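(* Let $q$ be a prime or a prime power with $q\equiv 1 \pmod 6$ and $q\neq 13$. Then there exists a regular Fano Kaleidoscope of order $q$ (a regular FK$(q)$).
   Context: For an ordered 7-tuple $B=(b_0,\dots,b_6)$ of distinct points, its $i$-th line is $\ell_i(B)=\{b_i,b_{i+1},b_{i+3}\}$ (indices mod 7), $0\le i\le 6$; the pair $(B,\{\ell_i(B)\})$ is a Fano plane (the unique 2-$(7,3,1)$ design). A Fano Kaleidoscope of order $v$, FK$(v)$, is a set $\mathcal F$ of Fano planes whose points lie in a $v$-set $\mathcal V$, where the seven lines of each plane are colored with seven distinct colors $c_0,\dots,c_6$, such that for any two distinct points $x,y\in\mathcal V$ and any color $c_i$ there is exactly one plane of $\mathcal F$ whose $c_i$-colored line contains $x$ and $y$. For a group $G$ of order $v$, an FK$(v)$ is $G$-regular if $G$ acts sharply transitively on $\mathcal V$ (so $\mathcal V$ is identified with $G$) and $G$ (acting by translation) leaves the collection of colored planes invariant; "regular" means $G$-regular for some group $G$. *)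

theory Defs
  imports
    "HOL-Algebra.Group_Action"
    "HOL-Library.Numeral_Type"
    "HOL-Number_Theory.Cong"
    "HOL-Number_Theory.Prime_Powers"
begin

text \<open>
  The seven-element type \<open>7\<close>, whose arithmetic is modulo 7, indexes both the entries of
  7-tuples and the seven colors.
\<close>

definition fano_line :: "(7 \<Rightarrow> 'a) \<Rightarrow> 7 \<Rightarrow> 'a set" where
  "fano_line b i = {b i, b (i + 1), b (i + 3)}"

definition fano_plane :: "'a set \<Rightarrow> 'a set set \<Rightarrow> bool" where
  "fano_plane P L \<longleftrightarrow> (\<exists>b :: 7 \<Rightarrow> 'a. inj b \<and> P = range b \<and> L = range (fano_line b))"

text \<open>
  A coloring of the lines with seven distinct colors is a bijection between lines and colors. It is
  recorded in the direction from colors to lines: \<open>color_line A c\<close> is the line of color \<open>c\<close>. It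
  need not agree with the indexing of the lines by any tuple that represents the plane.
\<close>

record 'a colored_plane =
  plane_points :: "'a set"
  color_line :: "7 \<Rightarrow> 'a set"

definition colored_fano_plane :: "'a colored_plane \<Rightarrow> bool" where
  "colored_fano_plane A \<longleftrightarrow>
     fano_plane (plane_points A) (range (color_line A)) \<and> inj (color_line A)"

definition fano_kaleidoscope :: "nat \<Rightarrow> 'a set \<Rightarrow> 'a colored_plane set \<Rightarrow> bool" where
  "fano_kaleidoscope v V F \<longleftrightarrow>
     finite V \<and> card V = v \<and>
     (\<forall>A\<in>F. colored_fano_plane A \<and> plane_points A \<subseteq> V) \<and>
     (\<forall>x\<in>V. \<forall>y\<in>V. x \<noteq> y \<longrightarrow> (\<forall>c. \<exists>!A. A \<in> F \<and> x \<in> color_line A c \<and> y \<in> color_line A c))"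

definition map_colored_plane :: "('a \<Rightarrow> 'b) \<Rightarrow> 'a colored_plane \<Rightarrow> 'b colored_plane" where
  "map_colored_plane f A =
     \<lparr>plane_points = f ` plane_points A, color_line = (\<lambda>c. f ` color_line A c)\<rparr>"

definition sharply_transitive_action ::
    "('g, 'm) monoid_scheme \<Rightarrow> 'a set \<Rightarrow> ('g \<Rightarrow> 'a \<Rightarrow> 'a) \<Rightarrow> bool" where
  "sharply_transitive_action G V \<phi> \<longleftrightarrow>
     group_action G V \<phi> \<and> (\<forall>x\<in>V. \<forall>y\<in>V. \<exists>!g. g \<in> carrier G \<and> \<phi> g x = y)"

definition group_regular_fano_kaleidoscope ::
    "('g, 'm) monoid_scheme \<Rightarrow> nat \<Rightarrow> 'a set \<Rightarrow> 'a colored_plane set \<Rightarrow> bool" where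
  "group_regular_fano_kaleidoscope G v V F \<longleftrightarrow>
     group G \<and> order G = v \<and> fano_kaleidoscope v V F \<and>
     (\<exists>\<phi>. sharply_transitive_action G V \<phi> \<and>
        (\<forall>g\<in>carrier G. map_colored_plane (\<phi> g) ` F = F))"

text \<open>
  The group is finite, so up to isomorphism its carrier may be taken to be a set of natural numbers.
\<close>

definition regular_fano_kaleidoscope :: "nat \<Rightarrow> 'a set \<Rightarrow> 'a colored_plane set \<Rightarrow> bool" where
  "regular_fano_kaleidoscope v V F \<longleftrightarrow>
     (\<exists>G :: nat monoid. group_regular_fano_kaleidoscope G v V F)"

lemma UNIV_7: "(UNIV :: 7 set) = {0, 1, 2, 3, 4, 5, 6}"
proof (rule sym, rule card_subset_eq)
  show "card {0, 1, 2, 3, 4, 5, 6 :: 7} = card (UNIV :: 7 set)" by simp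
qed simp_all

lemma fano_plane_is_design:
  assumes "fano_plane P L"
  shows "card P = 7" "card L = 7" "l \<in> L \<Longrightarrow> l \<subseteq> P \<and> card l = 3"
    "\<lbrakk>x \<in> P; y \<in> P; x \<noteq> y\<rbrakk> \<Longrightarrow> \<exists>!l. l \<in> L \<and> x \<in> l \<and> y \<in> l"
proof -
  from assms obtain b :: "7 \<Rightarrow> 'a"
    where b: "inj b" and P: "P = range b" and L: "L = range (fano_line b)"
    by (auto simp: fano_plane_def)
  have reduce: "(7 :: 7) = 0" "(8 :: 7) = 1" "(9 :: 7) = 2" by simp_all
  have cases7: "k \<in> {0, 1, 2, 3, 4, 5, 6}" for k :: 7
    by (metis UNIV_7 UNIV_I)
  have ex1: "\<exists>!k. b i \<in> fano_line b k \<and> b j \<in> fano_line b k" if "i \<noteq> j" for i j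
  proof -
    have "\<exists>k\<in>UNIV. (i = k \<or> i = k + 1 \<or> i = k + 3) \<and> (j = k \<or> j = k + 1 \<or> j = k + 3) \<and>
      (\<forall>m\<in>UNIV. (i = m \<or> i = m + 1 \<or> i = m + 3) \<and> (j = m \<or> j = m + 1 \<or> j = m + 3) \<longrightarrow> m = k)"
      using cases7[of i] cases7[of j] that
      unfolding UNIV_7
      by (elim insertE emptyE; simp add: reduce)
    then show ?thesis
      unfolding Ex1_def fano_line_def insert_iff empty_iff inj_eq[OF b] by blast
  qed
  show "card P = 7" by (simp add: P card_image[OF b])
  have "inj (fano_line b)"
  proof (rule injI)
    fix i j assume "fano_line b i = fano_line b j"
    moreover have "b i \<in> fano_line b i" "b (i + 1) \<in> fano_line b i"
      by (simp_all add: fano_line_def)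
    ultimately show "i = j" using ex1[of i "i + 1"] by auto
  qed
  then show "card L = 7" by (simp add: L card_image)
  show "l \<subseteq> P \<and> card l = 3" if "l \<in> L"
    using that by (auto simp: P L fano_line_def inj_eq[OF b])
  show "\<exists>!l. l \<in> L \<and> x \<in> l \<and> y \<in> l" if "x \<in> P" "y \<in> P" "x \<noteq> y"
  proof -
    from that obtain i j where ij: "x = b i" "y = b j" "i \<noteq> j" by (auto simp: P)
    from ex1[OF ij(3)] show ?thesis unfolding ij L by blast
  qed
qed

end

theory Submission
  imports Defs "HOL-Analysis.L2_Norm" "HOL-Algebra.Weak_Morphisms" "HOL-Number_Theory.Residues"
begin

text \<open>
  Over a field of order \<open>q \<equiv> 1 (mod 6)\<close>, call three points rainbow if their pairwise differences lie in
  three different cosets of the nonzero cubes. If all seven lines of a 7-tuple are rainbow, then its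
  multiples by representatives of the nonzero cubes modulo \<open>-1\<close> have, for each color, every nonzero
  difference exactly once, and their translates form a regular Fano Kaleidoscope. Such difference
  families multiply, so it suffices to treat the fields of order \<open>p\<close> for primes \<open>p \<equiv> 1 (mod 6)\<close> other than 13,
  those of order \<open>p\<^sup>2\<close> for \<open>p \<equiv> 5 (mod 6)\<close>, and those of order \<open>13\<^sup>2\<close> and \<open>13\<^sup>3\<close>.

  For \<open>q \<ge> 6400\<close> rainbow 7-tuples exist by a second moment argument that avoids the Weil bound.
  Deleting the line \<open>{b\<^sub>0, b\<^sub>1, b\<^sub>3}\<close> leaves four points; each of the three deleted points
  completes two lines whose other points form one of the three perfect matchings of these four. Affine
  2-transitivity makes the variance of the number of completions of a random matching exactly
  computable, and it is so small that some four points leave three sets of at least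
  \<open>3 \<surd>q + 1\<close> candidates. Orthogonality of the cubic character then gives a rainbow triple across
  these sets. The remaining fields are settled by explicit 7-tuples.
\<close>

text \<open>Modulo 6 the hypothesis makes \<open>(q - 1) / 3\<close> even, so -1 is a cube and a
  line has its six differences in three cosets, two of opposite sign in each. This is why a rainbow
  line needs exactly one multiplier from each pair \<open>s\<close>, \<open>-s\<close>. The obstacle
  for large \<open>q\<close> is the size of a candidate set: the points that complete two lines over
  four given points form a joint condition on cubic characters at several shifts, and orthogonality
  of a single character does not control it for given points. Averaged over all choices of the four
  points, the first two moments involve only counts around one or two points, and these are constant
  by 2-transitivity. Orthogonality is then needed only across three sets that are already large
  compared with \<open>sqrt q\<close>. The bound 6400 is the square of 80, slightly above the point
  where the resulting inequality starts to hold. It also bounds the finite work: primes below 6400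
  and squares of primes below 80. A prime \<open>p \<equiv> 5 (mod 6)\<close> enters only with even
  exponent, hence through its square.\<close>

definition seven :: "'a \<Rightarrow> 'a \<Rightarrow> 'a \<Rightarrow> 'a \<Rightarrow> 'a \<Rightarrow> 'a \<Rightarrow> 'a \<Rightarrow> 7 \<Rightarrow> 'a" where
  "seven x0 x1 x2 x3 x4 x5 x6 i = (if i = 0 then x0 else if i = 1 then x1 else if i = 2 then x2
     else if i = 3 then x3 else if i = 4 then x4 else if i = 5 then x5 else x6)"

lemma all_7: "(\<forall>i :: 7. P i) \<longleftrightarrow> P 0 \<and> P 1 \<and> P 2 \<and> P 3 \<and> P 4 \<and> P 5 \<and> P 6"
proof -
  have "(\<forall>i :: 7. P i) \<longleftrightarrow> (\<forall>i\<in>UNIV. P i)" by simp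
  then show ?thesis unfolding UNIV_7 by simp
qed

definition all_lines :: "('a \<Rightarrow> 'a \<Rightarrow> 'a \<Rightarrow> bool) \<Rightarrow> 'a \<Rightarrow> 'a \<Rightarrow> 'a \<Rightarrow> 'a \<Rightarrow> 'a \<Rightarrow> 'a \<Rightarrow> 'a \<Rightarrow> bool" where
  "all_lines P x0 x1 x2 x3 x4 x5 x6 \<longleftrightarrow> P x0 x1 x3 \<and> P x1 x2 x4 \<and> P x2 x3 x5 \<and> P x3 x4 x6 \<and>
     P x4 x5 x0 \<and> P x5 x6 x1 \<and> P x6 x0 x2"

lemma all_lines_seven:
  fixes x0 x1 x2 x3 x4 x5 x6 :: 'a
  defines "b \<equiv> seven x0 x1 x2 x3 x4 x5 x6"
  shows "(\<forall>i. P (b i) (b (i + 1)) (b (i + 3))) \<longleftrightarrow> all_lines P x0 x1 x2 x3 x4 x5 x6"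
proof -
  have reduce: "(7 :: 7) = 0" "(8 :: 7) = 1" "(9 :: 7) = 2" by simp_all
  show ?thesis by (simp add: all_7 b_def seven_def all_lines_def reduce)
qed

section \<open>Rainbow triples from cubic characters\<close>

lemma cube_root_unity_cases:
  fixes u :: complex
  assumes "u ^ 3 = 1"
  shows "u = 1 \<or> u = Complex (-1/2) (sqrt 3 / 2) \<or> u = Complex (-1/2) (- sqrt 3 / 2)"
proof -
  have "(u - 1) * ((u - Complex (-1/2) (sqrt 3 / 2)) * (u - Complex (-1/2) (- sqrt 3 / 2))) = u ^ 3 - 1"
  proof -
    have s: "Complex (-1/2) (sqrt 3 / 2) + Complex (-1/2) (- sqrt 3 / 2) = -1"
      "Complex (-1/2) (sqrt 3 / 2) * Complex (-1/2) (- sqrt 3 / 2) = 1"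
      by (simp_all add: complex_eq_iff)
    have "(u - a) * (u - b) = u\<^sup>2 - (a + b) * u + a * b" for a b :: complex
      by (simp add: power2_eq_square algebra_simps)
    then have "(u - Complex (-1/2) (sqrt 3 / 2)) * (u - Complex (-1/2) (- sqrt 3 / 2)) = u\<^sup>2 + u + 1"
      by (simp only: s) simp
    then show ?thesis by (simp add: power2_eq_square power3_eq_cube algebra_simps)
  qed
  then show ?thesis using assms by auto
qed

definition rainbow3 :: "'b \<Rightarrow> 'b \<Rightarrow> 'b \<Rightarrow> bool" where
  "rainbow3 u v w \<longleftrightarrow> u \<noteq> v \<and> v \<noteq> w \<and> u \<noteq> w"

text \<open>This is the Fourier expansion of the rainbow indicator on triples of cube roots of
  unity. The constant term 2/9 is the proportion 6/27 of rainbow triples. Written with real parts,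
  it also makes sense when some entries are 0, as happens for coinciding points.\<close>

definition rainbow_weight :: "complex \<Rightarrow> complex \<Rightarrow> complex \<Rightarrow> real" where
  "rainbow_weight u v w = 2/9 + 4/9 * Re (u * v * w)
     - 2/9 * (Re (u * cnj v) + Re (v * cnj w) + Re (u * cnj w))"

lemma rainbow_weight_cube_roots:
  assumes "u ^ 3 = 1" "v ^ 3 = 1" "w ^ 3 = 1"
  shows "rainbow_weight u v w = of_bool (rainbow3 u v w)"
proof -
  define a b where "a = Complex (-1/2) (sqrt 3 / 2)" and "b = Complex (-1/2) (- sqrt 3 / 2)"
  have tab: "a * a = b" "b * b = a" "a * b = 1" "b * a = 1" "cnj a = b" "cnj b = a"
    "a \<noteq> 1" "b \<noteq> 1" "a \<noteq> b" "Re a = -1/2" "Re b = -1/2"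
    by (auto simp: a_def b_def complex_eq_iff)
  have "u \<in> {1, a, b}" "v \<in> {1, a, b}" "w \<in> {1, a, b}"
    using assms[THEN cube_root_unity_cases] unfolding a_def b_def by auto
  then show ?thesis
    unfolding rainbow_weight_def rainbow3_def
    by (elim insertE emptyE; simp add: tab tab(7-9)[symmetric] del: times_complex.sel)
qed

lemma cauchy_schwarz_complex:
  fixes f g :: "'a \<Rightarrow> complex"
  assumes "(\<Sum>x\<in>A. (norm (f x))\<^sup>2) \<le> a" "(\<Sum>x\<in>A. (norm (g x))\<^sup>2) \<le> b"
  shows "norm (\<Sum>x\<in>A. f x * g x) \<le> sqrt a * sqrt b"
proof -
  have "norm (\<Sum>x\<in>A. f x * g x) \<le> (\<Sum>x\<in>A. \<bar>norm (f x)\<bar> * \<bar>norm (g x)\<bar>)"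
    by (rule order_trans[OF norm_sum]) (simp add: norm_mult)
  also have "\<dots> \<le> L2_set (\<lambda>x. norm (f x)) A * L2_set (\<lambda>x. norm (g x)) A"
    by (rule L2_set_mult_ineq)
  also have "\<dots> \<le> sqrt a * sqrt b"
    unfolding L2_set_def using assms
    by (intro mult_mono real_sqrt_le_mono) (auto intro!: sum_nonneg order_trans[OF _ assms(1)])
  finally show ?thesis .
qed

text \<open>The model is the cubic character of \<open>x - y\<close> in a field. In matrix terms
  \<open>orth\<close> says, together with the unit entries off the diagonal, that
  \<open>\<psi>\<close> times its adjoint is \<open>q\<close> times the identity minus the all-ones
  matrix.\<close>

locale cubic_scheme =
  fixes V :: "'a set" and \<psi> :: "'a \<Rightarrow> 'a \<Rightarrow> complex"
  assumes finite_V: "finite V"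
    and sym: "\<lbrakk>x \<in> V; y \<in> V\<rbrakk> \<Longrightarrow> \<psi> x y = \<psi> y x"
    and diag: "x \<in> V \<Longrightarrow> \<psi> x x = 0"
    and cube: "\<lbrakk>x \<in> V; y \<in> V; x \<noteq> y\<rbrakk> \<Longrightarrow> \<psi> x y ^ 3 = 1"
    and orth: "\<lbrakk>x \<in> V; y \<in> V; x \<noteq> y\<rbrakk> \<Longrightarrow> (\<Sum>z\<in>V. \<psi> x z * cnj (\<psi> y z)) = -1"
begin

abbreviation q :: nat where "q \<equiv> card V"

definition rb :: "'a \<Rightarrow> 'a \<Rightarrow> 'a \<Rightarrow> bool" where
  "rb x y z \<longleftrightarrow> rainbow3 (\<psi> x y) (\<psi> y z) (\<psi> x z)"

lemma rb_perm:
  assumes "x \<in> V" "y \<in> V" "z \<in> V"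
  shows "rb x y z \<longleftrightarrow> rb y x z" "rb x y z \<longleftrightarrow> rb x z y"
  using sym assms unfolding rb_def rainbow3_def by metis+

lemma rb_distinct:
  assumes "rb x y z" "x \<in> V" "y \<in> V" "z \<in> V"
  shows "x \<noteq> y" "y \<noteq> z" "x \<noteq> z"
  using assms sym unfolding rb_def rainbow3_def by auto

lemma norm_psi:
  assumes "x \<in> V" "y \<in> V" "x \<noteq> y"
  shows "norm (\<psi> x y) = 1"
proof -
  have "norm (\<psi> x y) ^ 3 = 1" by (metis cube[OF assms] norm_power norm_one)
  then show ?thesis
    by (intro power_eq_imp_eq_base[of _ 3 1]) auto
qed

lemma norm_psi_le:
  assumes "x \<in> V" "y \<in> V"
  shows "norm (\<psi> x y) \<le> 1"
  using assms norm_psi diag by (cases "x = y") auto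

lemma cnj_psi:
  assumes "x \<in> V" "y \<in> V" "x \<noteq> y"
  shows "\<psi> x y * cnj (\<psi> x y) = 1"
  using norm_psi[OF assms] by (metis complex_norm_square of_real_1 power_one)

text \<open>If exactly two of the points coincide, one value vanishes and the other two agree by
  symmetry, so the single surviving pair term cancels the constant 2/9. Only the triple
  \<open>x = y = z\<close> keeps the constant, hence the correction.\<close>

lemma weight_eq:
  assumes "x \<in> V" "y \<in> V" "z \<in> V"
  shows "rainbow_weight (\<psi> x y) (\<psi> y z) (\<psi> x z) =
    of_bool (rb x y z) + 2/9 * of_bool (x = y \<and> y = z)"
proof -
  consider "x \<noteq> y" "y \<noteq> z" "x \<noteq> z" | "x = y" "y = z" | "x = y" "y \<noteq> z" | "x = z" "x \<noteq> y"
    | "y = z" "x \<noteq> y" by blast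
  then show ?thesis
  proof cases
    case 1
    then show ?thesis
      using rainbow_weight_cube_roots[of "\<psi> x y" "\<psi> y z" "\<psi> x z"] cube assms
      by (simp add: rb_def)
  next
    case 2
    then show ?thesis using rb_distinct assms
      by (auto simp: rainbow_weight_def diag)
  next
    case 3
    then show ?thesis using rb_distinct(1)[of x y z] cnj_psi[of y z] assms
      by (auto simp: rainbow_weight_def diag)
  next
    case 4
    then show ?thesis using rb_distinct(3)[of x y z] cnj_psi[of x y] sym[of y x] assms
      by (auto simp: rainbow_weight_def diag)
  next
    case 5
    then show ?thesis using rb_distinct(2)[of x y z] cnj_psi[of x y] assms
      by (auto simp: rainbow_weight_def diag)
  qed
qed

section \<open>Spectral bounds from the Gram matrix\<close>

lemma gram:
  assumes "x \<in> V" "y \<in> V"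
  shows "(\<Sum>z\<in>V. \<psi> z x * cnj (\<psi> z y)) = (if x = y then of_nat q - 1 else -1)"
proof (cases "x = y")
  case True
  have "(\<Sum>z\<in>V. \<psi> z x * cnj (\<psi> z y)) = (\<Sum>z\<in>V - {x}. 1)"
    using True assms finite_V
    by (subst sum.remove[of _ x]) (auto simp: diag cnj_psi simp del: sum_constant intro!: sum.cong)
  also have "\<dots> = of_nat q - 1"
    using assms finite_V card_gt_0_iff[of V] by (auto simp: of_nat_diff Suc_le_eq)
  finally show ?thesis using True by simp
next
  case False
  have "(\<Sum>z\<in>V. \<psi> z x * cnj (\<psi> z y)) = (\<Sum>z\<in>V. \<psi> x z * cnj (\<psi> y z))"
    using assms sym by (intro sum.cong) auto
  then show ?thesis using False orth assms by simp
qed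

text \<open>The Gram matrix is \<open>q\<close> times the identity minus the all-ones matrix, and
  the latter contributes minus the squared norm of the sum of the coefficients, which may be
  dropped. So \<open>\<psi>\<close> has operator norm at most \<open>sqrt q\<close>.\<close>

lemma large_sieve:
  assumes "A \<subseteq> V"
  shows "(\<Sum>y\<in>V. (norm (\<Sum>z\<in>A. a z * \<psi> y z))\<^sup>2) \<le> real q * (\<Sum>z\<in>A. (norm (a z))\<^sup>2)"
proof -
  have fA: "finite A" using assms finite_V finite_subset by blast
  have "complex_of_real (\<Sum>y\<in>V. (norm (\<Sum>z\<in>A. a z * \<psi> y z))\<^sup>2)
      = (\<Sum>y\<in>V. (\<Sum>z\<in>A. a z * \<psi> y z) * cnj (\<Sum>z\<in>A. a z * \<psi> y z))"
    by (simp only: of_real_sum complex_norm_square)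
  also have "\<dots> = (\<Sum>y\<in>V. \<Sum>z\<in>A. \<Sum>w\<in>A. (a z * cnj (a w)) * (\<psi> y z * cnj (\<psi> y w)))"
    by (simp add: sum_product algebra_simps)
  also have "\<dots> = (\<Sum>z\<in>A. \<Sum>w\<in>A. \<Sum>y\<in>V. (a z * cnj (a w)) * (\<psi> y z * cnj (\<psi> y w)))"
    by (subst sum.swap) (rule sum.cong[OF refl], rule sum.swap)
  also have "\<dots> = (\<Sum>z\<in>A. \<Sum>w\<in>A. (a z * cnj (a w)) * (if z = w then of_nat q - 1 else -1))"
    using assms by (intro sum.cong refl) (simp only: sum_distrib_left[symmetric] gram subsetD)
  also have "\<dots> = (\<Sum>z\<in>A. \<Sum>w\<in>A. (if z = w then of_nat q * (a z * cnj (a z)) else 0) - a z * cnj (a w))"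
    by (intro sum.cong refl) (auto simp: algebra_simps)
  also have "\<dots> = of_nat q * (\<Sum>z\<in>A. a z * cnj (a z)) - (\<Sum>z\<in>A. a z) * cnj (\<Sum>z\<in>A. a z)"
    using fA by (simp add: sum_subtractf sum_distrib_left[symmetric] sum_distrib_right[symmetric])
  also have "\<dots> = complex_of_real (real q * (\<Sum>z\<in>A. (norm (a z))\<^sup>2) - (norm (\<Sum>z\<in>A. a z))\<^sup>2)"
    by (simp only: of_real_diff of_real_mult of_real_sum complex_norm_square of_real_of_nat_eq)
  finally have "(\<Sum>y\<in>V. (norm (\<Sum>z\<in>A. a z * \<psi> y z))\<^sup>2)
      = real q * (\<Sum>z\<in>A. (norm (a z))\<^sup>2) - (norm (\<Sum>z\<in>A. a z))\<^sup>2"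
    using of_real_eq_iff by blast
  then show ?thesis by simp
qed

lemma sieve_subset:
  assumes "A \<subseteq> V" "B \<subseteq> V" "\<And>z. z \<in> A \<Longrightarrow> norm (a z) \<le> 1"
  shows "(\<Sum>y\<in>B. (norm (\<Sum>z\<in>A. a z * \<psi> y z))\<^sup>2) \<le> real q * real (card A)"
proof -
  have "(\<Sum>y\<in>B. (norm (\<Sum>z\<in>A. a z * \<psi> y z))\<^sup>2) \<le> (\<Sum>y\<in>V. (norm (\<Sum>z\<in>A. a z * \<psi> y z))\<^sup>2)"
    using assms finite_V by (intro sum_mono2) auto
  also have "\<dots> \<le> real q * (\<Sum>z\<in>A. (norm (a z))\<^sup>2)" by (rule large_sieve[OF assms(1)])
  also have "\<dots> \<le> real q * (\<Sum>z\<in>A. 1)"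
    using assms(3) by (intro mult_left_mono sum_mono) (auto simp: power_le_one)
  finally show ?thesis by simp
qed

text \<open>With \<open>x\<close> fixed, \<open>\<psi> x z\<close> serves as a coefficient of
  modulus at most 1 in the sieve over \<open>z\<close>, and Cauchy-Schwarz handles the sum over
  \<open>y\<close>. The sum over \<open>x\<close> is estimated trivially.\<close>

lemma triple_product_bound:
  assumes "A \<subseteq> V" "B \<subseteq> V" "C \<subseteq> V"
  shows "norm (\<Sum>x\<in>A. \<Sum>y\<in>B. \<Sum>z\<in>C. \<psi> x y * \<psi> y z * \<psi> x z)
    \<le> real (card A) * (sqrt (card B) * sqrt (real q * card C))"
proof -
  have *: "norm (\<Sum>y\<in>B. \<psi> x y * (\<Sum>z\<in>C. \<psi> x z * \<psi> y z)) \<le> sqrt (card B) * sqrt (real q * card C)"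
    if "x \<in> A" for x
  proof (rule cauchy_schwarz_complex)
    have "(\<Sum>y\<in>B. (norm (\<psi> x y))\<^sup>2) \<le> (\<Sum>y\<in>B. 1)"
      using norm_psi_le that assms by (intro sum_mono) (auto simp: power_le_one subset_iff)
    then show "(\<Sum>y\<in>B. (norm (\<psi> x y))\<^sup>2) \<le> card B" by simp
    show "(\<Sum>y\<in>B. (norm (\<Sum>z\<in>C. \<psi> x z * \<psi> y z))\<^sup>2) \<le> real q * card C"
      using norm_psi_le that assms by (intro sieve_subset) (auto simp: subset_iff)
  qed
  have "(\<Sum>x\<in>A. \<Sum>y\<in>B. \<Sum>z\<in>C. \<psi> x y * \<psi> y z * \<psi> x z)
      = (\<Sum>x\<in>A. \<Sum>y\<in>B. \<psi> x y * (\<Sum>z\<in>C. \<psi> x z * \<psi> y z))"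
    by (simp add: sum_distrib_left mult_ac)
  then show ?thesis
    using sum_norm_le[of A, OF *] by simp
qed

text \<open>The summand is a path with middle vertex \<open>y\<close>. For fixed \<open>y\<close>
  the two ends separate, so Cauchy-Schwarz over \<open>y\<close> allows the sieve to be applied to
  both ends.\<close>

lemma path_product_bound:
  assumes "A \<subseteq> V" "B \<subseteq> V" "C \<subseteq> V"
  shows "norm (\<Sum>y\<in>B. \<Sum>x\<in>A. \<Sum>z\<in>C. \<psi> y x * cnj (\<psi> y z))
    \<le> sqrt (real q * card A) * sqrt (real q * card C)"
proof -
  have 1: "(\<Sum>y\<in>B. (norm (\<Sum>x\<in>A. \<psi> y x))\<^sup>2) \<le> real q * card A" if "A \<subseteq> V" for A
    using sieve_subset[OF that assms(2), of "\<lambda>_. 1"] by simp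
  have "norm (\<Sum>y\<in>B. (\<Sum>x\<in>A. \<psi> y x) * cnj (\<Sum>z\<in>C. \<psi> y z))
      \<le> sqrt (real q * card A) * sqrt (real q * card C)"
    using 1[OF assms(1)] 1[OF assms(3)] by (intro cauchy_schwarz_complex) (simp_all del: cnj_sum)
  then show ?thesis by (simp add: sum_product)
qed

section \<open>Rainbow triples across three sets\<close>

definition rb_sum :: "'a set \<Rightarrow> 'a set \<Rightarrow> 'a set \<Rightarrow> real" where
  "rb_sum A B C = (\<Sum>x\<in>A. \<Sum>y\<in>B. \<Sum>z\<in>C. rainbow_weight (\<psi> x y) (\<psi> y z) (\<psi> x z))"

text \<open>Each of the three pair terms is rearranged around the vertex that its two edges share,
  which is the form that the path bound expects.\<close>

lemma rb_sum_expand: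
  assumes "A \<subseteq> V" "B \<subseteq> V" "C \<subseteq> V"
  shows "rb_sum A B C = 2/9 * (real (card A) * real (card B) * real (card C))
    + 4/9 * Re (\<Sum>x\<in>A. \<Sum>y\<in>B. \<Sum>z\<in>C. \<psi> x y * \<psi> y z * \<psi> x z)
    - 2/9 * (Re (\<Sum>y\<in>B. \<Sum>x\<in>A. \<Sum>z\<in>C. \<psi> y x * cnj (\<psi> y z))
      + Re (\<Sum>z\<in>C. \<Sum>y\<in>B. \<Sum>x\<in>A. \<psi> z y * cnj (\<psi> z x))
      + Re (\<Sum>x\<in>A. \<Sum>y\<in>B. \<Sum>z\<in>C. \<psi> x y * cnj (\<psi> x z)))"
proof -
  have sym': "\<psi> x y = \<psi> y x" if "x \<in> A \<union> B \<union> C" "y \<in> A \<union> B \<union> C" for x y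
    using that sym assms by blast
  have 1: "(\<Sum>y\<in>B. \<Sum>x\<in>A. \<Sum>z\<in>C. \<psi> y x * cnj (\<psi> y z)) = (\<Sum>x\<in>A. \<Sum>y\<in>B. \<Sum>z\<in>C. \<psi> x y * cnj (\<psi> y z))"
    by (rule trans[OF sum.swap]) (intro sum.cong refl arg_cong2[where f = "(*)"] sym', auto)
  have "(\<Sum>z\<in>C. \<Sum>y\<in>B. \<Sum>x\<in>A. \<psi> z y * cnj (\<psi> z x)) = (\<Sum>y\<in>B. \<Sum>z\<in>C. \<Sum>x\<in>A. \<psi> z y * cnj (\<psi> z x))"
    by (rule sum.swap)
  also have "\<dots> = (\<Sum>y\<in>B. \<Sum>x\<in>A. \<Sum>z\<in>C. \<psi> z y * cnj (\<psi> z x))"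
    by (intro sum.cong refl sum.swap)
  also have "\<dots> = (\<Sum>x\<in>A. \<Sum>y\<in>B. \<Sum>z\<in>C. \<psi> z y * cnj (\<psi> z x))"
    by (rule sum.swap)
  also have "\<dots> = (\<Sum>x\<in>A. \<Sum>y\<in>B. \<Sum>z\<in>C. \<psi> y z * cnj (\<psi> x z))"
    by (intro sum.cong refl arg_cong2[where f = "(*)"] arg_cong[where f = cnj] sym') auto
  finally have 2: "(\<Sum>z\<in>C. \<Sum>y\<in>B. \<Sum>x\<in>A. \<psi> z y * cnj (\<psi> z x)) = \<dots>" .
  show ?thesis
    unfolding 1 2 rb_sum_def rainbow_weight_def
    by (simp only: sum.distrib sum_subtractf sum_distrib_left[where r = "2/9 :: real", symmetric]
        sum_distrib_left[where r = "4/9 :: real", symmetric] Re_sum sum_constant)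
qed

lemma rb_sum_lower:
  assumes "A \<subseteq> V" "B \<subseteq> V" "C \<subseteq> V" "card A = a" "card B = a" "card C = a"
  shows "rb_sum A B C \<ge> 2/9 * (real a ^ 3 - 2 * sqrt q * real a ^ 2 - 3 * real q * real a)"
proof -
  have s: "sqrt (real a) * sqrt (real q * real a) = sqrt q * real a"
    "sqrt (real q * real a) * sqrt (real q * real a) = real q * real a"
    by (simp_all add: real_sqrt_mult[symmetric]) (simp add: real_sqrt_mult)
  have "Re (\<Sum>x\<in>A. \<Sum>y\<in>B. \<Sum>z\<in>C. \<psi> x y * \<psi> y z * \<psi> x z) \<ge> - (real a * (sqrt q * real a))"
    using abs_Re_le_cmod[of "\<Sum>x\<in>A. \<Sum>y\<in>B. \<Sum>z\<in>C. \<psi> x y * \<psi> y z * \<psi> x z"]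
      triple_product_bound[OF assms(1-3)] unfolding assms s by linarith
  moreover have "Re (\<Sum>y\<in>B. \<Sum>x\<in>A. \<Sum>z\<in>C. \<psi> y x * cnj (\<psi> y z)) \<le> real q * a"
    using complex_Re_le_cmod[of "\<Sum>y\<in>B. \<Sum>x\<in>A. \<Sum>z\<in>C. \<psi> y x * cnj (\<psi> y z)"]
      path_product_bound[OF assms(1-3)] unfolding assms s by linarith
  moreover have "Re (\<Sum>z\<in>C. \<Sum>y\<in>B. \<Sum>x\<in>A. \<psi> z y * cnj (\<psi> z x)) \<le> real q * a"
    using complex_Re_le_cmod[of "\<Sum>z\<in>C. \<Sum>y\<in>B. \<Sum>x\<in>A. \<psi> z y * cnj (\<psi> z x)"]
      path_product_bound[OF assms(2,3,1)] unfolding assms s by linarith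
  moreover have "Re (\<Sum>x\<in>A. \<Sum>y\<in>B. \<Sum>z\<in>C. \<psi> x y * cnj (\<psi> x z)) \<le> real q * a"
    using complex_Re_le_cmod[of "\<Sum>x\<in>A. \<Sum>y\<in>B. \<Sum>z\<in>C. \<psi> x y * cnj (\<psi> x z)"]
      path_product_bound[OF assms(2,1,3)] unfolding assms s by linarith
  ultimately show ?thesis
    unfolding rb_sum_expand[OF assms(1-3)] assms(4-6)
    by (simp add: power2_eq_square power3_eq_cube algebra_simps)
qed

lemma rb_sum_count:
  assumes "A \<subseteq> V" "B \<subseteq> V" "C \<subseteq> V"
  shows "rb_sum A B C = (\<Sum>x\<in>A. \<Sum>y\<in>B. \<Sum>z\<in>C. of_bool (rb x y z)) + 2/9 * real (card (A \<inter> B \<inter> C))"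
proof -
  have fin: "finite A" "finite B" "finite C" using assms finite_V finite_subset by blast+
  have "(\<Sum>x\<in>A. \<Sum>y\<in>B. \<Sum>z\<in>C. of_bool (x = y \<and> y = z)) = (\<Sum>x\<in>A. of_bool (x \<in> B \<and> x \<in> C) :: real)"
  proof (intro sum.cong refl)
    fix x
    have "(\<Sum>y\<in>B. \<Sum>z\<in>C. of_bool (x = y \<and> y = z)) = (\<Sum>y\<in>B. if x = y then (\<Sum>z\<in>C. if x = z then 1 else 0) else (0::real))"
      by (intro sum.cong refl) (auto simp: of_bool_def)
    then show "(\<Sum>y\<in>B. \<Sum>z\<in>C. of_bool (x = y \<and> y = z)) = (of_bool (x \<in> B \<and> x \<in> C) :: real)"
      using fin by simp
  qed
  also have "\<dots> = real (card (A \<inter> B \<inter> C))"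
    using fin by (simp add: sum.If_cases of_bool_def Int_def conj_assoc)
  finally have *: "(\<Sum>x\<in>A. \<Sum>y\<in>B. \<Sum>z\<in>C. of_bool (x = y \<and> y = z)) = real (card (A \<inter> B \<inter> C))" .
  have "rb_sum A B C = (\<Sum>x\<in>A. \<Sum>y\<in>B. \<Sum>z\<in>C. of_bool (rb x y z) + 2/9 * of_bool (x = y \<and> y = z))"
    unfolding rb_sum_def using weight_eq assms by (intro sum.cong refl) (simp add: subset_iff)
  then show ?thesis
    by (simp only: sum.distrib sum_distrib_left[symmetric] *)
qed

text \<open>With \<open>s = sqrt q\<close>, the main term minus the errors is \<open>a\<close> times
  \<open>(a - 3 * s) * (a + s)\<close>, up to the factor 2/9. For \<open>a \<ge> 3 * s + 1\<close>
  the product is at least \<open>4 * s + 1\<close>, whereas without a rainbow triple only the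
  diagonal correction remains, which allows at most 1. The sets may overlap.\<close>

lemma rainbow_triple_of_card:
  assumes "A \<subseteq> V" "B \<subseteq> V" "C \<subseteq> V" "card A = a" "card B = a" "card C = a"
    and a: "real a \<ge> 3 * sqrt q + 1"
  shows "\<exists>x\<in>A. \<exists>y\<in>B. \<exists>z\<in>C. rb x y z"
proof (rule ccontr)
  assume no: "\<not> ?thesis"
  then have "(\<Sum>x\<in>A. \<Sum>y\<in>B. \<Sum>z\<in>C. of_bool (rb x y z)) = (0::real)"
    by (intro sum.neutral ballI) auto
  then have "rb_sum A B C = 2/9 * real (card (A \<inter> B \<inter> C))"
    using rb_sum_count[OF assms(1-3)] by simp
  also have "\<dots> \<le> 2/9 * real a"
    using card_mono[of A "A \<inter> B \<inter> C"] assms finite_V by (auto dest: finite_subset)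
  finally have "real a ^ 3 - 2 * sqrt q * real a ^ 2 - 3 * real q * real a \<le> real a"
    using rb_sum_lower[OF assms(1-6)] by (simp add: field_simps)
  then have "real a * (real a ^ 2 - 2 * sqrt q * real a - 3 * real q) \<le> real a * 1"
    by (simp add: algebra_simps power2_eq_square power3_eq_cube)
  moreover have apos: "real a > 0" using a real_sqrt_ge_zero[of q] by linarith
  ultimately have le: "real a ^ 2 - 2 * sqrt q * real a - 3 * real q \<le> 1" by simp
  have "(2 * sqrt q + 1)\<^sup>2 \<le> (real a - sqrt q)\<^sup>2"
    using a real_sqrt_ge_zero[of q] by (intro power_mono) linarith+
  then have "4 * real q + 4 * sqrt q + 1 \<le> real a ^ 2 - 2 * sqrt q * real a + real q"
    by (simp add: power2_sum power2_diff power_mult_distrib algebra_simps)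
  moreover have "q > 0" using apos assms finite_V card_mono[of V A] by auto
  ultimately show False using le real_sqrt_gt_zero[of q] by linarith
qed

end

section \<open>Seven points by a second moment argument\<close>

text \<open>In a field the maps \<open>f\<close> are affine: they multiply all values of
  \<open>\<psi>\<close> by one nonzero constant. So they need not preserve \<open>\<psi>\<close>,
  only the relation \<open>rb\<close>.\<close>

locale homogeneous_cubic_scheme = cubic_scheme +
  assumes homog: "\<lbrakk>x \<in> V; y \<in> V; x \<noteq> y; x' \<in> V; y' \<in> V; x' \<noteq> y'\<rbrakk> \<Longrightarrow>
    \<exists>f. bij_betw f V V \<and> f x = x' \<and> f y = y' \<and>
      (\<forall>u\<in>V. \<forall>v\<in>V. \<forall>w\<in>V. rb (f u) (f v) (f w) \<longleftrightarrow> rb u v w)"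
begin

section \<open>Degrees, codegrees and completions of a matching\<close>

definition deg :: "'a \<Rightarrow> 'a \<Rightarrow> real" where
  "deg x y = (\<Sum>z\<in>V. of_bool (rb x y z))"

definition codeg :: "'a \<Rightarrow> 'a \<Rightarrow> real" where
  "codeg z w = (\<Sum>a\<in>V. \<Sum>b\<in>V. of_bool (rb z a b) * of_bool (rb w a b))"

lemma deg_diag: "x \<in> V \<Longrightarrow> deg x x = 0"
  using rb_distinct(1)[of x x] by (auto simp: deg_def intro!: sum.neutral)

lemma deg_const:
  assumes "x \<in> V" "y \<in> V" "x \<noteq> y" "x' \<in> V" "y' \<in> V" "x' \<noteq> y'"
  shows "deg x y = deg x' y'"
proof -
  obtain f where f: "bij_betw f V V" "f x = x'" "f y = y'"
    "\<And>u v w. \<lbrakk>u \<in> V; v \<in> V; w \<in> V\<rbrakk> \<Longrightarrow> rb (f u) (f v) (f w) \<longleftrightarrow> rb u v w"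
    using homog[OF assms] by blast
  have "deg x' y' = (\<Sum>z\<in>V. of_bool (rb x' y' (f z)))"
    unfolding deg_def by (rule sum.reindex_bij_betw[OF f(1), symmetric])
  also have "\<dots> = deg x y"
    unfolding deg_def using f(4) assms by (intro sum.cong refl) (simp flip: f(2,3))
  finally show ?thesis by simp
qed

lemma codeg_const:
  assumes "x \<in> V" "y \<in> V" "x \<noteq> y" "x' \<in> V" "y' \<in> V" "x' \<noteq> y'"
  shows "codeg x y = codeg x' y'"
proof -
  obtain f where f: "bij_betw f V V" "f x = x'" "f y = y'"
    "\<And>u v w. \<lbrakk>u \<in> V; v \<in> V; w \<in> V\<rbrakk> \<Longrightarrow> rb (f u) (f v) (f w) \<longleftrightarrow> rb u v w"
    using homog[OF assms] by blast
  have "codeg x' y' = (\<Sum>a\<in>V. \<Sum>b\<in>V. of_bool (rb x' (f a) b) * of_bool (rb y' (f a) b))"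
    unfolding codeg_def by (rule sum.reindex_bij_betw[OF f(1), symmetric])
  also have "\<dots> = (\<Sum>a\<in>V. \<Sum>b\<in>V. of_bool (rb x' (f a) (f b)) * of_bool (rb y' (f a) (f b)))"
    by (intro sum.cong refl sum.reindex_bij_betw[OF f(1), symmetric])
  also have "\<dots> = codeg x y"
    unfolding codeg_def using f(4) assms by (intro sum.cong refl) (simp flip: f(2,3))
  finally show ?thesis by simp
qed

definition ext :: "'a \<Rightarrow> 'a \<Rightarrow> 'a \<Rightarrow> 'a \<Rightarrow> real" where
  "ext a b c d = (\<Sum>z\<in>V. of_bool (rb z a b) * of_bool (rb z c d))"

section \<open>First and second moments of the number of completions\<close>

context
  fixes R :: real
  assumes R: "\<lbrakk>x \<in> V; y \<in> V; x \<noteq> y\<rbrakk> \<Longrightarrow> deg x y = R"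
begin

lemma codeg_diag:
  assumes "z \<in> V"
  shows "codeg z z = (real q - 1) * R"
proof -
  have "codeg z z = (\<Sum>a\<in>V. deg z a)"
    by (simp add: codeg_def deg_def of_bool_conj[symmetric])
  also have "\<dots> = (\<Sum>a\<in>V - {z}. R)"
    using assms finite_V R by (subst sum.remove[of _ z]) (auto simp: deg_diag simp del: sum_constant intro!: sum.cong)
  also have "\<dots> = (real q - 1) * R"
    using assms finite_V card_gt_0_iff[of V] by (auto simp: of_nat_diff Suc_le_eq)
  finally show ?thesis .
qed

text \<open>Summed over all \<open>w\<close>, the codegrees of \<open>z\<close> count each ordered
  pair \<open>(a, b)\<close> that is rainbow with \<open>z\<close> exactly
  \<open>deg a b = R\<close> times. This gives \<open>(q - 1) * R * R\<close>. The term
  \<open>w = z\<close> is known and the other \<open>q - 1\<close> terms are equal.\<close>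

lemma codeg_off_diag:
  assumes "z \<in> V" "w \<in> V" "z \<noteq> w"
  shows "codeg z w = R * (R - 1)"
proof -
  have q: "real q > 1"
    using card_mono[of V "{z, w}"] assms finite_V by auto
  have "(\<Sum>w'\<in>V. codeg z w') = (\<Sum>a\<in>V. \<Sum>w'\<in>V. \<Sum>b\<in>V. of_bool (rb z a b) * of_bool (rb w' a b))"
    unfolding codeg_def by (rule sum.swap)
  also have "\<dots> = (\<Sum>a\<in>V. \<Sum>b\<in>V. \<Sum>w'\<in>V. of_bool (rb z a b) * of_bool (rb w' a b))"
    by (intro sum.cong refl sum.swap)
  also have "\<dots> = (\<Sum>a\<in>V. \<Sum>b\<in>V. of_bool (rb z a b) * deg a b)"
    unfolding deg_def sum_distrib_left
    by (intro sum.cong refl arg_cong2[where f = "(*)"] arg_cong[where f = of_bool]) (metis rb_perm)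
  also have "\<dots> = (\<Sum>a\<in>V. \<Sum>b\<in>V. of_bool (rb z a b) * R)"
    using rb_distinct(2)[of z] assms R by (intro sum.cong refl) (auto simp: of_bool_def)
  also have "\<dots> = (\<Sum>a\<in>V. deg z a) * R"
    by (simp add: deg_def sum_distrib_right)
  also have "(\<Sum>a\<in>V. deg z a) = codeg z z"
    by (simp add: codeg_def deg_def of_bool_conj[symmetric])
  finally have "(\<Sum>w'\<in>V. codeg z w') = (real q - 1) * R * R"
    by (simp add: codeg_diag assms)
  moreover have "(\<Sum>w'\<in>V. codeg z w') = codeg z z + (\<Sum>w'\<in>V - {z}. codeg z w)"
    using assms finite_V
    by (subst sum.remove[of _ z]) (auto intro!: sum.cong codeg_const simp del: sum_constant)
  moreover have "(\<Sum>w'\<in>V - {z}. codeg z w) = (real q - 1) * codeg z w"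
    using assms finite_V card_gt_0_iff[of V] by (auto simp: of_nat_diff Suc_le_eq)
  ultimately have "(real q - 1) * (R + codeg z w) = (real q - 1) * (R * R)"
    using codeg_diag assms by (simp add: algebra_simps)
  then have "R + codeg z w = R * R" using q by simp
  then show ?thesis by (simp add: algebra_simps)
qed

text \<open>With the completing point \<open>z\<close> outermost, the two edges
  \<open>(a, b)\<close> and \<open>(c, d)\<close> are independent, and each contributes
  \<open>codeg z z\<close>.\<close>

lemma ext_sum:
  "(\<Sum>a\<in>V. \<Sum>b\<in>V. \<Sum>c\<in>V. \<Sum>d\<in>V. ext a b c d) = real q * ((real q - 1) * R)\<^sup>2"
proof -
  let ?g = "\<lambda>z (a, b). of_bool (rb z a b) :: real"
  have "(\<Sum>a\<in>V. \<Sum>b\<in>V. \<Sum>c\<in>V. \<Sum>d\<in>V. ext a b c d)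
      = (\<Sum>p\<in>V \<times> V. \<Sum>r\<in>V \<times> V. \<Sum>z\<in>V. ?g z p * ?g z r)"
    by (simp add: ext_def sum.cartesian_product')
  also have "\<dots> = (\<Sum>p\<in>V \<times> V. \<Sum>z\<in>V. \<Sum>r\<in>V \<times> V. ?g z p * ?g z r)"
    by (intro sum.cong refl sum.swap)
  also have "\<dots> = (\<Sum>z\<in>V. \<Sum>p\<in>V \<times> V. \<Sum>r\<in>V \<times> V. ?g z p * ?g z r)"
    by (rule sum.swap)
  also have "\<dots> = (\<Sum>z\<in>V. (\<Sum>p\<in>V \<times> V. ?g z p)\<^sup>2)"
    by (simp add: power2_eq_square sum_product)
  also have "\<dots> = (\<Sum>z\<in>V. (codeg z z)\<^sup>2)"
    by (simp add: codeg_def sum.cartesian_product' of_bool_conj[symmetric])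
  finally show ?thesis by (simp add: codeg_diag)
qed

text \<open>Squaring introduces two completing points \<open>z\<close> and \<open>w\<close>. Once
  they are fixed the two edges are again independent, each counted by \<open>codeg z w\<close>, so
  the whole second moment is determined by \<open>q\<close> and \<open>R\<close>.\<close>

lemma ext_square_sum:
  "(\<Sum>a\<in>V. \<Sum>b\<in>V. \<Sum>c\<in>V. \<Sum>d\<in>V. (ext a b c d)\<^sup>2)
    = real q * ((real q - 1) * R)\<^sup>2 + real q * (real q - 1) * (R * (R - 1))\<^sup>2"
proof -
  let ?g = "\<lambda>z (a, b). of_bool (rb z a b) :: real"
  let ?P = "V \<times> V"
  have "(\<Sum>a\<in>V. \<Sum>b\<in>V. \<Sum>c\<in>V. \<Sum>d\<in>V. (ext a b c d)\<^sup>2)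
      = (\<Sum>p\<in>?P. \<Sum>r\<in>?P. (\<Sum>z\<in>V. ?g z p * ?g z r)\<^sup>2)"
    by (simp add: ext_def sum.cartesian_product')
  also have "\<dots> = (\<Sum>p\<in>?P. \<Sum>r\<in>?P. \<Sum>z\<in>V. \<Sum>w\<in>V. (?g z p * ?g w p) * (?g z r * ?g w r))"
    unfolding power2_eq_square sum_product by (intro sum.cong refl) (simp only: mult_ac)
  also have "\<dots> = (\<Sum>p\<in>?P. \<Sum>r\<in>?P. \<Sum>t\<in>?P. (?g (fst t) p * ?g (snd t) p) * (?g (fst t) r * ?g (snd t) r))"
    by (simp only: sum.cartesian_product split_def)
  also have "\<dots> = (\<Sum>p\<in>?P. \<Sum>t\<in>?P. \<Sum>r\<in>?P. (?g (fst t) p * ?g (snd t) p) * (?g (fst t) r * ?g (snd t) r))"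
    by (intro sum.cong refl sum.swap)
  also have "\<dots> = (\<Sum>t\<in>?P. \<Sum>p\<in>?P. \<Sum>r\<in>?P. (?g (fst t) p * ?g (snd t) p) * (?g (fst t) r * ?g (snd t) r))"
    by (rule sum.swap)
  also have "\<dots> = (\<Sum>t\<in>?P. (\<Sum>p\<in>?P. ?g (fst t) p * ?g (snd t) p)\<^sup>2)"
    by (simp only: power2_eq_square sum_product)
  also have "\<dots> = (\<Sum>z\<in>V. \<Sum>w\<in>V. (codeg z w)\<^sup>2)"
    by (simp add: codeg_def sum.cartesian_product split_def)
  also have "\<dots> = (\<Sum>z\<in>V. ((real q - 1) * R)\<^sup>2 + (real q - 1) * (R * (R - 1))\<^sup>2)"
  proof (intro sum.cong refl)
    fix z assume z: "z \<in> V"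
    have "(\<Sum>w\<in>V. (codeg z w)\<^sup>2) = (codeg z z)\<^sup>2 + (\<Sum>w\<in>V - {z}. (R * (R - 1))\<^sup>2)"
      using z finite_V
      by (subst sum.remove[of _ z])
        (auto simp del: sum_constant intro!: sum.cong arg_cong[where f = "\<lambda>x. x\<^sup>2"] codeg_off_diag)
    also have "(\<Sum>w\<in>V - {z}. (R * (R - 1))\<^sup>2) = (real q - 1) * (R * (R - 1))\<^sup>2"
      using z finite_V card_gt_0_iff[of V] by (auto simp: of_nat_diff Suc_le_eq)
    finally show "(\<Sum>w\<in>V. (codeg z w)\<^sup>2) = ((real q - 1) * R)\<^sup>2 + (real q - 1) * (R * (R - 1))\<^sup>2"
      using z by (simp add: codeg_diag)
  qed
  finally show ?thesis by (simp add: algebra_simps)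
qed

text \<open>The lower bound is the triple count for \<open>A = B = C = V\<close> divided by the
  number of ordered pairs. The 4 is the 3 from the path terms plus 1 that absorbs the diagonal
  correction.\<close>

lemma R_bounds:
  assumes "q \<ge> 2"
  shows "0 \<le> R" "R \<le> real q" "R \<ge> 2/9 * (real q - 2 * sqrt q - 4)"
proof -
  obtain x y where xy: "x \<in> V" "y \<in> V" "x \<noteq> y"
    using assms by (metis card_le_Suc0_iff_eq finite_V not_less_eq_eq numeral_2_eq_2)
  have "deg x y \<le> (\<Sum>z\<in>V. 1)" unfolding deg_def by (intro sum_mono) auto
  then show "R \<le> real q" using R xy by simp
  have "deg x y \<ge> 0" unfolding deg_def by (intro sum_nonneg) auto
  then show R0: "0 \<le> R" using R xy by simp
  have "(\<Sum>x\<in>V. \<Sum>y\<in>V. \<Sum>z\<in>V. of_bool (rb x y z)) = (\<Sum>z\<in>V. codeg z z)"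
    by (simp add: codeg_def of_bool_conj[symmetric])
  also have "\<dots> = real q * ((real q - 1) * R)" by (simp add: codeg_diag)
  finally have "real q * ((real q - 1) * R) + 2/9 * real q
      \<ge> 2/9 * (real q ^ 3 - 2 * sqrt q * real q ^ 2 - 3 * real q * real q)"
    using rb_sum_count[of V V V] rb_sum_lower[of V V V q] by simp
  then have "real q * (2/9 * (real q ^ 2 - 2 * sqrt q * real q - 3 * real q))
      \<le> real q * ((real q - 1) * R + 2/9)"
    by (simp add: algebra_simps power2_eq_square power3_eq_cube)
  then have "2/9 * (real q ^ 2 - 2 * sqrt q * real q - 3 * real q) \<le> (real q - 1) * R + 2/9"
    using assms by simp
  also have "\<dots> \<le> real q * R + 2/9 * real q" using R0 assms by (simp add: algebra_simps)
  finally have "real q * (2/9 * (real q - 2 * sqrt q - 4)) \<le> real q * R"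
    by (simp add: algebra_simps power2_eq_square)
  then show "R \<ge> 2/9 * (real q - 2 * sqrt q - 4)"
    using assms by simp
qed

text \<open>The centre \<open>R\<^sup>2 / q\<close> replaces the exact mean, which carries an extra
  factor \<open>((q - 1) / q)\<^sup>2\<close>, for the sake of simpler algebra. Averaged over
  \<open>q ^ 4\<close> quadruples, the bound gives a mean square deviation of
  \<open>2 * R\<^sup>2 / q\<close>. Since \<open>R\<close> has order \<open>q\<close>, this has
  order \<open>q\<close>, while the squared centre has order \<open>q\<^sup>2\<close>.\<close>

lemma ext_deviation:
  assumes "q \<ge> 2"
  shows "(\<Sum>a\<in>V. \<Sum>b\<in>V. \<Sum>c\<in>V. \<Sum>d\<in>V. (ext a b c d - R\<^sup>2 / q)\<^sup>2) \<le> 2 * R\<^sup>2 * real q ^ 3"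
proof -
  define Q where "Q = real q"
  have Q: "Q \<ge> 2" using assms by (simp add: Q_def)
  have R0: "0 \<le> R" "R \<le> Q" using R_bounds[OF assms] by (auto simp: Q_def)
  have sq: "(x - y)\<^sup>2 = x\<^sup>2 - 2 * y * x + y\<^sup>2" for x y :: real by (simp add: power2_diff)
  have "(\<Sum>a\<in>V. \<Sum>b\<in>V. \<Sum>c\<in>V. \<Sum>d\<in>V. (ext a b c d - R\<^sup>2 / Q)\<^sup>2)
      = Q * ((Q - 1) * R)\<^sup>2 + Q * (Q - 1) * (R * (R - 1))\<^sup>2
        - 2 * (R\<^sup>2 / Q) * (Q * ((Q - 1) * R)\<^sup>2) + Q * (Q * (Q * (Q * (R\<^sup>2 / Q)\<^sup>2)))"
    unfolding sq sum.distrib sum_subtractf sum_distrib_left[symmetric] ext_sum ext_square_sum Q_def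
    by simp
  also have "\<dots> = R\<^sup>2 * (R * ((3 * Q - 2) * R) - 2 * Q * (Q - 1) * R + Q\<^sup>2 * (Q - 1))"
    using Q by (simp add: field_simps power2_eq_square)
  also have "\<dots> \<le> R\<^sup>2 * (2 * Q ^ 3)"
  proof (intro mult_left_mono)
    have "R * ((3 * Q - 2) * R) \<le> Q * ((3 * Q - 2) * R)"
      using R0 Q by (intro mult_right_mono) auto
    moreover have "Q\<^sup>2 * R \<le> Q\<^sup>2 * Q" using R0 by (intro mult_left_mono) auto
    ultimately show "R * ((3 * Q - 2) * R) - 2 * Q * (Q - 1) * R + Q\<^sup>2 * (Q - 1) \<le> 2 * Q ^ 3"
      by (simp add: algebra_simps power2_eq_square power3_eq_cube)
        (use zero_le_square[of Q] in linarith)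
  qed simp
  finally show ?thesis by (simp add: Q_def mult_ac)
qed

text \<open>If every quadruple had a matching with fewer than \<open>t\<close> completions, each
  would contribute at least \<open>(\<mu> - t)\<^sup>2\<close> to the sum of the three deviations.
  By symmetry that sum is at most three times the bound for one matching.\<close>

lemma large_extensions:
  assumes q: "q \<ge> 6400"
  shows "\<exists>a\<in>V. \<exists>b\<in>V. \<exists>c\<in>V. \<exists>d\<in>V. ext a b c d \<ge> 3 * sqrt q + 1 \<and>
    ext a c b d \<ge> 3 * sqrt q + 1 \<and> ext a d b c \<ge> 3 * sqrt q + 1"
proof (rule ccontr)
  define s where "s = sqrt q"
  define \<mu> t where "\<mu> = R\<^sup>2 / q" and "t = 3 * s + 1"
  assume "\<not> ?thesis"
  then have small: "ext a b c d < t \<or> ext a c b d < t \<or> ext a d b c < t"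
    if "a \<in> V" "b \<in> V" "c \<in> V" "d \<in> V" for a b c d
    using that unfolding t_def s_def by (meson not_le)
  have s80: "s \<ge> 80" unfolding s_def using q by (intro real_le_rsqrt) auto
  have qs: "real q = s\<^sup>2" by (simp add: s_def)
  have q2: "q \<ge> 2" using q by simp
  \<comment> \<open>27/125 = 0.216 lies just below the value of
    \<open>2/9 * (1 - 2/s - 4/s\<^sup>2)\<close> at \<open>s = 80\<close>.\<close>
  have R_low: "R \<ge> 27/125 * s\<^sup>2"
  proof -
    have "80 * s \<le> s\<^sup>2" unfolding power2_eq_square using s80 by (intro mult_right_mono) auto
    then have "27/125 * s\<^sup>2 \<le> 2/9 * (s\<^sup>2 - 2 * s - 4)" using s80 by (simp add: field_simps)
    then show ?thesis using R_bounds(3)[OF q2] s80 unfolding qs by (simp add: field_simps)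
  qed
  define \<rho> where "\<rho> = R / s\<^sup>2"
  have \<rho>: "\<rho> \<ge> 27/125" "R = \<rho> * s\<^sup>2" "\<mu> = \<rho>\<^sup>2 * s\<^sup>2"
    using R_low s80 by (auto simp: \<rho>_def \<mu>_def qs field_simps power2_eq_square)
  \<comment> \<open>The deviation bound will give at most \<open>sqrt 6 * \<rho> * s\<close>, and
    5/2 is a rational number above \<open>sqrt 6\<close>. At the extreme values,
    \<open>0.216 * (0.216 * 80 - 2.5)\<close> is about 3.19 and so exceeds \<open>3 + 1/80\<close>.
    The 1/80 pays for the summand 1 in \<open>t\<close>, as \<open>s / 80 \<ge> 1\<close>.\<close>
  have key: "5/2 * \<rho> * s < \<mu> - t"
  proof -
    have "\<rho> * s \<ge> \<rho> * 80" using \<rho> s80 by (intro mult_left_mono) auto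
    then have "\<rho> * s - 5/2 \<ge> 27/125 * 80 - 5/2" using \<rho> by linarith
    then have "\<rho> * (\<rho> * s - 5/2) \<ge> 27/125 * (27/125 * 80 - 5/2)"
      using \<rho> by (intro mult_mono) auto
    then have "\<rho> * (\<rho> * s - 5/2) > 3 + 1/80" by simp
    then have "s * (\<rho> * (\<rho> * s - 5/2)) > s * (3 + 1/80)" using s80 by (intro mult_strict_left_mono) auto
    then show ?thesis using s80 unfolding \<rho> t_def by (simp add: algebra_simps power2_eq_square)
  qed
  have "0 \<le> 5/2 * \<rho> * s" using \<rho> s80 by simp
  then have pos: "\<mu> - t > 0" using key by linarith
  have dev: "(\<mu> - t)\<^sup>2 \<le> (ext a b c d - \<mu>)\<^sup>2 + (ext a c b d - \<mu>)\<^sup>2 + (ext a d b c - \<mu>)\<^sup>2"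
    if "a \<in> V" "b \<in> V" "c \<in> V" "d \<in> V" for a b c d
  proof -
    have *: "(\<mu> - t)\<^sup>2 \<le> (x - \<mu>)\<^sup>2" if "x < t" for x
      using that pos by (subst power2_commute[of x]) (intro power_mono, auto)
    show ?thesis using small[OF that]
      by (auto dest!: * intro: order_trans[OF _ add_mono] add_increasing2 add_increasing)
  qed
  let ?S = "\<lambda>f. \<Sum>a\<in>V. \<Sum>b\<in>V. \<Sum>c\<in>V. \<Sum>d\<in>V. f a b c d :: real"
  have "real q ^ 4 * (\<mu> - t)\<^sup>2 = ?S (\<lambda>a b c d. (\<mu> - t)\<^sup>2)"
    by (simp add: power4_eq_xxxx)
  also have "\<dots> \<le> ?S (\<lambda>a b c d. (ext a b c d - \<mu>)\<^sup>2 + (ext a c b d - \<mu>)\<^sup>2 + (ext a d b c - \<mu>)\<^sup>2)"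
    by (intro sum_mono dev)
  also have "\<dots> = ?S (\<lambda>a b c d. (ext a b c d - \<mu>)\<^sup>2) + ?S (\<lambda>a b c d. (ext a c b d - \<mu>)\<^sup>2)
      + ?S (\<lambda>a b c d. (ext a d b c - \<mu>)\<^sup>2)"
    by (simp only: sum.distrib)
  \<comment> \<open>Permuting the names of \<open>b\<close>, \<open>c\<close>, \<open>d\<close>
    permutes the three perfect matchings, so the three sums agree.\<close>
  also have "?S (\<lambda>a b c d. (ext a c b d - \<mu>)\<^sup>2) = ?S (\<lambda>a b c d. (ext a b c d - \<mu>)\<^sup>2)"
    by (intro sum.cong refl sum.swap)
  also have "?S (\<lambda>a b c d. (ext a d b c - \<mu>)\<^sup>2) = ?S (\<lambda>a b d c. (ext a d b c - \<mu>)\<^sup>2)"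
    by (intro sum.cong refl sum.swap)
  also have "\<dots> = ?S (\<lambda>a b c d. (ext a b c d - \<mu>)\<^sup>2)"
    by (intro sum.cong refl sum.swap)
  also have "?S (\<lambda>a b c d. (ext a b c d - \<mu>)\<^sup>2) \<le> 2 * R\<^sup>2 * real q ^ 3"
    unfolding \<mu>_def by (rule ext_deviation[OF q2])
  finally have "real q ^ 4 * (\<mu> - t)\<^sup>2 \<le> 6 * R\<^sup>2 * real q ^ 3" by linarith
  also have "6 * R\<^sup>2 * real q ^ 3 = real q ^ 4 * (6 * (\<rho> * s)\<^sup>2)"
    unfolding \<rho>(2) qs by (simp add: power2_eq_square power3_eq_cube power4_eq_xxxx)
  finally have "(\<mu> - t)\<^sup>2 \<le> 6 * (\<rho> * s)\<^sup>2" using q by simp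
  moreover have "(5/2 * \<rho> * s)\<^sup>2 < (\<mu> - t)\<^sup>2"
    using key \<rho> s80 by (intro power_strict_mono) auto
  moreover have "(5/2 * \<rho> * s)\<^sup>2 = 25/4 * (\<rho> * s)\<^sup>2" by (simp add: power2_eq_square)
  ultimately show False using zero_le_power2[of "\<rho> * s"] by linarith
qed

end

section \<open>Assembly of the seven points\<close>

lemma ext_card: "ext a b c d = real (card {z \<in> V. rb z a b \<and> rb z c d})"
proof -
  have "ext a b c d = (\<Sum>z\<in>V. if rb z a b \<and> rb z c d then 1 else 0)"
    unfolding ext_def by (intro sum.cong) auto
  then show ?thesis using finite_V by (simp add: sum.If_cases Int_def)
qed

theorem rainbow_fano:
  assumes q: "q \<ge> 6400"
  shows "\<exists>b :: 7 \<Rightarrow> 'a. \<forall>i. b i \<in> V \<and> rb (b i) (b (i + 1)) (b (i + 3))"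
proof -
  obtain x y where "x \<in> V" "y \<in> V" "x \<noteq> y"
    using q by (metis card_le_Suc0_iff_eq finite_V not_less_eq_eq numeral_le_one_iff One_nat_def
      le_trans semiring_norm(69))
  then have "deg x' y' = deg x y" if "x' \<in> V" "y' \<in> V" "x' \<noteq> y'" for x' y'
    using deg_const that by blast
  from large_extensions[OF this q] obtain a b c d where
    abcd: "a \<in> V" "b \<in> V" "c \<in> V" "d \<in> V" and
    big: "ext a b c d \<ge> 3 * sqrt q + 1" "ext a c b d \<ge> 3 * sqrt q + 1" "ext a d b c \<ge> 3 * sqrt q + 1"
    by auto
  \<comment> \<open>The three candidate sets are trimmed to one common size, the least integer that
    the triple lemma admits.\<close>
  define n where "n = nat \<lceil>3 * sqrt q + 1\<rceil>"
  have n: "real n \<ge> 3 * sqrt q + 1" unfolding n_def by linarith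
  have sub: "\<exists>X. X \<subseteq> {z \<in> V. rb z a b \<and> rb z c d} \<and> card X = n" if "ext a b c d \<ge> 3 * sqrt q + 1" for a b c d
  proof -
    have "n \<le> card {z \<in> V. rb z a b \<and> rb z c d}"
      using that unfolding ext_card n_def by (simp only: nat_le_iff ceiling_le_iff of_int_of_nat_eq)
    then show ?thesis by (meson obtain_subset_with_card_n)
  qed
  obtain X Y Z where XYZ: "X \<subseteq> {z \<in> V. rb z a d \<and> rb z b c}" "card X = n"
    "Y \<subseteq> {z \<in> V. rb z a b \<and> rb z c d}" "card Y = n"
    "Z \<subseteq> {z \<in> V. rb z a c \<and> rb z b d}" "card Z = n"
    using sub big by meson
  obtain x y z where xyz: "x \<in> X" "y \<in> Y" "z \<in> Z" "rb x y z"
    using rainbow_triple_of_card[of X Y Z n] XYZ n by blast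
  have V: "x \<in> V" "y \<in> V" "z \<in> V" using XYZ xyz by auto
  have XYZ': "rb x a d" "rb x b c" "rb y a b" "rb y c d" "rb z a c" "rb z b d"
    using XYZ xyz by auto
  have "rb a z c" using rb_perm(1)[of z a c] XYZ' V abcd by simp
  moreover have "rb b c x" using rb_perm(1)[of x b c] rb_perm(2)[of b x c] XYZ' V abcd by simp
  moreover have "rb c d y" using rb_perm(1)[of y c d] rb_perm(2)[of c y d] XYZ' V abcd by simp
  moreover have "rb d x a" using rb_perm(2)[of x a d] rb_perm(1)[of x d a] XYZ' V abcd by simp
  \<comment> \<open>The deleted line is \<open>{x, y, z}\<close> at indices 0, 1, 3. The matchings
    completed by \<open>x\<close>, \<open>y\<close>, \<open>z\<close> are \<open>ad|bc\<close>,
    \<open>ab|cd\<close>, \<open>ac|bd\<close>, which is how the other six lines of the plane meet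
    the indices 2, 4, 5, 6 of \<open>a\<close>, \<open>b\<close>, \<open>c\<close>,
    \<open>d\<close>.\<close>
  ultimately have "all_lines rb x y a z b c d"
    using xyz(4) XYZ'(3,6) by (simp add: all_lines_def)
  then have "\<forall>i. rb (seven x y a z b c d i) (seven x y a z b c d (i + 1)) (seven x y a z b c d (i + 3))"
    by (simp only: all_lines_seven)
  moreover have "\<forall>i. seven x y a z b c d i \<in> V" using abcd V by (simp add: all_7 seven_def)
  ultimately show ?thesis by blast
qed

end

section \<open>Difference families of Fano planes\<close>

definition line_indices :: "7 \<Rightarrow> 7 set" where
  "line_indices c = {c, c + 1, c + 3}"

lemma fano_line_eq_image: "fano_line b c = b ` line_indices c"
  by (simp add: fano_line_def line_indices_def)

text \<open>A color is the index of a line in the base tuple, so for each \<open>c\<close> the lines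
  of index \<open>c\<close> have to form a difference family with block size 3. Differences are
  written \<open>inv u\<close> times \<open>v\<close> because left translations leave these
  unchanged.\<close>

definition fano_difference_family :: "('g, 'm) monoid_scheme \<Rightarrow> (7 \<Rightarrow> 'g) set \<Rightarrow> bool" where
  "fano_difference_family G \<B> \<longleftrightarrow>
     (\<forall>b\<in>\<B>. inj b \<and> range b \<subseteq> carrier G) \<and>
     (\<forall>c. \<forall>d\<in>carrier G - {\<one>\<^bsub>G\<^esub>}. \<exists>b\<in>\<B>. \<exists>j\<in>line_indices c. \<exists>k\<in>line_indices c.
        inv\<^bsub>G\<^esub> (b j) \<otimes>\<^bsub>G\<^esub> b k = d) \<and>
     (\<forall>c. \<forall>b\<in>\<B>. \<forall>b'\<in>\<B>. \<forall>j\<in>line_indices c. \<forall>k\<in>line_indices c. \<forall>j'\<in>line_indices c. \<forall>k'\<in>line_indices c.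
        j \<noteq> k \<longrightarrow> j' \<noteq> k' \<longrightarrow> inv\<^bsub>G\<^esub> (b j) \<otimes>\<^bsub>G\<^esub> b k = inv\<^bsub>G\<^esub> (b' j') \<otimes>\<^bsub>G\<^esub> b' k' \<longrightarrow>
        b = b' \<and> j = j' \<and> k = k')"

lemma fano_difference_familyI:
  assumes "\<And>b. b \<in> \<B> \<Longrightarrow> inj b" "\<And>b i. b \<in> \<B> \<Longrightarrow> b i \<in> carrier G"
    and "\<And>c d. \<lbrakk>d \<in> carrier G; d \<noteq> \<one>\<^bsub>G\<^esub>\<rbrakk> \<Longrightarrow>
      \<exists>b\<in>\<B>. \<exists>j\<in>line_indices c. \<exists>k\<in>line_indices c. inv\<^bsub>G\<^esub> (b j) \<otimes>\<^bsub>G\<^esub> b k = d"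
    and "\<And>c b b' j k j' k'. \<lbrakk>b \<in> \<B>; b' \<in> \<B>; j \<in> line_indices c; k \<in> line_indices c;
      j' \<in> line_indices c; k' \<in> line_indices c; j \<noteq> k; j' \<noteq> k';
      inv\<^bsub>G\<^esub> (b j) \<otimes>\<^bsub>G\<^esub> b k = inv\<^bsub>G\<^esub> (b' j') \<otimes>\<^bsub>G\<^esub> b' k'\<rbrakk> \<Longrightarrow> b = b' \<and> j = j' \<and> k = k'"
  shows "fano_difference_family G \<B>"
  unfolding fano_difference_family_def
proof (intro conjI ballI allI impI)
  fix b assume "b \<in> \<B>"
  then show "inj b" "range b \<subseteq> carrier G" using assms(1,2) by auto
next
  fix c d assume "d \<in> carrier G - {\<one>\<^bsub>G\<^esub>}"
  then show "\<exists>b\<in>\<B>. \<exists>j\<in>line_indices c. \<exists>k\<in>line_indices c. inv\<^bsub>G\<^esub> (b j) \<otimes>\<^bsub>G\<^esub> b k = d"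
    using assms(3) by simp
next
  fix c b b' j k j' k'
  assume a: "b \<in> \<B>" "b' \<in> \<B>" "j \<in> line_indices c" "k \<in> line_indices c"
      "j' \<in> line_indices c" "k' \<in> line_indices c" "j \<noteq> k" "j' \<noteq> k'"
      "inv\<^bsub>G\<^esub> (b j) \<otimes>\<^bsub>G\<^esub> b k = inv\<^bsub>G\<^esub> (b' j') \<otimes>\<^bsub>G\<^esub> b' k'"
  show "b = b'" "j = j'" "k = k'" using assms(4)[OF a] by auto
qed

lemma fano_difference_familyD:
  assumes "fano_difference_family G \<B>"
  shows "b \<in> \<B> \<Longrightarrow> inj b" "b \<in> \<B> \<Longrightarrow> b i \<in> carrier G"
    and "\<lbrakk>d \<in> carrier G; d \<noteq> \<one>\<^bsub>G\<^esub>\<rbrakk> \<Longrightarrow>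
      \<exists>b\<in>\<B>. \<exists>j\<in>line_indices c. \<exists>k\<in>line_indices c. inv\<^bsub>G\<^esub> (b j) \<otimes>\<^bsub>G\<^esub> b k = d"
    and "\<lbrakk>b \<in> \<B>; b' \<in> \<B>; j \<in> line_indices c; k \<in> line_indices c;
      j' \<in> line_indices c; k' \<in> line_indices c; j \<noteq> k; j' \<noteq> k';
      inv\<^bsub>G\<^esub> (b j) \<otimes>\<^bsub>G\<^esub> b k = inv\<^bsub>G\<^esub> (b' j') \<otimes>\<^bsub>G\<^esub> b' k'\<rbrakk> \<Longrightarrow> b = b' \<and> j = j' \<and> k = k'"
proof -
  note def = assms[unfolded fano_difference_family_def]
  show "inj b" "b i \<in> carrier G" if "b \<in> \<B>" using def[THEN conjunct1] that by auto
  show "\<exists>b\<in>\<B>. \<exists>j\<in>line_indices c. \<exists>k\<in>line_indices c. inv\<^bsub>G\<^esub> (b j) \<otimes>\<^bsub>G\<^esub> b k = d"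
    if "d \<in> carrier G" "d \<noteq> \<one>\<^bsub>G\<^esub>"
    by (rule def[THEN conjunct2, THEN conjunct1, rule_format]) (use that in simp)
  show "b = b' \<and> j = j' \<and> k = k'"
    if "b \<in> \<B>" "b' \<in> \<B>" "j \<in> line_indices c" "k \<in> line_indices c"
      "j' \<in> line_indices c" "k' \<in> line_indices c" "j \<noteq> k" "j' \<noteq> k'"
      "inv\<^bsub>G\<^esub> (b j) \<otimes>\<^bsub>G\<^esub> b k = inv\<^bsub>G\<^esub> (b' j') \<otimes>\<^bsub>G\<^esub> b' k'"
    by (rule def[THEN conjunct2, THEN conjunct2, rule_format, OF that])
qed

section \<open>Regular kaleidoscopes from translates of base planes\<close>

definition plane_of :: "(7 \<Rightarrow> 'a) \<Rightarrow> 'a colored_plane" where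
  "plane_of b = \<lparr>plane_points = range b, color_line = fano_line b\<rparr>"

lemma inj_fano_line:
  assumes "inj b"
  shows "inj (fano_line b)"
proof -
  have "fano_plane (range b) (range (fano_line b))"
    using assms by (auto simp: fano_plane_def)
  then have "card (range (fano_line b)) = card (UNIV :: 7 set)"
    using fano_plane_is_design(2) by simp
  then show ?thesis by (intro eq_card_imp_inj_on) auto
qed

lemma colored_fano_plane_of:
  assumes "inj b"
  shows "colored_fano_plane (plane_of b)"
  using assms inj_fano_line[OF assms]
  by (auto simp: colored_fano_plane_def plane_of_def fano_plane_def)

lemma map_plane_of: "map_colored_plane f (plane_of b) = plane_of (f \<circ> b)"
  by (auto simp: map_colored_plane_def plane_of_def fano_line_def image_comp)

lemma (in group) regular_kaleidoscope_of_difference_family: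
  assumes fin: "finite (carrier G)" and df: "fano_difference_family G \<B>"
  shows "\<exists>F. group_regular_fano_kaleidoscope G (Coset.order G) (carrier G) F"
proof -
  define T where "T g b = plane_of (\<lambda>i. g \<otimes> b i)" for g and b :: "7 \<Rightarrow> 'a"
  define F where "F = {T g b | g b. g \<in> carrier G \<and> b \<in> \<B>}"
  \<comment> \<open>The restriction to the carrier makes the maps extensional, as the elements of
    \<open>BijGroup\<close> are.\<close>
  define \<phi> where "\<phi> g = (\<lambda>x\<in>carrier G. g \<otimes> x)" for g
  note D = fano_difference_familyD[OF df]
  have mem: "x \<in> color_line (T g b) c \<longleftrightarrow> (\<exists>j\<in>line_indices c. x = g \<otimes> b j)" for x g b c
    by (auto simp: T_def plane_of_def fano_line_eq_image)
  have diff: "inv (g \<otimes> u) \<otimes> (g \<otimes> v) = inv u \<otimes> v"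
    if "g \<in> carrier G" "u \<in> carrier G" "v \<in> carrier G" for g u v
    using that by (simp add: inv_mult_group m_assoc) (simp add: m_assoc[symmetric])
  have inj: "inj (\<lambda>i. g \<otimes> b i)" if "g \<in> carrier G" "b \<in> \<B>" for g b
    using that D(1,2) by (auto simp: inj_def)
  have unique: "\<exists>!A. A \<in> F \<and> x \<in> color_line A c \<and> y \<in> color_line A c"
    if xy: "x \<in> carrier G" "y \<in> carrier G" "x \<noteq> y" for x y c
  proof -
    have "inv x \<otimes> y \<noteq> \<one>" using xy by (metis inv_equality inv_inv inv_closed)
    then obtain b j k where b: "b \<in> \<B>" "j \<in> line_indices c" "k \<in> line_indices c"
      "inv (b j) \<otimes> b k = inv x \<otimes> y" using D(3)[of "inv x \<otimes> y" c] xy by auto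
    note [simp] = D(2)[OF b(1)]
    have jk: "j \<noteq> k" using b(4) \<open>inv x \<otimes> y \<noteq> \<one>\<close> by auto
    \<comment> \<open>The difference determines \<open>b\<close>, \<open>j\<close> and
      \<open>k\<close>, and the translation is then forced by sending \<open>b j\<close> to
      \<open>x\<close>. This gives existence here and uniqueness below.\<close>
    define g where "g = x \<otimes> inv (b j)"
    have g: "g \<in> carrier G" "g \<otimes> b j = x" using xy by (simp_all add: g_def m_assoc)
    have gk: "g \<otimes> b k = y" unfolding g_def using xy
      by (simp add: m_assoc b(4)) (simp add: m_assoc[symmetric])
    show ?thesis
    proof (rule ex1I[of _ "T g b"])
      show "T g b \<in> F \<and> x \<in> color_line (T g b) c \<and> y \<in> color_line (T g b) c"
        using g gk b unfolding mem F_def by blast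
    next
      fix A assume "A \<in> F \<and> x \<in> color_line A c \<and> y \<in> color_line A c"
      then obtain g' b' j' k' where A: "A = T g' b'" "g' \<in> carrier G" "b' \<in> \<B>"
        "j' \<in> line_indices c" "k' \<in> line_indices c" "x = g' \<otimes> b' j'" "y = g' \<otimes> b' k'"
        unfolding F_def using mem by auto
      have "inv x \<otimes> y = inv (b' j') \<otimes> b' k'"
        using A D(2) by (simp add: diff)
      then have "b = b' \<and> j = j' \<and> k = k'"
        using b jk A xy(3) by (intro D(4)[of b b' j c k j' k']) auto
      then show "A = T g b" using A g b(1) D(2)
        by (metis right_cancel)
    qed
  qed
  have kal: "fano_kaleidoscope (Coset.order G) (carrier G) F"
    unfolding fano_kaleidoscope_def
  proof (intro conjI ballI impI allI unique fin)
    fix A assume "A \<in> F"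
    then obtain g b where A: "A = T g b" "g \<in> carrier G" "b \<in> \<B>" unfolding F_def by blast
    show "colored_fano_plane A" unfolding A T_def by (intro colored_fano_plane_of inj A)
    show "plane_points A \<subseteq> carrier G" using A D(2) by (auto simp: T_def plane_of_def)
  qed (simp_all add: Coset.order_def)
  have bij: "bij_betw (\<phi> g) (carrier G) (carrier G)" if g: "g \<in> carrier G" for g
    unfolding \<phi>_def
    by (rule bij_betwI[where g = "\<lambda>x. inv g \<otimes> x"])
      (use g in \<open>auto simp: m_assoc[symmetric]\<close>)
  have act: "group_action G (carrier G) \<phi>"
    unfolding group_action_def group_hom_def group_hom_axioms_def
  proof (intro conjI group_BijGroup is_group homI)
    fix g assume "g \<in> carrier G"
    then show "\<phi> g \<in> carrier (BijGroup (carrier G))"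
      using bij by (simp add: BijGroup_def Bij_def) (simp add: \<phi>_def)
  next
    fix g h assume gh: "g \<in> carrier G" "h \<in> carrier G"
    then have "\<phi> g \<in> Bij (carrier G)" "\<phi> h \<in> Bij (carrier G)"
      using bij by (simp_all add: Bij_def) (simp_all add: \<phi>_def)
    then show "\<phi> (g \<otimes> h) = \<phi> g \<otimes>\<^bsub>BijGroup (carrier G)\<^esub> \<phi> h"
      using gh by (simp add: BijGroup_def) (auto simp: \<phi>_def compose_def m_assoc restrict_def)
  qed
  have sharp: "sharply_transitive_action G (carrier G) \<phi>"
    unfolding sharply_transitive_action_def
  proof (intro conjI act ballI)
    fix x y assume xy: "x \<in> carrier G" "y \<in> carrier G"
    show "\<exists>!g. g \<in> carrier G \<and> \<phi> g x = y"
    proof (rule ex1I[of _ "y \<otimes> inv x"])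
      show "y \<otimes> inv x \<in> carrier G \<and> \<phi> (y \<otimes> inv x) x = y" using xy by (simp add: \<phi>_def m_assoc)
    next
      fix g assume "g \<in> carrier G \<and> \<phi> g x = y"
      then show "g = y \<otimes> inv x" using xy by (auto simp: \<phi>_def m_assoc)
    qed
  qed
  have map_T: "map_colored_plane (\<phi> g) (T h b) = T (g \<otimes> h) b"
    if "g \<in> carrier G" "h \<in> carrier G" "b \<in> \<B>" for g h b
  proof -
    have "\<phi> g \<circ> (\<lambda>i. h \<otimes> b i) = (\<lambda>i. (g \<otimes> h) \<otimes> b i)"
      using that D(2) by (auto simp: \<phi>_def m_assoc)
    then show ?thesis unfolding T_def map_plane_of by simp
  qed
  have "map_colored_plane (\<phi> g) ` F = F" if g: "g \<in> carrier G" for g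
  proof (intro equalityI subsetI)
    fix A assume "A \<in> map_colored_plane (\<phi> g) ` F"
    then obtain h b where "A = map_colored_plane (\<phi> g) (T h b)" "h \<in> carrier G" "b \<in> \<B>"
      unfolding F_def by blast
    then show "A \<in> F" using map_T g unfolding F_def by blast
  next
    fix A assume "A \<in> F"
    then obtain h b where A: "A = T h b" "h \<in> carrier G" "b \<in> \<B>" unfolding F_def by blast
    then have "A = map_colored_plane (\<phi> g) (T (inv g \<otimes> h) b)"
      using g map_T[of g "inv g \<otimes> h" b] by (simp add: m_assoc[symmetric])
    moreover have "T (inv g \<otimes> h) b \<in> F" unfolding F_def using A g by blast
    ultimately show "A \<in> map_colored_plane (\<phi> g) ` F" by blast
  qed
  then show ?thesis
    unfolding group_regular_fano_kaleidoscope_def using kal sharp is_group by blast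
qed

section \<open>Transport to other groups and products\<close>

lemma fano_difference_family_iso:
  assumes "group G" "group H" and h: "h \<in> iso G H" and df: "fano_difference_family G \<B>"
  shows "fano_difference_family H ((\<lambda>b. h \<circ> b) ` \<B>)"
proof -
  interpret G: group G by fact
  interpret H: group H by fact
  interpret hom: group_hom G H h
    using h by (auto simp: group_hom_def group_hom_axioms_def iso_def assms)
  note D = fano_difference_familyD[OF df]
  have bij: "bij_betw h (carrier G) (carrier H)" using h by (simp add: iso_def)
  have inj: "h x = h y \<longleftrightarrow> x = y" if "x \<in> carrier G" "y \<in> carrier G" for x y
    using bij that by (auto simp: bij_betw_def inj_on_def)
  have diff: "inv\<^bsub>H\<^esub> h x \<otimes>\<^bsub>H\<^esub> h y = h (inv\<^bsub>G\<^esub> x \<otimes>\<^bsub>G\<^esub> y)" if "x \<in> carrier G" "y \<in> carrier G" for x y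
    using that by simp
  show ?thesis
  proof (rule fano_difference_familyI)
    fix c d assume d: "d \<in> carrier H" "d \<noteq> \<one>\<^bsub>H\<^esub>"
    then obtain e where e: "e \<in> carrier G" "d = h e"
      using bij by (auto simp: bij_betw_def)
    then have "e \<noteq> \<one>\<^bsub>G\<^esub>" using d by auto
    then obtain b j k where b: "b \<in> \<B>" "j \<in> line_indices c" "k \<in> line_indices c"
      "inv\<^bsub>G\<^esub> (b j) \<otimes>\<^bsub>G\<^esub> b k = e" using D(3)[OF e(1)] by blast
    have "inv\<^bsub>H\<^esub> ((h \<circ> b) j) \<otimes>\<^bsub>H\<^esub> (h \<circ> b) k = d"
      by (simp only: comp_def diff[OF D(2)[OF b(1)] D(2)[OF b(1)]] b(4) e(2))
    then show "\<exists>b\<in>(\<lambda>b. h \<circ> b) ` \<B>. \<exists>j\<in>line_indices c. \<exists>k\<in>line_indices c.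
        inv\<^bsub>H\<^esub> (b j) \<otimes>\<^bsub>H\<^esub> b k = d"
      using b by blast
  next
    fix c b b' j k j' k'
    assume "b \<in> (\<lambda>b. h \<circ> b) ` \<B>" "b' \<in> (\<lambda>b. h \<circ> b) ` \<B>"
    then obtain a a' where a: "a \<in> \<B>" "b = h \<circ> a" "a' \<in> \<B>" "b' = h \<circ> a'" by blast
    assume jk: "j \<in> line_indices c" "k \<in> line_indices c" "j' \<in> line_indices c"
      "k' \<in> line_indices c" "j \<noteq> k" "j' \<noteq> k'"
    assume "inv\<^bsub>H\<^esub> b j \<otimes>\<^bsub>H\<^esub> b k = inv\<^bsub>H\<^esub> b' j' \<otimes>\<^bsub>H\<^esub> b' k'"
    then have "h (inv\<^bsub>G\<^esub> (a j) \<otimes>\<^bsub>G\<^esub> a k) = h (inv\<^bsub>G\<^esub> (a' j') \<otimes>\<^bsub>G\<^esub> a' k')"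
      by (simp only: a(2,4) comp_def diff[OF D(2)[OF a(1)] D(2)[OF a(1)]]
          diff[OF D(2)[OF a(3)] D(2)[OF a(3)]])
    then have "inv\<^bsub>G\<^esub> (a j) \<otimes>\<^bsub>G\<^esub> a k = inv\<^bsub>G\<^esub> (a' j') \<otimes>\<^bsub>G\<^esub> a' k'"
      by (subst (asm) inj) (use D(2) a in auto)
    then show "b = b' \<and> j = j' \<and> k = k'" using D(4)[OF a(1,3) jk] a by simp
  next
    fix b assume "b \<in> (\<lambda>b. h \<circ> b) ` \<B>"
    then show "inj b" using D(1,2) inj by (auto simp: inj_def)
  next
    fix b i assume "b \<in> (\<lambda>b. h \<circ> b) ` \<B>"
    then show "b i \<in> carrier H" using D(2) by auto
  qed
qed

lemma (in group) exists_nat_iso: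
  assumes "finite (carrier G)"
  shows "\<exists>H :: nat monoid. \<exists>h. group H \<and> Coset.order H = Coset.order G \<and> h \<in> iso G H"
proof -
  obtain f :: "'a \<Rightarrow> nat" where f: "inj_on f (carrier G)"
    using finite_imp_inj_to_nat_seg[OF assms] by blast
  have "group (image_group f G)" "f \<in> iso G (image_group f G)"
    using inj_imp_image_group_is_group[OF f] inj_imp_image_group_iso[OF f] by auto
  moreover have "Coset.order (image_group f G) = Coset.order G"
    using f by (simp add: Coset.order_def image_group_carrier card_image)
  ultimately show ?thesis by blast
qed

text \<open>Fixing the carrier type turns existence into a property of the number \<open>v\<close>
  alone, so that families over residues, pairs and triples can be combined in one induction.\<close>

definition has_fano_difference_family :: "nat \<Rightarrow> bool" where
  "has_fano_difference_family v \<longleftrightarrow>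
     (\<exists>(G :: nat monoid) \<B>. group G \<and> Coset.order G = v \<and> finite (carrier G) \<and> fano_difference_family G \<B>)"

lemma (in group) has_fano_difference_familyI:
  assumes "finite (carrier G)" "fano_difference_family G \<B>"
  shows "has_fano_difference_family (Coset.order G)"
proof -
  obtain H :: "nat monoid" and h where H: "group H" "Coset.order H = Coset.order G" "h \<in> iso G H"
    using exists_nat_iso[OF assms(1)] by blast
  moreover have "finite (carrier H)"
    using H(3) assms(1) bij_betw_finite by (auto simp: iso_def)
  ultimately show ?thesis
    using fano_difference_family_iso[OF is_group H(1,3) assms(2)]
    unfolding has_fano_difference_family_def by blast
qed

lemma regular_kaleidoscope_of_has_difference_family:
  assumes "has_fano_difference_family v"
  shows "\<exists>(V :: nat set) F. regular_fano_kaleidoscope v V F"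
  using assms group.regular_kaleidoscope_of_difference_family
  unfolding has_fano_difference_family_def regular_fano_kaleidoscope_def by blast

text \<open>The multipliers \<open>m j\<close> play the role of a difference matrix with seven rows over \<open>H\<close>.\<close>

lemma fano_difference_family_product:
  assumes "group G" "group H"
    and dfG: "fano_difference_family G \<A>" and dfH: "fano_difference_family H \<B>"
    and m: "\<And>j h. h \<in> carrier H \<Longrightarrow> m j h \<in> carrier H"
    and m_diff: "\<And>j k. j \<noteq> k \<Longrightarrow>
      bij_betw (\<lambda>h. inv\<^bsub>H\<^esub> (m j h) \<otimes>\<^bsub>H\<^esub> m k h) (carrier H) (carrier H)"
  shows "fano_difference_family (G \<times>\<times> H)
    ({\<lambda>j. (a j, m j h) | a h. a \<in> \<A> \<and> h \<in> carrier H} \<union> {\<lambda>j. (\<one>\<^bsub>G\<^esub>, b j) | b. b \<in> \<B>})"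
    (is "fano_difference_family _ (?P \<union> ?Q)")
proof -
  interpret G: group G by fact
  interpret H: group H by fact
  note DG = fano_difference_familyD[OF dfG] and DH = fano_difference_familyD[OF dfH]
  have car: "b i \<in> carrier (G \<times>\<times> H)" if "b \<in> ?P \<union> ?Q" for b i
    using that DG(2) DH(2) m by auto
  have diff: "inv\<^bsub>G \<times>\<times> H\<^esub> (x, y) \<otimes>\<^bsub>G \<times>\<times> H\<^esub> (x', y') = (inv\<^bsub>G\<^esub> x \<otimes>\<^bsub>G\<^esub> x', inv\<^bsub>H\<^esub> y \<otimes>\<^bsub>H\<^esub> y')"
    if "x \<in> carrier G" "y \<in> carrier H" for x y x' y'
    using that assms by simp
  \<comment> \<open>Differences of lifted planes have a nontrivial first coordinate, those of the
    planes over \<open>H\<close> a trivial one. This separates the two parts of the union.\<close>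
  have ne: "inv\<^bsub>G\<^esub> (a j) \<otimes>\<^bsub>G\<^esub> a k \<noteq> \<one>\<^bsub>G\<^esub>" if "a \<in> \<A>" "j \<noteq> k" for a j k
    using that DG(1,2) by (metis G.inv_equality G.inv_inv G.inv_closed injD)
  show ?thesis
  proof (rule fano_difference_familyI)
    fix b assume "b \<in> ?P \<union> ?Q"
    then show "inj b" using DG(1) DH(1) by (auto simp: inj_def)
  next
    fix b i assume "b \<in> ?P \<union> ?Q"
    then show "b i \<in> carrier (G \<times>\<times> H)" by (rule car)
  next
    fix c d assume d: "d \<in> carrier (G \<times>\<times> H)" "d \<noteq> \<one>\<^bsub>G \<times>\<times> H\<^esub>"
    obtain x y where xy: "d = (x, y)" "x \<in> carrier G" "y \<in> carrier H" using d by auto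
    show "\<exists>b\<in>?P \<union> ?Q. \<exists>j\<in>line_indices c. \<exists>k\<in>line_indices c.
        inv\<^bsub>G \<times>\<times> H\<^esub> (b j) \<otimes>\<^bsub>G \<times>\<times> H\<^esub> b k = d"
    proof (cases "x = \<one>\<^bsub>G\<^esub>")
      case True
      then have "y \<noteq> \<one>\<^bsub>H\<^esub>" using d xy by auto
      then obtain b j k where "b \<in> \<B>" "j \<in> line_indices c" "k \<in> line_indices c"
        "inv\<^bsub>H\<^esub> (b j) \<otimes>\<^bsub>H\<^esub> b k = y" using DH(3)[OF xy(3)] by blast
      then show ?thesis using True xy DH(2)
        by (intro bexI[of _ "\<lambda>j. (\<one>\<^bsub>G\<^esub>, b j)"] bexI[of _ j] bexI[of _ k]) (auto simp: diff)
    next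
      case False
      then obtain a j k where a: "a \<in> \<A>" "j \<in> line_indices c" "k \<in> line_indices c"
        "inv\<^bsub>G\<^esub> (a j) \<otimes>\<^bsub>G\<^esub> a k = x" using DG(3)[OF xy(2)] by blast
      then have "j \<noteq> k" using False DG(2) by auto
      then obtain h where "h \<in> carrier H" "inv\<^bsub>H\<^esub> (m j h) \<otimes>\<^bsub>H\<^esub> m k h = y"
        using m_diff[of j k] xy(3) unfolding bij_betw_def by (metis (no_types, lifting) imageE)
      then show ?thesis using a xy DG(2) m
        by (intro bexI[of _ "\<lambda>j. (a j, m j h)"] bexI[of _ j] bexI[of _ k]) (auto simp: diff)
    qed
  next
    fix c b b' j k j' k'
    assume b: "b \<in> ?P \<union> ?Q" "b' \<in> ?P \<union> ?Q"
    assume jk: "j \<in> line_indices c" "k \<in> line_indices c" "j' \<in> line_indices c"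
      "k' \<in> line_indices c" "j \<noteq> k" "j' \<noteq> k'"
    assume eq: "inv\<^bsub>G \<times>\<times> H\<^esub> b j \<otimes>\<^bsub>G \<times>\<times> H\<^esub> b k = inv\<^bsub>G \<times>\<times> H\<^esub> b' j' \<otimes>\<^bsub>G \<times>\<times> H\<^esub> b' k'"
    consider a h a' h' where "b = (\<lambda>j. (a j, m j h))" "b' = (\<lambda>j. (a' j, m j h'))" "a \<in> \<A>" "a' \<in> \<A>"
        "h \<in> carrier H" "h' \<in> carrier H"
      | a h a' where "b = (\<lambda>j. (a j, m j h))" "b' = (\<lambda>j. (\<one>\<^bsub>G\<^esub>, a' j))" "a \<in> \<A>" "a' \<in> \<B>" "h \<in> carrier H"
      | a a' h where "b = (\<lambda>j. (\<one>\<^bsub>G\<^esub>, a j))" "b' = (\<lambda>j. (a' j, m j h))" "a \<in> \<B>" "a' \<in> \<A>" "h \<in> carrier H"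
      | a a' where "b = (\<lambda>j. (\<one>\<^bsub>G\<^esub>, a j))" "b' = (\<lambda>j. (\<one>\<^bsub>G\<^esub>, a' j))" "a \<in> \<B>" "a' \<in> \<B>"
      using b by blast
    then show "b = b' \<and> j = j' \<and> k = k'"
    proof cases
      case (1 a h a' h')
      have e: "inv\<^bsub>G\<^esub> a j \<otimes>\<^bsub>G\<^esub> a k = inv\<^bsub>G\<^esub> a' j' \<otimes>\<^bsub>G\<^esub> a' k'"
        "inv\<^bsub>H\<^esub> (m j h) \<otimes>\<^bsub>H\<^esub> m k h = inv\<^bsub>H\<^esub> (m j' h') \<otimes>\<^bsub>H\<^esub> m k' h'"
        using eq 1 DG(2) m by (auto simp: diff)
      have same: "a = a' \<and> j = j' \<and> k = k'" using DG(4)[OF 1(3,4) jk e(1)] .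
      then have "h = h'" using e(2) m_diff[OF jk(5)] 1(5,6) by (auto simp: bij_betw_def inj_on_def)
      then show ?thesis using same 1 by simp
    next
      case (2 a h a')
      then show ?thesis using eq DG(2) DH(2) m ne[OF 2(3) jk(5)] by (auto simp: diff)
    next
      case (3 a a' h)
      then show ?thesis using eq DG(2) DH(2) m ne[OF 3(4) jk(6)] by (auto simp: diff)
    next
      case (4 a a')
      then have "inv\<^bsub>H\<^esub> a j \<otimes>\<^bsub>H\<^esub> a k = inv\<^bsub>H\<^esub> a' j' \<otimes>\<^bsub>H\<^esub> a' k'"
        using eq DH(2) by (auto simp: diff)
      then show ?thesis using DH(4)[OF 4(3,4) jk] 4 by simp
    qed
  qed
qed

section \<open>Rainbow tuples in finite fields\<close>

text \<open>The exponent is a third of the order of the multiplicative group, so in a field two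
  nonzero elements have the same value of \<open>\<kappa>\<close> exactly if they lie in the same
  coset of the nonzero cubes. In this form the condition can be evaluated in a concrete
  ring.\<close>

definition rainbow_heptad :: "('a, 'm) ring_scheme \<Rightarrow> (7 \<Rightarrow> 'a) \<Rightarrow> bool" where
  "rainbow_heptad R b \<longleftrightarrow> (let \<kappa> = (\<lambda>x. x [^]\<^bsub>R\<^esub> ((Coset.order R - 1) div 3)) in
     \<forall>i. b i \<in> carrier R \<and> rainbow3 (\<kappa> (b i \<ominus>\<^bsub>R\<^esub> b (i + 1)))
       (\<kappa> (b (i + 1) \<ominus>\<^bsub>R\<^esub> b (i + 3))) (\<kappa> (b i \<ominus>\<^bsub>R\<^esub> b (i + 3))))"

locale cubic_field = field R for R (structure) +
  assumes fin: "finite (carrier R)" and order_mod: "Coset.order R mod 6 = 1"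
begin

definition \<kappa> :: "'a \<Rightarrow> 'a" where "\<kappa> x = x [^] ((Coset.order R - 1) div 3)"

lemma exponent: "3 * ((Coset.order R - 1) div 3) = Coset.order R - 1" "even ((Coset.order R - 1) div 3)"
  "(Coset.order R - 1) div 3 > 0"
proof -
  have "Coset.order R > 1"
    using card_mono[of "carrier R" "{\<zero>, \<one>}"] fin by (simp add: Coset.order_def)
  then show "3 * ((Coset.order R - 1) div 3) = Coset.order R - 1" "even ((Coset.order R - 1) div 3)"
    "(Coset.order R - 1) div 3 > 0"
    using order_mod by presburger+
qed

lemma \<kappa>_closed [simp]: "x \<in> carrier R \<Longrightarrow> \<kappa> x \<in> carrier R"
  by (simp add: \<kappa>_def)

lemma \<kappa>_mult: "\<lbrakk>x \<in> carrier R; y \<in> carrier R\<rbrakk> \<Longrightarrow> \<kappa> (x \<otimes> y) = \<kappa> x \<otimes> \<kappa> y"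
  by (simp add: \<kappa>_def nat_pow_distrib)

lemma \<kappa>_zero [simp]: "\<kappa> \<zero> = \<zero>"
  using exponent(3) by (simp add: \<kappa>_def nat_pow_zero)

lemma \<kappa>_minus:
  assumes "x \<in> carrier R"
  shows "\<kappa> (\<ominus> x) = \<kappa> x"
proof -
  obtain k where k: "(Coset.order R - 1) div 3 = 2 * k" using exponent(2) by blast
  have "(\<ominus> x) [^] (2 * k) = ((\<ominus> x) [^] (2::nat)) [^] k" using assms by (simp add: nat_pow_pow)
  also have "(\<ominus> x) [^] (2::nat) = x [^] (2::nat)"
    using assms by (simp add: numeral_2_eq_2 l_minus r_minus)
  also have "(x [^] (2::nat)) [^] k = x [^] (2 * k)" using assms by (simp add: nat_pow_pow)
  finally show ?thesis by (simp only: \<kappa>_def k)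
qed

lemma \<kappa>_diff_commute:
  assumes "x \<in> carrier R" "y \<in> carrier R"
  shows "\<kappa> (x \<ominus> y) = \<kappa> (y \<ominus> x)"
proof -
  have "x \<ominus> y = \<ominus> (y \<ominus> x)" using assms by algebra
  then show ?thesis using \<kappa>_minus[of "y \<ominus> x"] assms by simp
qed

lemma \<kappa>_cube:
  assumes "x \<in> carrier R" "x \<noteq> \<zero>"
  shows "\<kappa> x [^] (3::nat) = \<one>"
proof -
  interpret M: group "mult_of R" by (rule field_mult_group)
  have "x [^] (Coset.order R - 1) = \<one>"
    using M.pow_order_eq_1[of x] assms fin by (simp add: order_mult_of nat_pow_mult_of)
  then show ?thesis using assms exponent(1) by (simp add: \<kappa>_def nat_pow_pow mult.commute)
qed

lemma \<kappa>_eq_zero: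
  assumes "x \<in> carrier R"
  shows "\<kappa> x = \<zero> \<longleftrightarrow> x = \<zero>"
  using \<kappa>_cube[OF assms] by (cases "x = \<zero>") (auto simp: nat_pow_zero)

lemma cube_roots:
  assumes "a \<in> carrier R" "b \<in> carrier R" "c \<in> carrier R" "z \<in> carrier R" "rainbow3 a b c"
    "a [^] (3::nat) = \<one>" "b [^] (3::nat) = \<one>" "c [^] (3::nat) = \<one>" "z [^] (3::nat) = \<one>"
  shows "z \<in> {a, b, c}"
proof (rule ccontr)
  assume "z \<notin> {a, b, c}"
  then have "card {z, a, b, c} = 4" using assms(5) by (auto simp: rainbow3_def)
  moreover have "card {z, a, b, c} \<le> card {x \<in> carrier R. x [^] (3::nat) = \<one>}"
    using assms fin by (intro card_mono) auto
  ultimately show False using num_roots_le_deg[OF fin, of 3] by simp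
qed

text \<open>Otherwise the additive order of 1 would divide both 2 and the odd order of the
  field.\<close>

lemma neg_one_neq_one: "\<ominus> \<one> \<noteq> \<one>"
proof
  assume "\<ominus> \<one> = \<one>"
  then have 2: "\<one> \<oplus> \<one> = \<zero>" using r_neg[of \<one>] by simp
  have "group.ord (add_monoid R) \<one> dvd 2"
    using 2 group.pow_eq_id[OF a_group, of \<one> 2] by (simp add: numeral_2_eq_2)
  moreover have "group.ord (add_monoid R) \<one> dvd Coset.order R"
    using group.ord_dvd_group_order[OF a_group, of \<one>] by (simp add: Coset.order_def)
  moreover have "coprime 2 (Coset.order R)"
    using order_mod by (simp only: coprime_left_2_iff_odd) presburger
  ultimately have "group.ord (add_monoid R) \<one> dvd 1" by (metis coprime_common_divisor)
  then have "\<one> = \<zero>" using group.pow_eq_id[OF a_group, of \<one> 1] by simp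
  then show False by simp
qed

text \<open>The choice is made from the unordered set \<open>{s, \<ominus> s}\<close>, so
  \<open>s\<close> and its negative select the same element. The result contains exactly one element
  of each such pair among the nonzero cubes.\<close>

definition half_kernel :: "'a set" where
  "half_kernel = (\<lambda>s. SOME x. x \<in> {s, \<ominus> s}) ` {s \<in> carrier R. \<kappa> s = \<one>}"

lemma half_kernel:
  shows "s \<in> half_kernel \<Longrightarrow> s \<in> carrier R \<and> \<kappa> s = \<one>"
    and "\<lbrakk>s \<in> carrier R; \<kappa> s = \<one>\<rbrakk> \<Longrightarrow> s \<in> half_kernel \<or> \<ominus> s \<in> half_kernel"
    and "s \<in> half_kernel \<Longrightarrow> \<ominus> s \<notin> half_kernel"
proof -
  define r where "r s = (SOME x. x \<in> {s, \<ominus> s})" for s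
  have r: "r s \<in> {s, \<ominus> s}" for s unfolding r_def by (rule someI[of _ s]) simp
  have rm: "r (\<ominus> s) = r s" if "s \<in> carrier R" for s
    using that by (simp add: r_def insert_commute)
  have hk: "half_kernel = r ` {s \<in> carrier R. \<kappa> s = \<one>}" unfolding half_kernel_def r_def ..
  have ker: "s \<in> carrier R \<and> \<kappa> s = \<one>" if s: "s \<in> half_kernel" for s
  proof -
    obtain t where "t \<in> carrier R" "\<kappa> t = \<one>" "s = r t" using s unfolding hk by blast
    then show ?thesis using r[of t] \<kappa>_minus[of t] by auto
  qed
  then show "s \<in> half_kernel \<Longrightarrow> s \<in> carrier R \<and> \<kappa> s = \<one>" .
  show "s \<in> half_kernel \<or> \<ominus> s \<in> half_kernel" if "s \<in> carrier R" "\<kappa> s = \<one>" for s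
  proof -
    have "r s \<in> half_kernel" unfolding hk using that by blast
    then show ?thesis using r[of s] by auto
  qed
  have fix_r: "r s = s" if s: "s \<in> half_kernel" for s
  proof -
    obtain t where t: "t \<in> carrier R" "s = r t" using s unfolding hk by blast
    then have "s = t \<or> s = \<ominus> t" using r[of t] by simp
    then show ?thesis using t rm[OF t(1)] by metis
  qed
  show "\<ominus> s \<notin> half_kernel" if s: "s \<in> half_kernel"
  proof
    assume "\<ominus> s \<in> half_kernel"
    moreover have c: "s \<in> carrier R" "\<kappa> s = \<one>" using ker[OF s] by auto
    ultimately have "\<ominus> s = s" using fix_r[OF s] fix_r[of "\<ominus> s"] rm by simp
    then have "\<ominus> \<one> \<otimes> s = \<one> \<otimes> s" using c by (simp add: l_minus)
    moreover have "s \<noteq> \<zero>" using c by auto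
    ultimately show False using neg_one_neq_one c m_rcancel[of s "\<ominus> \<one>" \<one>] by simp
  qed
qed

text \<open>On each line the three differences represent all three cosets. Given \<open>d\<close>,
  division by the difference in its coset leaves a nonzero cube \<open>s\<close>. If only
  \<open>\<ominus> s\<close> was chosen as representative, exchanging \<open>j\<close> and
  \<open>k\<close> compensates the sign.\<close>

theorem difference_family_of_rainbow_heptad:
  assumes "rainbow_heptad R b"
  shows "fano_difference_family (add_monoid R) ((\<lambda>s i. s \<otimes> b i) ` half_kernel)" and "inj b"
proof -
  have b [simp]: "b i \<in> carrier R" for i
    using assms by (simp add: rainbow_heptad_def Let_def)
  have rb: "rainbow3 (\<kappa> (b i \<ominus> b (i + 1))) (\<kappa> (b (i + 1) \<ominus> b (i + 3))) (\<kappa> (b i \<ominus> b (i + 3)))" for i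
    using assms by (simp add: rainbow_heptad_def Let_def \<kappa>_def)
  define D where "D j k = b k \<ominus> b j" for j k
  have D [simp]: "D j k \<in> carrier R" for j k by (simp add: D_def)
  have D_neg: "D k j = \<ominus> D j k" for j k unfolding D_def using b[of j] b[of k] by algebra
  have \<kappa>D: "\<kappa> (D j k) = \<kappa> (D k j)" for j k unfolding D_def by (rule \<kappa>_diff_commute) auto
  \<comment> \<open>If two points of a line coincided, their differences to the third point would
    agree up to sign, and two of the three values of \<open>\<kappa>\<close> would be equal.\<close>
  have ne: "b c \<noteq> b (c + 1)" "b (c + 1) \<noteq> b (c + 3)" "b c \<noteq> b (c + 3)" for c
    using rb[of c] \<kappa>_diff_commute[of "b (c + 1)" "b (c + 3)"] \<kappa>_diff_commute[of "b c" "b (c + 1)"]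
    by (auto simp: rainbow3_def)
  have ne_line: "b j \<noteq> b k" if "j \<in> line_indices c" "k \<in> line_indices c" "j \<noteq> k" for j k c
    using that ne[of c] by (auto simp: line_indices_def)
  have D_nonzero: "D j k \<noteq> \<zero>" if "j \<in> line_indices c" "k \<in> line_indices c" "j \<noteq> k" for j k c
    using ne_line[OF that] by (auto simp: D_def)
  show inj_b: "inj b"
  proof (rule injI, rule ccontr)
    fix j k assume "b j = b k" "j \<noteq> k"
    moreover have "\<exists>c. j \<in> line_indices c \<and> k \<in> line_indices c"
    proof -
      have "j \<in> {0, 1, 2, 3, 4, 5, 6}" "k \<in> {0, 1, 2, 3, 4, 5, 6}"
        using UNIV_7 by auto
      then have "\<exists>c\<in>UNIV. j \<in> line_indices c \<and> k \<in> line_indices c"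
        unfolding UNIV_7 line_indices_def by (elim insertE emptyE; simp)
      then show ?thesis by blast
    qed
    ultimately show False using ne_line by blast
  qed
  \<comment> \<open>Only the unordered pair can be recovered here, because \<open>\<kappa>\<close>
    does not see the sign.\<close>
  have pair: "{j, k} = {j', k'}"
    if "j \<in> line_indices c" "k \<in> line_indices c" "j' \<in> line_indices c" "k' \<in> line_indices c"
      "j \<noteq> k" "j' \<noteq> k'" "\<kappa> (D j k) = \<kappa> (D j' k')" for c j k j' k'
  proof -
    have "rainbow3 (\<kappa> (D (c + 1) c)) (\<kappa> (D (c + 3) (c + 1))) (\<kappa> (D (c + 3) c))"
      using rb[of c] by (simp add: D_def)
    then show ?thesis
      using that \<kappa>D[of c "c + 1"] \<kappa>D[of c "c + 3"] \<kappa>D[of "c + 1" "c + 3"]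
      unfolding line_indices_def rainbow3_def by (elim insertE emptyE) auto
  qed
  have exists_pair: "\<exists>j\<in>line_indices c. \<exists>k\<in>line_indices c. j \<noteq> k \<and> \<kappa> (D j k) = \<kappa> d"
    if "d \<in> carrier R" "d \<noteq> \<zero>" for c d
  proof -
    have "\<kappa> d \<in> {\<kappa> (D (c + 1) c), \<kappa> (D (c + 3) (c + 1)), \<kappa> (D (c + 3) c)}"
      using that rb[of c] ne[of c] unfolding D_def
      by (intro cube_roots \<kappa>_cube \<kappa>_closed) auto
    moreover have "c \<noteq> c + 1" "c + 1 \<noteq> c + 3" "c \<noteq> c + 3" by simp_all
    ultimately show ?thesis unfolding line_indices_def by auto
  qed
  have diff: "inv\<^bsub>add_monoid R\<^esub> (s \<otimes> b j) \<otimes>\<^bsub>add_monoid R\<^esub> (s \<otimes> b k) = s \<otimes> D j k"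
    if "s \<in> carrier R" for s j k
  proof -
    have "\<ominus> (s \<otimes> b j) \<oplus> s \<otimes> b k = s \<otimes> D j k"
      unfolding D_def using that b[of j] b[of k] by algebra
    then show ?thesis by (simp add: a_inv_def)
  qed
  note hk = half_kernel
  have hk0: "s \<noteq> \<zero>" if "s \<in> half_kernel" for s using hk(1)[OF that] by auto
  show "fano_difference_family (add_monoid R) ((\<lambda>s i. s \<otimes> b i) ` half_kernel)"
  proof (rule fano_difference_familyI)
    fix f assume "f \<in> (\<lambda>s i. s \<otimes> b i) ` half_kernel"
    then show "inj f" using inj_b hk(1) hk0 by (auto simp: inj_def m_lcancel)
  next
    fix f i assume "f \<in> (\<lambda>s i. s \<otimes> b i) ` half_kernel"
    then show "f i \<in> carrier (add_monoid R)" using hk(1) by auto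
  next
    fix c d assume d: "d \<in> carrier (add_monoid R)" "d \<noteq> \<one>\<^bsub>add_monoid R\<^esub>"
    then have d': "d \<in> carrier R" "d \<noteq> \<zero>" by auto
    then obtain j k where jk: "j \<in> line_indices c" "k \<in> line_indices c" "j \<noteq> k" "\<kappa> (D j k) = \<kappa> d"
      using exists_pair by blast
    note Dn = D_nonzero[OF jk(1-3)]
    define s where "s = d \<otimes> inv (D j k)"
    have s: "s \<in> carrier R" "s \<otimes> D j k = d"
      using Dn d' by (auto simp: s_def m_assoc field_Units)
    have "\<kappa> s \<otimes> \<kappa> (D j k) = \<one> \<otimes> \<kappa> (D j k)"
      using \<kappa>_mult[of s "D j k"] s jk(4) d' by simp
    then have "\<kappa> s = \<one>"
      using Dn s(1) \<kappa>_eq_zero[of "D j k"] m_rcancel[of "\<kappa> (D j k)" "\<kappa> s" \<one>] by simp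
    then have "s \<in> half_kernel \<or> \<ominus> s \<in> half_kernel" using hk(2) s by blast
    then show "\<exists>f\<in>(\<lambda>s i. s \<otimes> b i) ` half_kernel. \<exists>j\<in>line_indices c. \<exists>k\<in>line_indices c.
        inv\<^bsub>add_monoid R\<^esub> (f j) \<otimes>\<^bsub>add_monoid R\<^esub> f k = d"
    proof
      assume "s \<in> half_kernel"
      then show ?thesis using jk(1,2) s diff[OF s(1)]
        by (intro bexI[of _ "\<lambda>i. s \<otimes> b i"] bexI[of _ j] bexI[of _ k]) simp_all
    next
      assume "\<ominus> s \<in> half_kernel"
      moreover have "\<ominus> s \<otimes> D k j = d" unfolding D_neg[of k j] using s d' D[of j k] by (simp add: l_minus r_minus)
      ultimately show ?thesis using jk(1,2) s diff[of "\<ominus> s" k j]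
        by (intro bexI[of _ "\<lambda>i. \<ominus> s \<otimes> b i"] bexI[of _ k] bexI[of _ j]) simp_all
    qed
  next
    fix c f f' j k j' k'
    assume "f \<in> (\<lambda>s i. s \<otimes> b i) ` half_kernel" "f' \<in> (\<lambda>s i. s \<otimes> b i) ` half_kernel"
    then obtain s s' where s: "s \<in> half_kernel" "s' \<in> half_kernel"
      "f = (\<lambda>i. s \<otimes> b i)" "f' = (\<lambda>i. s' \<otimes> b i)" by blast
    note sc = hk(1)[OF s(1)] hk(1)[OF s(2)]
    assume jk: "j \<in> line_indices c" "k \<in> line_indices c" "j' \<in> line_indices c"
      "k' \<in> line_indices c" "j \<noteq> k" "j' \<noteq> k'"
    assume "inv\<^bsub>add_monoid R\<^esub> f j \<otimes>\<^bsub>add_monoid R\<^esub> f k = inv\<^bsub>add_monoid R\<^esub> f' j' \<otimes>\<^bsub>add_monoid R\<^esub> f' k'"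
    then have eq: "s \<otimes> D j k = s' \<otimes> D j' k'" using s sc diff by simp
    then have "\<kappa> (D j k) = \<kappa> (D j' k')"
      using \<kappa>_mult[of s "D j k"] \<kappa>_mult[of s' "D j' k'"] sc by simp
    from pair[OF jk this] consider "j = j'" "k = k'" | "j = k'" "k = j'"
      by (auto simp: doubleton_eq_iff)
    then show "f = f' \<and> j = j' \<and> k = k'"
    proof cases
      case 1
      then have "s = s'" using eq sc D_nonzero[OF jk(1,2,5)] by (simp add: m_rcancel)
      then show ?thesis using 1 s by simp
    next
      case 2
      \<comment> \<open>Opposite orientations would require a representative together with its
        negative.\<close>
      have "s \<otimes> D j k = \<ominus> s' \<otimes> D j k"
        unfolding eq unfolding 2 D_neg[of k' j'] using sc D[of k' j'] D[of j' k'] D_neg[of j' k']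
        by (simp add: l_minus r_minus)
      then have "s = \<ominus> s'" using sc D_nonzero[OF jk(1,2,5)] by (simp add: m_rcancel)
      then show ?thesis using hk(3) s by blast
    qed
  qed
qed

end

section \<open>The complex cubic character\<close>

context cubic_field
begin

text \<open>The polynomial \<open>x ^ ((q - 1) / 3) - 1\<close> has at most a third as many roots as
  there are nonzero elements.\<close>

lemma exists_noncube: "\<exists>\<gamma>\<in>carrier R. \<gamma> \<noteq> \<zero> \<and> \<kappa> \<gamma> \<noteq> \<one>"
proof (rule ccontr)
  assume "\<not> ?thesis"
  then have "carrier R - {\<zero>} \<subseteq> {x \<in> carrier R. x [^] ((Coset.order R - 1) div 3) = \<one>}"
    by (auto simp: \<kappa>_def)
  then have "card (carrier R - {\<zero>}) \<le> card {x \<in> carrier R. x [^] ((Coset.order R - 1) div 3) = \<one>}"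
    using fin by (intro card_mono) auto
  also have "\<dots> \<le> (Coset.order R - 1) div 3"
    using exponent(3) by (intro num_roots_le_deg[OF fin]) simp
  finally have "card (carrier R - {\<zero>}) \<le> (Coset.order R - 1) div 3" .
  then show False using exponent by (simp add: Coset.order_def)
qed

definition \<gamma> :: 'a where "\<gamma> = (SOME \<gamma>. \<gamma> \<in> carrier R \<and> \<gamma> \<noteq> \<zero> \<and> \<kappa> \<gamma> \<noteq> \<one>)"

lemma \<gamma>: "\<gamma> \<in> carrier R" "\<gamma> \<noteq> \<zero>" "\<kappa> \<gamma> \<noteq> \<one>"
  using someI_ex[of "\<lambda>\<gamma>. \<gamma> \<in> carrier R \<and> \<gamma> \<noteq> \<zero> \<and> \<kappa> \<gamma> \<noteq> \<one>"] exists_noncube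
  unfolding \<gamma>_def by blast+

definition \<zeta> :: complex where "\<zeta> = Complex (-1/2) (sqrt 3 / 2)"

lemma \<zeta>: "\<zeta> * (\<zeta> * \<zeta>) = 1" "\<zeta> \<noteq> 1" "\<zeta> \<noteq> 0" "\<zeta> * cnj \<zeta> = 1" "\<zeta> * \<zeta> = cnj \<zeta>"
    "cnj \<zeta> * (cnj \<zeta> * cnj \<zeta>) = 1"
  by (auto simp: \<zeta>_def complex_eq_iff)

text \<open>This is \<open>\<kappa>\<close> followed by the isomorphism of the cube roots of unity
  of the field with the complex ones that sends \<open>\<kappa> \<gamma>\<close> to
  \<open>\<zeta>\<close>, extended by 0.\<close>

definition \<eta> :: "'a \<Rightarrow> complex" where
  "\<eta> x = (if x = \<zero> then 0 else if \<kappa> x = \<one> then 1 else if \<kappa> x = \<kappa> \<gamma> then \<zeta> else \<zeta> * \<zeta>)"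

lemma \<gamma>_table:
  defines "w \<equiv> \<kappa> \<gamma>"
  shows "w \<in> carrier R" "w \<otimes> (w \<otimes> w) = \<one>" "w \<otimes> w \<noteq> \<one>" "w \<otimes> w \<noteq> w"
    "w \<otimes> w \<otimes> (w \<otimes> w) = w" "w \<otimes> w \<otimes> w = \<one>"
proof -
  show w: "w \<in> carrier R" using \<gamma> by (simp add: w_def)
  have "w \<noteq> \<one>" using \<gamma> by (simp add: w_def)
  show w3: "w \<otimes> (w \<otimes> w) = \<one>"
    using \<kappa>_cube[OF \<gamma>(1,2)] w by (simp add: w_def[symmetric] numeral_3_eq_3 m_assoc)
  show "w \<otimes> w \<noteq> \<one>" using w w3 \<open>w \<noteq> \<one>\<close> by auto
  show "w \<otimes> w \<noteq> w"
  proof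
    assume a: "w \<otimes> w = w"
    show False using w3 \<open>w \<noteq> \<one>\<close> unfolding a by simp
  qed
  show "w \<otimes> w \<otimes> w = \<one>" using w w3 by (simp add: m_assoc)
  show "w \<otimes> w \<otimes> (w \<otimes> w) = w" using w w3 by (simp add: m_assoc)
qed

lemma \<kappa>_cases:
  assumes "x \<in> carrier R" "x \<noteq> \<zero>"
  shows "\<kappa> x \<in> {\<one>, \<kappa> \<gamma>, \<kappa> \<gamma> \<otimes> \<kappa> \<gamma>}"
proof (rule cube_roots)
  show "rainbow3 \<one> (\<kappa> \<gamma>) (\<kappa> \<gamma> \<otimes> \<kappa> \<gamma>)"
    using \<gamma>(3) \<gamma>_table(3,4) by (auto simp: rainbow3_def)
  have "(\<kappa> \<gamma> \<otimes> \<kappa> \<gamma>) [^] (3::nat) = \<kappa> \<gamma> [^] (3::nat) \<otimes> \<kappa> \<gamma> [^] (3::nat)"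
    using \<gamma> by (simp add: nat_pow_distrib)
  then show "(\<kappa> \<gamma> \<otimes> \<kappa> \<gamma>) [^] (3::nat) = \<one>" using \<kappa>_cube[OF \<gamma>(1,2)] by simp
qed (use assms \<gamma> \<kappa>_cube in auto)

lemma \<eta>_zero [simp]: "\<eta> \<zero> = 0" by (simp add: \<eta>_def)

lemma \<eta>_mult:
  assumes "x \<in> carrier R" "y \<in> carrier R"
  shows "\<eta> (x \<otimes> y) = \<eta> x * \<eta> y"
proof (cases "x = \<zero> \<or> y = \<zero>")
  case True
  then show ?thesis using assms by auto
next
  case False
  then have xy: "x \<noteq> \<zero>" "y \<noteq> \<zero>" "x \<otimes> y \<noteq> \<zero>" using assms integral by auto
  define e where "e k = (if k = \<one> then 1 else if k = \<kappa> \<gamma> then \<zeta> else \<zeta> * \<zeta>)" for k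
  have "e (u \<otimes> v) = e u * e v" if "u \<in> {\<one>, w, w \<otimes> w}" "v \<in> {\<one>, w, w \<otimes> w}" "w = \<kappa> \<gamma>" for u v w
  proof -
    have \<zeta>4: "\<zeta> * \<zeta> * (\<zeta> * \<zeta>) = \<zeta>" using \<zeta>(1) by (simp add: mult.assoc)
    have "w \<noteq> \<one>" using \<gamma>(3) that(3) by simp
    then show ?thesis using that(1,2) \<gamma>_table[folded that(3)] unfolding e_def that(3)[symmetric]
      by (elim insertE emptyE) (simp_all add: \<zeta>(1) \<zeta>4 mult.assoc)
  qed
  from this[OF \<kappa>_cases[OF assms(1) xy(1)] \<kappa>_cases[OF assms(2) xy(2)] refl]
  have "e (\<kappa> (x \<otimes> y)) = e (\<kappa> x) * e (\<kappa> y)" by (simp only: \<kappa>_mult[OF assms])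
  moreover have "\<eta> z = e (\<kappa> z)" if "z \<noteq> \<zero>" for z using that by (simp add: \<eta>_def e_def)
  ultimately show ?thesis using xy by metis
qed

lemma \<eta>_eq_zero: "x \<in> carrier R \<Longrightarrow> \<eta> x = 0 \<longleftrightarrow> x = \<zero>"
  using \<zeta>(3) by (auto simp: \<eta>_def)

lemma \<eta>_cong: "\<lbrakk>x \<in> carrier R; y \<in> carrier R; \<kappa> x = \<kappa> y\<rbrakk> \<Longrightarrow> \<eta> x = \<eta> y"
  using \<kappa>_eq_zero[of x] \<kappa>_eq_zero[of y] by (simp add: \<eta>_def)

lemma \<eta>_unit:
  assumes "x \<in> carrier R" "x \<noteq> \<zero>"
  shows "\<eta> x ^ 3 = 1" "\<eta> x * cnj (\<eta> x) = 1"
  using assms \<zeta> by (auto simp: \<eta>_def power3_eq_cube mult.commute)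

lemma bij_mult:
  assumes "c \<in> carrier R" "c \<noteq> \<zero>"
  shows "bij_betw (\<lambda>x. c \<otimes> x) (carrier R) (carrier R)"
proof -
  have "inj_on (\<lambda>x. c \<otimes> x) (carrier R)" using assms by (auto simp: inj_on_def m_lcancel)
  moreover from this have "(\<lambda>x. c \<otimes> x) ` carrier R = carrier R"
    using assms by (intro endo_inj_surj fin) auto
  ultimately show ?thesis by (simp add: bij_betw_def)
qed

lemma bij_add:
  assumes "c \<in> carrier R"
  shows "bij_betw (\<lambda>x. x \<oplus> c) (carrier R) (carrier R)"
proof -
  have "inj_on (\<lambda>x. x \<oplus> c) (carrier R)" using assms by (auto simp: inj_on_def)
  moreover from this have "(\<lambda>x. x \<oplus> c) ` carrier R = carrier R"
    using assms by (intro endo_inj_surj fin) auto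
  ultimately show ?thesis by (simp add: bij_betw_def)
qed

text \<open>Multiplication by the noncube \<open>\<gamma>\<close> permutes the field and multiplies
  the sum by \<open>\<zeta> \<noteq> 1\<close>.\<close>

lemma \<eta>_sum: "(\<Sum>x\<in>carrier R. \<eta> x) = 0"
proof -
  have "(\<Sum>x\<in>carrier R. \<eta> x) = (\<Sum>x\<in>carrier R. \<eta> (\<gamma> \<otimes> x))"
    by (rule sum.reindex_bij_betw[OF bij_mult, symmetric]) (use \<gamma> in auto)
  also have "\<dots> = (\<Sum>x\<in>carrier R. \<zeta> * \<eta> x)"
    using \<gamma> by (intro sum.cong refl) (simp add: \<eta>_mult, simp add: \<eta>_def)
  also have "\<dots> = \<zeta> * (\<Sum>x\<in>carrier R. \<eta> x)" by (simp add: sum_distrib_left)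
  finally have "(1 - \<zeta>) * (\<Sum>x\<in>carrier R. \<eta> x) = 0" by (simp add: algebra_simps)
  then show ?thesis using \<zeta>(2) by simp
qed

text \<open>Scaling by \<open>c\<close> shows that all nonzero shifts give the same value. Over all
  shifts the values sum to 0 because \<open>\<eta>\<close> does, and the shift 0 gives
  \<open>q - 1\<close>, which leaves -1 for each of the other \<open>q - 1\<close>.\<close>

lemma \<eta>_correlation:
  assumes a: "a \<in> carrier R" "a \<noteq> \<zero>"
  shows "(\<Sum>x\<in>carrier R. \<eta> x * cnj (\<eta> (x \<oplus> a))) = -1"
proof -
  define S where "S a = (\<Sum>x\<in>carrier R. \<eta> x * cnj (\<eta> (x \<oplus> a)))" for a
  have scale: "S c = S \<one>" if c: "c \<in> carrier R" "c \<noteq> \<zero>" for c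
  proof -
    have "S c = (\<Sum>x\<in>carrier R. \<eta> (c \<otimes> x) * cnj (\<eta> (c \<otimes> x \<oplus> c)))"
      unfolding S_def by (rule sum.reindex_bij_betw[OF bij_mult[OF c], symmetric])
    also have "\<dots> = S \<one>" unfolding S_def
    proof (intro sum.cong refl)
      fix x assume x: "x \<in> carrier R"
      have e: "c \<otimes> x \<oplus> c = c \<otimes> (x \<oplus> \<one>)" using c x by algebra
      have "\<eta> (c \<otimes> x) * cnj (\<eta> (c \<otimes> x \<oplus> c)) = (\<eta> c * cnj (\<eta> c)) * (\<eta> x * cnj (\<eta> (x \<oplus> \<one>)))"
        unfolding e using c x by (simp add: \<eta>_mult)
      then show "\<eta> (c \<otimes> x) * cnj (\<eta> (c \<otimes> x \<oplus> c)) = \<eta> x * cnj (\<eta> (x \<oplus> \<one>))"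
        using \<eta>_unit(2)[OF c] by simp
    qed
    finally show ?thesis .
  qed
  have "(\<Sum>c\<in>carrier R. S c) = (\<Sum>x\<in>carrier R. \<Sum>c\<in>carrier R. \<eta> x * cnj (\<eta> (x \<oplus> c)))"
    unfolding S_def by (rule sum.swap)
  also have "\<dots> = (\<Sum>x\<in>carrier R. 0)"
  proof (intro sum.cong refl)
    fix x assume x: "x \<in> carrier R"
    have "(\<Sum>c\<in>carrier R. \<eta> (x \<oplus> c)) = (\<Sum>c\<in>carrier R. \<eta> (c \<oplus> x))"
      using x by (intro sum.cong refl) (simp add: a_comm)
    also have "\<dots> = 0" using sum.reindex_bij_betw[OF bij_add[OF x], of \<eta>] \<eta>_sum by simp
    finally show "(\<Sum>c\<in>carrier R. \<eta> x * cnj (\<eta> (x \<oplus> c))) = 0"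
      by (simp add: sum_distrib_left[symmetric] cnj_sum[symmetric] del: cnj_sum)
  qed
  finally have tot: "(\<Sum>c\<in>carrier R. S c) = 0" by simp
  have "S \<zero> = (\<Sum>x\<in>carrier R - {\<zero>}. 1)"
    unfolding S_def using fin
    by (subst sum.remove[of _ \<zero>]) (auto simp: \<eta>_unit(2) simp del: sum_constant intro!: sum.cong)
  moreover have "(\<Sum>c\<in>carrier R. S c) = S \<zero> + (\<Sum>c\<in>carrier R - {\<zero>}. S \<one>)"
    using fin by (subst sum.remove[of _ \<zero>]) (auto simp del: sum_constant intro!: sum.cong scale)
  moreover have "card (carrier R - {\<zero>}) \<noteq> 0"
    using exponent(1,3) fin by (simp add: Coset.order_def)
  ultimately have "of_nat (card (carrier R - {\<zero>})) * (1 + S \<one>) = 0" "of_nat (card (carrier R - {\<zero>})) \<noteq> (0 :: complex)"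
    using tot by (simp_all only: sum_constant of_nat_eq_0_iff distrib_left mult_1_right) simp
  then have "S \<one> = -1" by (simp add: add_eq_0_iff)
  then show ?thesis using scale[OF a] unfolding S_def by simp
qed

sublocale homogeneous_cubic_scheme "carrier R" "\<lambda>x y. \<eta> (x \<ominus> y)"
proof -
  have flip: "\<eta> (x \<ominus> y) = \<eta> (y \<ominus> x)" if "x \<in> carrier R" "y \<in> carrier R" for x y
    using that by (intro \<eta>_cong \<kappa>_diff_commute) auto
  interpret cubic_scheme "carrier R" "\<lambda>x y. \<eta> (x \<ominus> y)"
  proof
    show "finite (carrier R)" by (rule fin)
  next
    fix x y assume xy: "x \<in> carrier R" "y \<in> carrier R"
    then show "\<eta> (x \<ominus> y) = \<eta> (y \<ominus> x)" by (rule flip)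
    assume ne: "x \<noteq> y"
    then show "\<eta> (x \<ominus> y) ^ 3 = 1" using xy by (intro \<eta>_unit) auto
    have bij: "bij_betw (\<lambda>u. u \<oplus> x) (carrier R) (carrier R)" by (rule bij_add[OF xy(1)])
    have "(\<Sum>z\<in>carrier R. \<eta> (x \<ominus> z) * cnj (\<eta> (y \<ominus> z)))
        = (\<Sum>u\<in>carrier R. \<eta> (x \<ominus> (u \<oplus> x)) * cnj (\<eta> (y \<ominus> (u \<oplus> x))))"
      by (rule sum.reindex_bij_betw[OF bij, symmetric])
    also have "\<dots> = (\<Sum>u\<in>carrier R. \<eta> u * cnj (\<eta> (u \<oplus> (x \<ominus> y))))"
    proof (intro sum.cong refl)
      fix u assume u: "u \<in> carrier R"
      have "(u \<oplus> x) \<ominus> x = u" "(u \<oplus> x) \<ominus> y = u \<oplus> (x \<ominus> y)" using u xy by algebra+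
      then show "\<eta> (x \<ominus> (u \<oplus> x)) * cnj (\<eta> (y \<ominus> (u \<oplus> x))) = \<eta> u * cnj (\<eta> (u \<oplus> (x \<ominus> y)))"
        using flip[of x "u \<oplus> x"] flip[of y "u \<oplus> x"] u xy by simp
    qed
    also have "\<dots> = -1" using xy ne by (intro \<eta>_correlation) auto
    finally show "(\<Sum>z\<in>carrier R. \<eta> (x \<ominus> z) * cnj (\<eta> (y \<ominus> z))) = -1" .
  next
    fix x assume "x \<in> carrier R"
    then show "\<eta> (x \<ominus> x) = 0" by (simp add: minus_eq r_neg)
  qed
  show "homogeneous_cubic_scheme (carrier R) (\<lambda>x y. \<eta> (x \<ominus> y))"
  proof
    fix x y x' y' assume xy: "x \<in> carrier R" "y \<in> carrier R" "x \<noteq> y"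
      and xy': "x' \<in> carrier R" "y' \<in> carrier R" "x' \<noteq> y'"
    \<comment> \<open>The slope of the affine map that sends \<open>x\<close>, \<open>y\<close> to
      \<open>x'\<close>, \<open>y'\<close>.\<close>
    define c where "c = (y' \<ominus> x') \<otimes> inv (y \<ominus> x)"
    have nz: "y \<ominus> x \<noteq> \<zero>" "y' \<ominus> x' \<noteq> \<zero>" using xy xy' by auto
    then have iv: "inv (y \<ominus> x) \<in> carrier R" "inv (y \<ominus> x) \<otimes> (y \<ominus> x) = \<one>"
      using xy by (auto simp: field_Units)
    have c: "c \<in> carrier R" unfolding c_def using iv(1) xy' by simp
    have cm: "c \<otimes> (y \<ominus> x) = y' \<ominus> x'"
      unfolding c_def using iv xy xy' by (simp add: m_assoc)
    then have c0: "c \<noteq> \<zero>" using nz xy by auto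
    define f where "f u = c \<otimes> u \<oplus> (x' \<ominus> c \<otimes> x)" for u
    have "bij_betw ((\<lambda>u. u \<oplus> (x' \<ominus> c \<otimes> x)) \<circ> (\<lambda>u. c \<otimes> u)) (carrier R) (carrier R)"
      using xy xy' c c0 by (intro bij_betw_trans[of _ _ "carrier R"] bij_mult bij_add) auto
    then have "bij_betw f (carrier R) (carrier R)" unfolding comp_def f_def[symmetric] .
    moreover have "f x = x'" unfolding f_def using xy xy' c by algebra
    moreover have "f y = y'"
    proof -
      have "f y = c \<otimes> (y \<ominus> x) \<oplus> x'" unfolding f_def using xy xy' c by algebra
      then show ?thesis unfolding cm using xy' by algebra
    qed
    moreover have "rb (f u) (f v) (f w) \<longleftrightarrow> rb u v w"
      if "u \<in> carrier R" "v \<in> carrier R" "w \<in> carrier R" for u v w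
    proof -
      have "\<eta> (f u \<ominus> f v) = \<eta> c * \<eta> (u \<ominus> v)" if "u \<in> carrier R" "v \<in> carrier R" for u v
      proof -
        have "f u \<ominus> f v = c \<otimes> (u \<ominus> v)" unfolding f_def using xy xy' c that by algebra
        then show ?thesis using \<eta>_mult c that by simp
      qed
      moreover have "\<eta> c \<noteq> 0" using \<eta>_eq_zero c c0 by simp
      ultimately show ?thesis using that unfolding rb_def rainbow3_def by simp
    qed
    ultimately show "\<exists>f. bij_betw f (carrier R) (carrier R) \<and> f x = x' \<and> f y = y' \<and>
      (\<forall>u\<in>carrier R. \<forall>v\<in>carrier R. \<forall>w\<in>carrier R. rb (f u) (f v) (f w) \<longleftrightarrow> rb u v w)"
      by blast
  qed
qed

section \<open>From a rainbow heptad to families of many orders\<close>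

theorem rainbow_heptad_of_large_order:
  assumes "Coset.order R \<ge> 6400"
  shows "\<exists>b. rainbow_heptad R b"
proof -
  obtain b :: "7 \<Rightarrow> 'a" where b: "\<And>i. b i \<in> carrier R" "\<And>i. rb (b i) (b (i + 1)) (b (i + 3))"
    using rainbow_fano assms unfolding Coset.order_def by blast
  have "rainbow3 (\<kappa> (b i \<ominus> b (i + 1))) (\<kappa> (b (i + 1) \<ominus> b (i + 3))) (\<kappa> (b i \<ominus> b (i + 3)))" for i
    using b(2)[of i] b(1) \<eta>_cong[of "b i \<ominus> b (i + 1)" "b (i + 1) \<ominus> b (i + 3)"]
      \<eta>_cong[of "b i \<ominus> b (i + 1)" "b i \<ominus> b (i + 3)"]
      \<eta>_cong[of "b (i + 1) \<ominus> b (i + 3)" "b i \<ominus> b (i + 3)"]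
    unfolding rb_def rainbow3_def by auto
  then have "rainbow_heptad R b"
    unfolding rainbow_heptad_def Let_def \<kappa>_def[symmetric] using b(1) by blast
  then show ?thesis by blast
qed

lemma has_difference_family_of_rainbow_heptad:
  assumes "rainbow_heptad R b"
  shows "has_fano_difference_family (Coset.order R)"
    and "has_fano_difference_family u \<Longrightarrow> has_fano_difference_family (u * Coset.order R)"
proof -
  note df = difference_family_of_rainbow_heptad[OF assms]
  have ord: "Coset.order (add_monoid R) = Coset.order R" by (simp add: Coset.order_def)
  show "has_fano_difference_family (Coset.order R)"
    using group.has_fano_difference_familyI[OF a_group _ df(1)] fin ord by simp
  assume "has_fano_difference_family u"
  then obtain G :: "nat monoid" and \<B> where G: "group G" "Coset.order G = u" "finite (carrier G)"
    "fano_difference_family G \<B>" unfolding has_fano_difference_family_def by blast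
  have b: "b i \<in> carrier R" for i using assms by (simp add: rainbow_heptad_def Let_def)
  \<comment> \<open>The heptad provides its own multipliers: for \<open>j \<noteq> k\<close> the map
    \<open>h\<close> to \<open>(b k \<ominus> b j) \<otimes> h\<close> is bijective because the
    entries of \<open>b\<close> are distinct.\<close>
  have prod: "fano_difference_family (G \<times>\<times> add_monoid R)
    ({\<lambda>j. (a j, b j \<otimes> h) | a h. a \<in> \<B> \<and> h \<in> carrier (add_monoid R)} \<union>
     {\<lambda>j. (\<one>\<^bsub>G\<^esub>, f j) | f. f \<in> (\<lambda>s i. s \<otimes> b i) ` half_kernel})"
  proof (rule fano_difference_family_product[OF G(1) a_group G(4) df(1)])
    fix j h assume "h \<in> carrier (add_monoid R)"
    then show "b j \<otimes> h \<in> carrier (add_monoid R)" using b by simp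
  next
    fix j k :: 7 assume "j \<noteq> k"
    then have "b j \<noteq> b k" using df(2) by (auto simp: inj_def)
    then have nz: "b k \<ominus> b j \<noteq> \<zero>" using b by auto
    have "bij_betw (\<lambda>h. (b k \<ominus> b j) \<otimes> h) (carrier R) (carrier R)"
      using nz b by (intro bij_mult) auto
    moreover have "(b k \<ominus> b j) \<otimes> h = inv\<^bsub>add_monoid R\<^esub> (b j \<otimes> h) \<otimes>\<^bsub>add_monoid R\<^esub> (b k \<otimes> h)"
      if h: "h \<in> carrier R" for h
    proof -
      have "(b k \<ominus> b j) \<otimes> h = \<ominus> (b j \<otimes> h) \<oplus> b k \<otimes> h" using h b[of j] b[of k] by algebra
      then show ?thesis by (simp add: a_inv_def)
    qed
    ultimately show "bij_betw (\<lambda>h. inv\<^bsub>add_monoid R\<^esub> (b j \<otimes> h) \<otimes>\<^bsub>add_monoid R\<^esub> (b k \<otimes> h))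
        (carrier (add_monoid R)) (carrier (add_monoid R))"
      by (subst bij_betw_cong[symmetric]) auto
  qed
  have grp: "group (G \<times>\<times> add_monoid R)" using G(1) a_group by (rule DirProd_group)
  have fin': "finite (carrier (G \<times>\<times> add_monoid R))" using G(3) fin by simp
  have "Coset.order (G \<times>\<times> add_monoid R) = u * Coset.order R"
    using G(2) by (simp add: Coset.order_def card_cartesian_product)
  then show "has_fano_difference_family (u * Coset.order R)"
    using group.has_fano_difference_familyI[OF grp fin' prod] by simp
qed

text \<open>The group for a power is a direct product, so no heptad in an extension field has to be
  found.\<close>

lemma has_difference_family_mult_power:
  assumes "rainbow_heptad R b" "has_fano_difference_family u"
  shows "has_fano_difference_family (u * Coset.order R ^ k)"
proof (induction k)
  case (Suc k)
  then show ?case using has_difference_family_of_rainbow_heptad(2)[OF assms(1) Suc] by (simp add: mult_ac)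
qed (use assms in simp)

lemma has_difference_family_power:
  assumes "rainbow_heptad R b" "k \<ge> 1"
  shows "has_fano_difference_family (Coset.order R ^ k)"
  using has_difference_family_mult_power[OF assms(1) has_difference_family_of_rainbow_heptad(1)[OF assms(1)], of "k - 1"]
    assms(2) by (simp flip: power_Suc)

end

section \<open>Prime fields of small order\<close>

lemma rainbow_heptad_sevenI:
  assumes "{x0, x1, x2, x3, x4, x5, x6} \<subseteq> carrier R"
    and "all_lines (\<lambda>x y z. rainbow3 ((x \<ominus>\<^bsub>R\<^esub> y) [^]\<^bsub>R\<^esub> ((Coset.order R - 1) div 3))
      ((y \<ominus>\<^bsub>R\<^esub> z) [^]\<^bsub>R\<^esub> ((Coset.order R - 1) div 3)) ((x \<ominus>\<^bsub>R\<^esub> z) [^]\<^bsub>R\<^esub> ((Coset.order R - 1) div 3)))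
      x0 x1 x2 x3 x4 x5 x6"
  shows "rainbow_heptad R (seven x0 x1 x2 x3 x4 x5 x6)"
proof -
  have "\<forall>i. seven x0 x1 x2 x3 x4 x5 x6 i \<in> carrier R"
    using assms(1) by (simp add: all_7 seven_def)
  moreover note assms(2)[folded all_lines_seven]
  ultimately show ?thesis unfolding rainbow_heptad_def Let_def by blast
qed

text \<open>A separate constant lets symbolic evaluation normalize the argument once before it is
  duplicated. Otherwise each squaring would evaluate the smaller power twice.\<close>

definition square_with :: "('a \<Rightarrow> 'a \<Rightarrow> 'a) \<Rightarrow> 'a \<Rightarrow> 'a" where
  "square_with f x = f x x"

fun num_pow :: "('a \<Rightarrow> 'a \<Rightarrow> 'a) \<Rightarrow> 'a \<Rightarrow> num \<Rightarrow> 'a" where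
  "num_pow f x num.One = x"
| "num_pow f x (num.Bit0 n) = square_with f (num_pow f x n)"
| "num_pow f x (num.Bit1 n) = f x (square_with f (num_pow f x n))"

text \<open>The code equation below hands the binary digits of a positive numeral to
  \<open>num_pow\<close>, so that powers are computed by repeated squaring.\<close>

definition int_pow :: "('a \<Rightarrow> 'a \<Rightarrow> 'a) \<Rightarrow> 'a \<Rightarrow> int \<Rightarrow> 'a" where
  "int_pow f x n = num_pow f x (num_of_nat (nat n))"

lemma int_pow_Pos [code]: "int_pow f x (Int.Pos n) = num_pow f x n"
  by (simp add: int_pow_def nat_of_num_numeral[symmetric] nat_of_num_inverse)

lemma (in monoid) num_pow_eq:
  assumes "x \<in> carrier G"
  shows "num_pow (\<otimes>) x n = x [^] nat_of_num n"
proof (induction n)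
  case (Bit0 n)
  then show ?case using assms by (simp add: square_with_def nat_pow_mult)
next
  case (Bit1 n)
  have "x \<otimes> (x [^] nat_of_num n \<otimes> x [^] nat_of_num n) = x [^] Suc (nat_of_num n + nat_of_num n)"
    using assms by (simp only: nat_pow_mult nat_pow_Suc2)
  then show ?case using Bit1 by (simp add: square_with_def)
qed (use assms in simp)

lemma (in monoid) int_pow_eq:
  assumes "x \<in> carrier G" "n > 0"
  shows "int_pow (\<otimes>) x n = x [^] nat n"
  using assms by (simp add: int_pow_def num_pow_eq num_of_nat_inverse)

text \<open>
  Products are reduced only up to congruence, by subtracting the multiples
  \<open>2 ^ 13 * p, \<dots>, 2 * p, p\<close> where possible. In symbolic evaluation this is much cheaper than \<open>mod\<close>.
\<close>

fun subtract_multiples :: "int list \<Rightarrow> int \<Rightarrow> int" where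
  "subtract_multiples [] x = x"
| "subtract_multiples (m # ms) x = subtract_multiples ms (if x < m then x else x - m)"

definition reduced_mult :: "int list \<Rightarrow> int \<Rightarrow> int \<Rightarrow> int" where
  "reduced_mult ms x y = subtract_multiples ms (x * y)"

text \<open>A negative argument is first shifted by \<open>p\<close>, since reduction by subtraction
  leaves negative products as they are and would let them grow.\<close>

definition power_residue :: "int \<Rightarrow> int list \<Rightarrow> int \<Rightarrow> int \<Rightarrow> int" where
  "power_residue p ms n x =
     int_pow (reduced_mult ms) (if x < 0 then x + p else x) n mod p"

lemma subtract_multiples_mod:
  assumes "\<forall>m\<in>set ms. (p :: int) dvd m"
  shows "subtract_multiples ms x mod p = x mod p"
  using assms
proof (induction ms arbitrary: x)
  case (Cons m ms)
  then obtain k where "m = p * k" by auto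
  then have "(x - m) mod p = x mod p" by (metis mod_mult_self4 diff_add_cancel add.commute)
  then show ?case using Cons by simp
qed simp

lemma power_residue_eq:
  assumes ms: "\<forall>m\<in>set ms. p dvd m" and n: "n > 0"
  shows "power_residue p ms n x = x ^ nat n mod p"
proof -
  have mult: "reduced_mult ms x y mod p = x * y mod p" for x y
    by (simp add: reduced_mult_def subtract_multiples_mod[OF ms])
  have *: "num_pow (reduced_mult ms) y k mod p = y ^ nat_of_num k mod p" for y k
  proof (induction k)
    case (Bit0 k)
    then show ?case by (simp add: square_with_def mult power_add) (metis mod_mult_eq)
  next
    case (Bit1 k)
    let ?s = "num_pow (reduced_mult ms) y k"
    have "y * reduced_mult ms ?s ?s mod p = y * (?s * ?s) mod p"
      by (metis mult mod_mult_right_eq)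
    also have "\<dots> = y * (y ^ nat_of_num k * y ^ nat_of_num k) mod p"
      using Bit1 by (metis mod_mult_eq mod_mult_right_eq)
    finally show ?case by (simp add: square_with_def mult power_add)
  qed simp
  have "(x + p) ^ nat n mod p = x ^ nat n mod p"
    using power_mod[of "x + p" p "nat n"] power_mod[of x p "nat n"] by (simp only: mod_add_self2)
  moreover have "power_residue p ms n x = (if x < 0 then x + p else x) ^ nat n mod p"
    unfolding power_residue_def int_pow_def * using n by (simp add: num_of_nat_inverse)
  ultimately show ?thesis by simp
qed

definition rainbow_line :: "('a \<Rightarrow> 'a \<Rightarrow> 'b) \<Rightarrow> 'a \<Rightarrow> 'a \<Rightarrow> 'a \<Rightarrow> bool" where
  "rainbow_line \<kappa> x y z = rainbow3 (\<kappa> x y) (\<kappa> y z) (\<kappa> x z)"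

definition diff_residue :: "int \<Rightarrow> int list \<Rightarrow> int \<Rightarrow> int \<Rightarrow> int \<Rightarrow> int" where
  "diff_residue p ms n x y = power_residue p ms n (x - y)"

text \<open>Affine maps preserve the rainbow property, so \<open>x2 = 0\<close> and
  \<open>x4 = 1\<close> are a normalization. The choice \<open>x5 = 2\<close> is a further
  restriction that shortens the table. As \<open>p\<close> is below \<open>2 ^ 13\<close>, products
  of two residues are below \<open>2 ^ 13 * p\<close>, and the listed multiples bring them back
  below \<open>p\<close>.\<close>

definition prime_certificate :: "int \<times> int \<times> int \<times> int \<times> int \<Rightarrow> bool" where
  "prime_certificate = (\<lambda>(p, x0, x1, x3, x6).
     all_lines (rainbow_line (diff_residue p
       (map ((*) p) [8192, 4096, 2048, 1024, 512, 256, 128, 64, 32, 16, 8, 4, 2, 1]) ((p - 1) div 3)))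
       x0 x1 0 x3 1 2 x6)"

lemma prime_field:
  assumes "prime p" "p mod 6 = 1"
  shows "cubic_field (residue_ring (int p))" "Coset.order (residue_ring (int p)) = p"
proof -
  interpret residues_prime p "residue_ring (int p)" by unfold_locales (use assms in auto)
  show ord: "Coset.order (residue_ring (int p)) = p"
    by (simp add: Coset.order_def res_carrier_eq)
  show "cubic_field (residue_ring (int p))"
    by unfold_locales (use assms ord in \<open>auto simp: finite\<close>)
qed

lemma rainbow_heptad_of_prime_certificate:
  assumes p: "prime p" "p mod 6 = 1" and cert: "prime_certificate (int p, x0, x1, x3, x6)"
  shows "\<exists>b. rainbow_heptad (residue_ring (int p)) b"
proof -
  interpret residues_prime p "residue_ring (int p)" by unfold_locales (use p in auto)
  let ?R = "residue_ring (int p)"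
  have p7: "p \<ge> 7" using p prime_gt_1_nat[of p] by presburger
  have e: "(int p - 1) div 3 > 0" "nat ((int p - 1) div 3) = (p - 1) div 3"
    using p7 by (auto simp: nat_div_distrib nat_diff_distrib)
  have diff: "x mod int p \<ominus>\<^bsub>?R\<^esub> y mod int p = (x - y) mod int p" for x y
    by (simp add: a_minus_def res_neg_eq res_add_eq mod_simps)
  have mem: "x mod int p \<in> carrier ?R" for x
    using p7 by (simp add: res_carrier_eq)
  have K: "power_residue (int p) (map ((*) (int p)) [8192, 4096, 2048, 1024, 512, 256, 128, 64, 32, 16, 8, 4, 2, 1])
      ((int p - 1) div 3) (x - y) = (x mod int p \<ominus>\<^bsub>?R\<^esub> y mod int p) [^]\<^bsub>?R\<^esub> ((Coset.order ?R - 1) div 3)" for x y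
    by (subst power_residue_eq) (use e prime_field(2)[OF p] in \<open>auto simp: diff pow_cong\<close>)
  have "rainbow_heptad ?R (seven (x0 mod int p) (x1 mod int p) (0 mod int p) (x3 mod int p)
      (1 mod int p) (2 mod int p) (x6 mod int p))"
  proof (rule rainbow_heptad_sevenI)
    show "{x0 mod int p, x1 mod int p, 0 mod int p, x3 mod int p, 1 mod int p, 2 mod int p, x6 mod int p}
        \<subseteq> carrier ?R"
      by (intro insert_subsetI mem) simp
  qed (use cert in \<open>simp only: prime_certificate_def rainbow_line_def diff_residue_def all_lines_def split_conv K\<close>)
  then show ?thesis by blast
qed

section \<open>Table of heptads for the primes below 6400\<close>

definition prime_heptads_1 :: "(int \<times> int \<times> int \<times> int \<times> int) list" where
  "prime_heptads_1 = [(7, 4, 3, 6, 5), (19, 7, 4, 8, 10), (31, 20, 6, 7, 23), (37, 4, 3, 6, 15),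
     (43, 20, 7, 19, 9), (61, 14, 5, 10, 15), (67, 12, 7, 14, 13), (73, 40, 6, 5, 65),
     (79, 21, 4, 8, 25), (97, 5, 4, 8, 23), (103, 22, 6, 5, 85), (109, 49, 10, 9, 23),
     (127, 117, 12, 9, 93), (139, 4, 3, 6, 49), (151, 6, 5, 10, 47), (157, 97, 10, 11, 19),
     (163, 56, 3, 5, 13), (181, 39, 3, 5, 13), (193, 79, 5, 9, 46), (199, 15, 4, 8, 61),
     (211, 32, 4, 8, 31), (223, 86, 6, 5, 49), (229, 41, 6, 5, 25), (241, 121, 3, 5, 34),
     (271, 114, 6, 5, 31), (277, 243, 6, 5, 98), (283, 244, 6, 5, 96), (307, 24, 14, 7, 133),
     (313, 33, 3, 5, 65), (331, 92, 4, 7, 9), (337, 84, 3, 5, 18), (349, 75, 3, 6, 16),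
     (367, 34, 12, 21, 39), (373, 7, 4, 8, 10), (379, 349, 3, 5, 24), (397, 81, 6, 5, 15),
     (409, 130, 3, 5, 18), (421, 177, 3, 6, 20), (433, 35, 7, 11, 101), (439, 77, 11, 15, 41),
     (457, 31, 7, 14, 30), (463, 55, 4, 7, 9), (487, 22, 4, 8, 10), (499, 132, 11, 22, 68),
     (523, 120, 5, 9, 24), (541, 4, 3, 6, 5), (547, 129, 6, 5, 57), (571, 4, 3, 6, 5),
     (577, 23, 5, 9, 115), (601, 50, 10, 9, 31), (607, 178, 3, 6, 16), (613, 50, 6, 5, 53)]"

definition prime_heptads_2 :: "(int \<times> int \<times> int \<times> int \<times> int) list" where
  "prime_heptads_2 = [(619, 104, 5, 9, 58), (631, 51, 3, 5, 48), (643, 177, 22, 13, 36), (661, 42, 6, 5, 23),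
     (673, 158, 4, 7, 9), (691, 186, 7, 14, 13), (709, 380, 4, 8, 14), (727, 52, 14, 15, 28),
     (733, 61, 13, 9, 54), (739, 43, 18, 9, 37), (751, 67, 3, 6, 16), (757, 705, 5, 10, 12),
     (769, 11, 4, 8, 10), (787, 14, 5, 10, 15), (811, 250, 6, 5, 45), (823, 86, 4, 8, 33),
     (829, 138, 4, 7, 9), (853, 237, 11, 13, 69), (859, 48, 3, 6, 17), (877, 4, 3, 6, 5),
     (883, 7, 4, 8, 10), (907, 38, 4, 8, 118), (919, 51, 11, 7, 21), (937, 4, 3, 6, 5),
     (967, 62, 6, 5, 25), (991, 33, 5, 9, 57), (997, 139, 23, 21, 74), (1009, 53, 5, 9, 30),
     (1021, 84, 23, 17, 46), (1033, 4, 3, 6, 5), (1039, 112, 4, 7, 9), (1051, 77, 6, 5, 24),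
     (1063, 5, 4, 8, 21), (1069, 21, 7, 11, 15), (1087, 16, 3, 5, 36), (1093, 197, 14, 7, 116),
     (1117, 134, 17, 19, 108), (1123, 54, 3, 5, 53), (1129, 121, 4, 8, 21), (1153, 7, 4, 8, 10),
     (1171, 4, 3, 6, 5), (1201, 118, 4, 7, 9), (1213, 5, 4, 8, 66), (1231, 120, 4, 8, 25),
     (1237, 273, 4, 8, 13), (1249, 21, 6, 5, 66), (1279, 15, 4, 8, 12), (1291, 25, 3, 5, 13),
     (1297, 18, 3, 5, 31), (1303, 176, 13, 25, 60), (1321, 155, 6, 5, 66), (1327, 41, 10, 11, 19)]"

definition prime_heptads_3 :: "(int \<times> int \<times> int \<times> int \<times> int) list" where
  "prime_heptads_3 = [(1381, 83, 4, 8, 29), (1399, 94, 20, 21, 82), (1423, 336, 13, 11, 70),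
     (1429, 33, 4, 8, 41), (1447, 18, 3, 5, 31), (1453, 4, 3, 6, 5), (1459, 67, 30, 11, 48),
     (1471, 35, 7, 11, 20), (1483, 78, 3, 6, 74), (1489, 56, 4, 7, 9), (1531, 53, 12, 15, 38),
     (1543, 185, 5, 10, 42), (1549, 51, 20, 29, 95), (1567, 27, 4, 8, 29), (1579, 128, 6, 5, 81),
     (1597, 128, 29, 19, 58), (1609, 140, 7, 9, 37), (1621, 137, 5, 9, 30), (1627, 94, 34, 9, 68),
     (1657, 227, 12, 17, 23), (1663, 7, 4, 8, 10), (1669, 41, 6, 5, 29), (1693, 4, 3, 6, 5),
     (1699, 43, 22, 9, 44), (1723, 330, 12, 17, 23), (1741, 4, 3, 6, 5), (1747, 73, 3, 6, 16),
     (1753, 31, 18, 9, 86), (1759, 130, 7, 9, 30), (1777, 71, 6, 5, 46), (1783, 101, 5, 10, 12),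
     (1789, 220, 6, 5, 25), (1801, 408, 6, 5, 12), (1831, 93, 22, 9, 45), (1861, 21, 7, 9, 37),
     (1867, 32, 11, 15, 67), (1873, 34, 4, 7, 9), (1879, 21, 6, 5, 29), (1933, 96, 26, 23, 75),
     (1951, 7, 4, 8, 29), (1987, 95, 4, 8, 54), (1993, 92, 4, 8, 13), (1999, 145, 10, 11, 44),
     (2011, 371, 3, 6, 20), (2017, 21, 10, 9, 82), (2029, 75, 5, 10, 33), (2053, 178, 4, 7, 9),
     (2083, 134, 4, 8, 16), (2089, 30, 7, 13, 29), (2113, 53, 6, 5, 25), (2131, 42, 6, 5, 23),
     (2137, 11, 4, 8, 10)]"

definition prime_heptads_4 :: "(int \<times> int \<times> int \<times> int \<times> int) list" where
  "prime_heptads_4 = [(2143, 64, 6, 5, 12), (2161, 155, 3, 6, 14), (2179, 150, 15, 7, 20),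
     (2203, 100, 29, 25, 84), (2221, 69, 7, 9, 37), (2239, 16, 3, 5, 13), (2251, 22, 15, 7, 47),
     (2269, 294, 5, 10, 12), (2281, 226, 7, 14, 52), (2287, 118, 14, 13, 60), (2293, 48, 4, 8, 19),
     (2311, 4, 3, 6, 5), (2341, 337, 11, 15, 51), (2347, 37, 10, 20, 44), (2371, 4, 3, 6, 5),
     (2377, 23, 4, 8, 13), (2383, 136, 26, 17, 52), (2389, 18, 7, 9, 37), (2437, 68, 4, 8, 12),
     (2467, 49, 4, 8, 89), (2473, 4, 3, 6, 5), (2503, 107, 4, 8, 25), (2521, 5, 4, 8, 46),
     (2539, 4, 3, 6, 5), (2551, 200, 4, 7, 9), (2557, 53, 4, 8, 29), (2593, 77, 4, 8, 30),
     (2617, 37, 5, 10, 27), (2647, 13, 3, 6, 42), (2659, 92, 4, 8, 13), (2671, 362, 29, 25, 76),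
     (2677, 26, 3, 6, 16), (2683, 36, 4, 7, 9), (2689, 77, 6, 5, 12), (2707, 45, 3, 5, 15),
     (2713, 14, 5, 10, 15), (2719, 224, 3, 5, 78), (2731, 208, 10, 9, 19), (2749, 154, 24, 17, 62),
     (2767, 80, 6, 5, 68), (2791, 36, 7, 14, 21), (2797, 26, 4, 8, 12), (2803, 69, 7, 9, 37),
     (2833, 86, 6, 5, 77), (2851, 52, 11, 15, 60), (2857, 4, 3, 6, 5), (2887, 7, 4, 8, 10),
     (2917, 117, 7, 14, 9), (2953, 79, 18, 11, 40), (2971, 306, 11, 13, 46),
     (3001, 235, 13, 17, 96), (3019, 197, 5, 10, 42)]"

definition prime_heptads_5 :: "(int \<times> int \<times> int \<times> int \<times> int) list" where
  "prime_heptads_5 = [(3037, 249, 4, 7, 9), (3049, 20, 6, 5, 12), (3061, 186, 7, 11, 14), (3067, 86, 5, 10, 35),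
     (3079, 50, 11, 19, 23), (3109, 144, 6, 5, 26), (3121, 87, 4, 8, 14), (3163, 43, 10, 13, 20),
     (3169, 4, 3, 6, 5), (3181, 88, 14, 7, 35), (3187, 156, 6, 5, 26), (3217, 116, 6, 5, 12),
     (3229, 45, 7, 11, 92), (3253, 120, 6, 5, 65), (3259, 96, 6, 5, 53), (3271, 11, 7, 14, 20),
     (3301, 7, 4, 8, 10), (3307, 37, 4, 8, 14), (3313, 47, 4, 8, 33), (3319, 18, 6, 5, 15),
     (3331, 40, 6, 5, 25), (3343, 22, 14, 7, 111), (3361, 43, 3, 5, 18), (3373, 219, 11, 13, 46),
     (3391, 39, 6, 5, 12), (3433, 4, 3, 6, 5), (3457, 470, 13, 9, 58), (3463, 49, 10, 15, 80),
     (3469, 38, 4, 8, 13), (3499, 95, 12, 24, 21), (3511, 4, 3, 6, 5), (3517, 97, 5, 10, 12),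
     (3529, 33, 5, 10, 53), (3541, 95, 7, 14, 37), (3547, 4, 3, 6, 5), (3559, 4, 3, 6, 5),
     (3571, 4, 3, 6, 5), (3583, 202, 4, 7, 9), (3607, 90, 11, 7, 22), (3613, 31, 3, 6, 27),
     (3631, 231, 26, 25, 95), (3637, 16, 3, 5, 24), (3643, 173, 4, 8, 16), (3673, 7, 4, 8, 19),
     (3691, 133, 4, 8, 19), (3697, 5, 4, 8, 31), (3709, 55, 4, 8, 10), (3727, 155, 3, 5, 83),
     (3733, 102, 13, 23, 30), (3739, 72, 6, 5, 12), (3769, 306, 4, 8, 29), (3793, 5, 4, 8, 19)]"

definition prime_heptads_6 :: "(int \<times> int \<times> int \<times> int \<times> int) list" where
  "prime_heptads_6 = [(3823, 61, 13, 15, 32), (3847, 14, 5, 10, 24), (3853, 107, 12, 15, 25),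
     (3877, 54, 3, 5, 13), (3889, 45, 11, 7, 21), (3907, 37, 5, 10, 24), (3919, 26, 3, 6, 20),
     (3931, 13, 3, 6, 34), (3943, 150, 6, 5, 25), (3967, 18, 7, 9, 37), (4003, 4, 3, 6, 5),
     (4021, 208, 3, 6, 37), (4027, 85, 6, 5, 40), (4051, 37, 10, 20, 71), (4057, 138, 15, 7, 22),
     (4093, 111, 6, 5, 40), (4099, 31, 5, 10, 40), (4111, 4, 3, 6, 5), (4129, 86, 10, 13, 20),
     (4153, 172, 10, 9, 19), (4159, 322, 4, 8, 23), (4177, 41, 11, 15, 44), (4201, 71, 3, 5, 13),
     (4219, 84, 3, 5, 56), (4231, 22, 4, 8, 10), (4243, 257, 4, 8, 33), (4261, 98, 3, 5, 34),
     (4273, 103, 4, 8, 188), (4297, 4, 3, 6, 27), (4327, 83, 4, 7, 9), (4339, 51, 11, 7, 22),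
     (4357, 26, 3, 6, 23), (4363, 4, 3, 6, 5), (4423, 88, 6, 5, 145), (4441, 4, 3, 6, 5),
     (4447, 77, 4, 7, 9), (4483, 133, 6, 5, 26), (4507, 145, 3, 6, 64), (4513, 500, 34, 31, 87),
     (4519, 79, 7, 13, 51), (4549, 61, 13, 9, 66), (4561, 117, 3, 5, 60), (4567, 94, 6, 5, 87),
     (4591, 22, 4, 8, 10), (4597, 40, 10, 9, 38), (4603, 4, 3, 6, 5), (4621, 7, 4, 8, 10),
     (4639, 75, 4, 7, 9), (4651, 30, 7, 13, 29), (4657, 23, 18, 9, 47), (4663, 144, 7, 14, 25),
     (4723, 94, 4, 8, 46)]"

definition prime_heptads_7 :: "(int \<times> int \<times> int \<times> int \<times> int) list" where
  "prime_heptads_7 = [(4729, 226, 26, 37, 76), (4759, 73, 10, 20, 44), (4783, 91, 11, 15, 30),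
     (4789, 5, 4, 8, 21), (4801, 221, 3, 6, 70), (4813, 5, 4, 8, 39), (4831, 26, 3, 6, 16),
     (4861, 156, 3, 5, 13), (4903, 26, 3, 6, 16), (4909, 46, 13, 9, 38), (4933, 203, 5, 10, 90),
     (4951, 77, 5, 9, 24), (4957, 114, 6, 5, 12), (4969, 38, 6, 5, 12), (4987, 4, 3, 6, 5),
     (4993, 55, 6, 5, 29), (4999, 106, 3, 5, 13), (5011, 43, 6, 5, 72), (5023, 19, 3, 6, 32),
     (5059, 59, 12, 24, 53), (5077, 33, 11, 13, 23), (5101, 121, 45, 11, 35), (5107, 4, 3, 6, 5),
     (5113, 134, 23, 13, 78), (5119, 4, 3, 6, 17), (5167, 243, 10, 13, 20), (5179, 24, 7, 9, 37),
     (5197, 208, 22, 21, 113), (5209, 49, 6, 5, 15), (5227, 55, 14, 13, 65),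
     (5233, 241, 14, 13, 65), (5281, 50, 4, 7, 9), (5323, 133, 11, 17, 62), (5347, 294, 6, 5, 23),
     (5407, 46, 4, 8, 13), (5413, 37, 10, 20, 15), (5419, 205, 10, 11, 106), (5431, 4, 3, 6, 5),
     (5437, 343, 6, 5, 12), (5443, 56, 4, 7, 9), (5449, 171, 6, 5, 12), (5479, 106, 3, 5, 13),
     (5503, 23, 6, 5, 19), (5521, 14, 5, 10, 38), (5527, 159, 5, 10, 38), (5557, 440, 4, 8, 19),
     (5563, 4, 3, 6, 5), (5569, 86, 20, 19, 58), (5581, 63, 6, 5, 46), (5623, 120, 5, 10, 36),
     (5641, 91, 4, 7, 9), (5647, 42, 4, 8, 23)]"

definition prime_heptads_8 :: "(int \<times> int \<times> int \<times> int \<times> int) list" where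
  "prime_heptads_8 = [(5653, 45, 10, 11, 20), (5659, 6, 5, 10, 184), (5683, 45, 3, 5, 15), (5689, 149, 3, 6, 16),
     (5701, 100, 4, 8, 10), (5737, 62, 11, 13, 24), (5743, 98, 3, 5, 13), (5749, 4, 3, 6, 5),
     (5779, 38, 4, 7, 9), (5791, 19, 6, 5, 60), (5821, 408, 10, 15, 52), (5827, 78, 3, 5, 44),
     (5839, 209, 5, 10, 35), (5851, 51, 6, 5, 30), (5857, 165, 3, 5, 53), (5869, 125, 3, 5, 63),
     (5881, 4, 3, 6, 5), (5923, 4, 3, 6, 5), (5953, 40, 7, 14, 70), (6007, 30, 10, 9, 19),
     (6037, 74, 6, 5, 64), (6043, 33, 5, 9, 30), (6067, 182, 7, 9, 37), (6073, 92, 3, 5, 18),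
     (6079, 69, 22, 23, 51), (6091, 88, 14, 21, 35), (6121, 104, 4, 8, 14), (6133, 52, 6, 5, 24),
     (6151, 111, 13, 9, 39), (6163, 8, 7, 14, 63), (6199, 34, 4, 7, 9), (6211, 14, 7, 9, 37),
     (6217, 82, 6, 5, 19), (6229, 71, 4, 8, 48), (6247, 158, 5, 9, 30), (6271, 134, 23, 19, 78),
     (6277, 7, 4, 8, 10), (6301, 60, 11, 15, 51), (6337, 22, 4, 8, 10), (6343, 47, 3, 5, 18),
     (6361, 102, 10, 15, 20), (6367, 45, 4, 8, 13), (6373, 36, 4, 7, 9), (6379, 192, 3, 6, 35),
     (6397, 71, 3, 5, 13)]"

lemma prime_heptads_1: "list_all prime_certificate prime_heptads_1"
  by code_simp

lemma prime_heptads_2: "list_all prime_certificate prime_heptads_2"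
  by code_simp

lemma prime_heptads_3: "list_all prime_certificate prime_heptads_3"
  by code_simp

lemma prime_heptads_4: "list_all prime_certificate prime_heptads_4"
  by code_simp

lemma prime_heptads_5: "list_all prime_certificate prime_heptads_5"
  by code_simp

lemma prime_heptads_6: "list_all prime_certificate prime_heptads_6"
  by code_simp

lemma prime_heptads_7: "list_all prime_certificate prime_heptads_7"
  by code_simp

lemma prime_heptads_8: "list_all prime_certificate prime_heptads_8"
  by code_simp

definition prime_heptads :: "(int \<times> int \<times> int \<times> int \<times> int) list" where
  "prime_heptads = prime_heptads_1 @ prime_heptads_2 @ prime_heptads_3 @ prime_heptads_4 @
     prime_heptads_5 @ prime_heptads_6 @ prime_heptads_7 @ prime_heptads_8"

lemma prime_heptads: "list_all prime_certificate prime_heptads"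
  by (simp add: prime_heptads_def prime_heptads_1 prime_heptads_2 prime_heptads_3 prime_heptads_4
      prime_heptads_5 prime_heptads_6 prime_heptads_7 prime_heptads_8)

section \<open>Completeness of the table\<close>

definition small_divisor :: "int \<Rightarrow> int \<Rightarrow> bool" where
  "small_divisor n d \<longleftrightarrow> d < n \<and> n mod d = 0"

text \<open>These are the primes from 5 to 79. A composite number below 6400 has a prime factor
  below 80, and numbers that are 1 modulo 6 are not divisible by 2 or 3.\<close>

definition trial_divisors :: "int list" where
  "trial_divisors = [5, 7, 11, 13, 17, 19, 23, 29, 31, 37, 41, 43, 47, 53, 59, 61, 67, 71, 73, 79]"

definition excluded :: "int \<Rightarrow> bool" where
  "excluded n \<longleftrightarrow> n = 13 \<or> list_ex (small_divisor n) trial_divisors"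

function excluded_between :: "int \<Rightarrow> int \<Rightarrow> bool" where
  "excluded_between a b = (if b \<le> a then True else if excluded a then excluded_between (a + 6) b else False)"
  by pat_completeness auto
termination by (relation "Wellfounded.measure (\<lambda>(a, b). nat (b - a))") auto

declare excluded_between.simps [simp del]

fun excluded_gaps :: "int \<Rightarrow> int list \<Rightarrow> bool" where
  "excluded_gaps a [] = excluded_between a 6400"
| "excluded_gaps a (p # ps) \<longleftrightarrow> excluded_between a p \<and> excluded_gaps (p + 6) ps"

text \<open>The evaluation walks once through 7, 13, 19, ... up to 6400 and finds a proper divisor
  for every number outside the table, 13 excepted. Hence no prime is missing, and no number has to
  be certified as prime.\<close>

lemma excluded_gaps_prime_heptads: "excluded_gaps 7 (map fst prime_heptads)"
  by code_simp

lemma excluded_betweenD: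
  assumes "excluded_between a b" "a + 6 * int k < b"
  shows "excluded (a + 6 * int k)"
  using assms
proof (induction k arbitrary: a)
  case 0
  then show ?case using excluded_between.simps[of a b] by (simp split: if_splits)
next
  case (Suc k)
  then have "excluded_between (a + 6) b"
    using excluded_between.simps[of a b] by (simp split: if_splits)
  from Suc.IH[OF this] Suc.prems(2) show ?case by (simp add: algebra_simps)
qed

lemma excluded_gapsD:
  assumes "excluded_gaps a ps" "a + 6 * int k < 6400" "\<forall>p\<in>set ps. p mod 6 = a mod 6"
  shows "a + 6 * int k \<in> set ps \<or> excluded (a + 6 * int k)"
  using assms
proof (induction ps arbitrary: a k)
  case Nil
  then show ?case using excluded_betweenD[of a 6400 k] by simp
next
  case (Cons p ps)
  consider "a + 6 * int k < p" | "a + 6 * int k = p" | "a + 6 * int k > p" by linarith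
  then show ?case
  proof cases
    case 1
    then show ?thesis using excluded_betweenD[of a p k] Cons.prems(1) by simp
  next
    case 3
    have pa: "p mod 6 = a mod 6" using Cons.prems(3) by simp
    then have "6 dvd a + 6 * int k - p" by presburger
    then obtain m where m: "a + 6 * int k - p = 6 * m" by (elim dvdE)
    \<comment> \<open>Here \<open>m \<ge> 1\<close>, and the remaining walk starts at
      \<open>p + 6\<close>, hence the shift by one.\<close>
    define j where "j = nat (m - 1)"
    have "a + 6 * int k = p + 6 + 6 * int j"
      unfolding j_def using 3 m by linarith
    then show ?thesis using Cons.IH[of "p + 6" j] Cons.prems pa by auto
  qed simp
qed

lemma rainbow_heptad_of_small_prime:
  assumes p: "prime p" "p mod 6 = 1" "p \<noteq> 13" "p < 6400"
  shows "\<exists>b. rainbow_heptad (residue_ring (int p)) b"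
proof -
  have "p \<ge> 7" using p(1,2) prime_gt_1_nat[of p] by presburger
  then have "p = 7 + 6 * ((p - 7) div 6)" using p(2) by presburger
  then obtain k where k: "int p = 7 + 6 * int k" by (metis of_nat_add of_nat_mult of_nat_numeral)
  have "\<forall>c\<in>set (map fst prime_heptads). c mod 6 = 7 mod 6"
    by (subst list_all_iff[symmetric]) code_simp
  then have "int p \<in> set (map fst prime_heptads) \<or> excluded (int p)"
    using excluded_gapsD[OF excluded_gaps_prime_heptads, of k] p(4) k by auto
  moreover have "\<not> excluded (int p)"
  proof
    assume "excluded (int p)"
    then obtain d where "d \<in> set trial_divisors" and d: "d < int p" "int p mod d = 0"
      using p(3) by (auto simp: excluded_def small_divisor_def list_ex_iff)
    then have "d \<ge> 2" by (auto simp: trial_divisors_def)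
    from d \<open>d \<ge> 2\<close> have "nat d dvd p" by (simp add: mod_eq_0_iff_dvd nat_dvd_iff)
    then show False using d(1) \<open>d \<ge> 2\<close> p(1) by (auto simp: prime_nat_iff)
  qed
  ultimately obtain x0 x1 x3 x6 where "(int p, x0, x1, x3, x6) \<in> set prime_heptads" by auto
  then show ?thesis
    using rainbow_heptad_of_prime_certificate[OF p(1,2)] prime_heptads
    by (auto simp: list_all_iff)
qed

section \<open>Quadratic and cubic extensions\<close>

text \<open>A norm that is multiplicative modulo \<open>p\<close> and divisible by \<open>p\<close>
  only at zero excludes zero divisors. In a finite ring, multiplication by a nonzero element is then
  injective, hence surjective.\<close>

lemma field_of_multiplicative_norm:
  fixes N :: "'a \<Rightarrow> int"
  assumes "cring R" and fin: "finite (carrier R)" and one: "\<one>\<^bsub>R\<^esub> \<noteq> \<zero>\<^bsub>R\<^esub>" and p: "prime (p :: int)"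
    and mult: "\<And>x y. \<lbrakk>x \<in> carrier R; y \<in> carrier R\<rbrakk> \<Longrightarrow> [N (x \<otimes>\<^bsub>R\<^esub> y) = N x * N y] (mod p)"
    and zero: "\<And>x. x \<in> carrier R \<Longrightarrow> p dvd N x \<longleftrightarrow> x = \<zero>\<^bsub>R\<^esub>"
  shows "field R"
proof -
  interpret cring R by fact
  have integral: "y = \<zero>\<^bsub>R\<^esub>"
    if "x \<in> carrier R" "y \<in> carrier R" "x \<otimes>\<^bsub>R\<^esub> y = \<zero>\<^bsub>R\<^esub>" "x \<noteq> \<zero>\<^bsub>R\<^esub>" for x y
  proof -
    have "p dvd N (x \<otimes>\<^bsub>R\<^esub> y)" using that zero[of "\<zero>\<^bsub>R\<^esub>"] by simp
    then have "p dvd N x * N y" using mult[OF that(1,2)] by (simp add: cong_dvd_iff)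
    then show ?thesis using zero that p by (simp add: prime_dvd_mult_iff)
  qed
  show ?thesis
  proof (rule field_intro2)
    show "\<zero>\<^bsub>R\<^esub> \<noteq> \<one>\<^bsub>R\<^esub>" using one by simp
    fix x assume "x \<in> carrier R - {\<zero>\<^bsub>R\<^esub>}"
    then have x: "x \<in> carrier R" "x \<noteq> \<zero>\<^bsub>R\<^esub>" by auto
    have "inj_on (\<lambda>y. x \<otimes>\<^bsub>R\<^esub> y) (carrier R)"
    proof (rule inj_onI)
      fix y z assume yz: "y \<in> carrier R" "z \<in> carrier R" "x \<otimes>\<^bsub>R\<^esub> y = x \<otimes>\<^bsub>R\<^esub> z"
      have "x \<otimes>\<^bsub>R\<^esub> (y \<ominus>\<^bsub>R\<^esub> z) = x \<otimes>\<^bsub>R\<^esub> y \<ominus>\<^bsub>R\<^esub> x \<otimes>\<^bsub>R\<^esub> z" using x yz(1,2) by algebra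
      also have "\<dots> = \<zero>\<^bsub>R\<^esub>" using x yz by (simp add: minus_eq r_neg)
      finally show "y = z" using integral[of x "y \<ominus>\<^bsub>R\<^esub> z"] x yz by simp
    qed
    then have "(\<lambda>y. x \<otimes>\<^bsub>R\<^esub> y) ` carrier R = carrier R"
      using x by (intro endo_inj_surj fin) auto
    then obtain y where y: "y \<in> carrier R" "x \<otimes>\<^bsub>R\<^esub> y = \<one>\<^bsub>R\<^esub>" by (metis imageE one_closed)
    then show "x \<in> Units R" unfolding Units_def using x m_comm[of x y] by auto
  qed
qed

text \<open>A quotient ring is modelled by the canonical representatives that \<open>\<pi>\<close>
  selects. All axioms follow from identities before reduction, which for the rings below are
  polynomial identities over the integers.\<close>

lemma cring_of_reduction:
  fixes add mul :: "'a \<Rightarrow> 'a \<Rightarrow> 'a" and \<pi> neg :: "'a \<Rightarrow> 'a" and z e :: 'a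
  assumes add_assoc: "\<And>x y w. add (add x y) w = add x (add y w)" and add_comm: "\<And>x y. add x y = add y x"
    and add_zero: "\<And>x. add z x = x" and add_neg: "\<And>x. add (neg x) x = z"
    and mul_assoc: "\<And>x y w. mul (mul x y) w = mul x (mul y w)" and mul_comm: "\<And>x y. mul x y = mul y x"
    and mul_one: "\<And>x. mul e x = x" and distrib: "\<And>x y w. mul (add x y) w = add (mul x w) (mul y w)"
    and red_add: "\<And>x y. \<pi> (add (\<pi> x) y) = \<pi> (add x y)" and red_mul: "\<And>x y. \<pi> (mul (\<pi> x) y) = \<pi> (mul x y)"
  shows "cring \<lparr>carrier = range \<pi>, monoid.mult = \<lambda>x y. \<pi> (mul x y), monoid.one = \<pi> e, ring.zero = \<pi> z,
    ring.add = \<lambda>x y. \<pi> (add x y)\<rparr>" (is "cring ?R")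
proof (rule cringI)
  have idem: "\<pi> (\<pi> x) = \<pi> x" for x by (metis red_add add_zero add_comm)
  have red_add': "\<pi> (add x (\<pi> y)) = \<pi> (add x y)" for x y by (metis red_add add_comm)
  have red_mul': "\<pi> (mul x (\<pi> y)) = \<pi> (mul x y)" for x y by (metis red_mul mul_comm)
  note red = idem red_add red_mul red_add' red_mul'
  show "abelian_group ?R"
  proof (rule abelian_groupI)
    fix x assume "x \<in> carrier ?R"
    then obtain x' where "x = \<pi> x'" by auto
    then have "\<pi> (neg x') \<oplus>\<^bsub>?R\<^esub> x = \<zero>\<^bsub>?R\<^esub>" by (simp add: red add_neg)
    then show "\<exists>y\<in>carrier ?R. y \<oplus>\<^bsub>?R\<^esub> x = \<zero>\<^bsub>?R\<^esub>" by (intro bexI[of _ "\<pi> (neg x')"]) auto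
  qed (auto simp: red add_assoc add_zero intro: add_comm[THEN arg_cong])
  show "comm_monoid ?R"
    by (rule comm_monoidI) (auto simp: red mul_assoc mul_one intro: mul_comm[THEN arg_cong])
  show "(x \<oplus>\<^bsub>?R\<^esub> y) \<otimes>\<^bsub>?R\<^esub> w = x \<otimes>\<^bsub>?R\<^esub> w \<oplus>\<^bsub>?R\<^esub> y \<otimes>\<^bsub>?R\<^esub> w" for x y w
    by (simp add: red distrib)
qed

section \<open>Quadratic extensions of prime fields\<close>

definition quadratic_mult :: "int \<Rightarrow> int \<Rightarrow> int \<Rightarrow> int \<times> int \<Rightarrow> int \<times> int \<Rightarrow> int \<times> int" where
  "quadratic_mult p s t = (\<lambda>(a, b) (c, d). ((a * c + t * (b * d)) mod p, (a * d + b * c + s * (b * d)) mod p))"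

definition quadratic_diff :: "int \<Rightarrow> int \<times> int \<Rightarrow> int \<times> int \<Rightarrow> int \<times> int" where
  "quadratic_diff p = (\<lambda>(a, b) (c, d). ((a - c) mod p, (b - d) mod p))"

text \<open>The pair \<open>(a, b)\<close> stands for \<open>a + b x\<close> in \<open>\<int>[x] / (p, x\<^sup>2 - s x - t)\<close>.\<close>

definition quadratic_ring :: "int \<Rightarrow> int \<Rightarrow> int \<Rightarrow> (int \<times> int) ring" where
  "quadratic_ring p s t = \<lparr>carrier = {0..<p} \<times> {0..<p}, monoid.mult = quadratic_mult p s t,
     monoid.one = (1, 0), ring.zero = (0, 0), ring.add = (\<lambda>(a, b) (c, d). ((a + c) mod p, (b + d) mod p))\<rparr>"

lemma quadratic_ring_cring:
  assumes "p > 1"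
  shows "cring (quadratic_ring p s t)"
proof -
  define \<pi> where "\<pi> = (\<lambda>(a :: int, b :: int). (a mod p, b mod p))"
  define add where "add = (\<lambda>(a :: int, b :: int) (c, d). (a + c, b + d))"
  define mul where "mul = (\<lambda>(a, b) (c, d). (a * c + t * (b * d), a * d + b * c + s * (b * d)))"
  have "cring \<lparr>carrier = range \<pi>, monoid.mult = \<lambda>x y. \<pi> (mul x y), monoid.one = \<pi> (1, 0),
      ring.zero = \<pi> (0, 0), ring.add = \<lambda>x y. \<pi> (add x y)\<rparr>"
  proof (rule cring_of_reduction[where neg = "\<lambda>(a, b). (- a, - b)"])
    fix x y
    show "\<pi> (add (\<pi> x) y) = \<pi> (add x y)"
      by (cases x, cases y) (simp add: \<pi>_def add_def mod_simps)
    have c: "[k mod p = k] (mod p)" for k by (simp add: unique_euclidean_semiring_class.cong_def)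
    show "\<pi> (mul (\<pi> x) y) = \<pi> (mul x y)"
      by (cases x, cases y)
        (simp add: \<pi>_def mul_def unique_euclidean_semiring_class.cong_def[symmetric], intro conjI cong_add cong_mult cong_refl c)
  qed (auto simp: add_def mul_def algebra_simps)
  moreover have "range \<pi> = {0..<p} \<times> {0..<p}"
  proof (intro equalityI subsetI)
    fix x assume "x \<in> {0..<p} \<times> {0..<p}"
    then have "x = \<pi> x" by (auto simp: \<pi>_def)
    then show "x \<in> range \<pi>" by blast
  qed (use assms in \<open>auto simp: \<pi>_def\<close>)
  moreover have "(\<lambda>x y. \<pi> (mul x y)) = quadratic_mult p s t"
    "(\<lambda>x y. \<pi> (add x y)) = (\<lambda>(a, b) (c, d). ((a + c) mod p, (b + d) mod p))"
    by (auto simp: fun_eq_iff \<pi>_def mul_def add_def quadratic_mult_def)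
  moreover have "\<pi> (1, 0) = (1, 0)" "\<pi> (0, 0) = (0, 0)" using assms by (auto simp: \<pi>_def)
  ultimately show ?thesis unfolding quadratic_ring_def by simp
qed

text \<open>The quadratic form is the norm of \<open>a + b x\<close>, the product with its conjugate
  under \<open>x\<close> to \<open>s - x\<close>. The assumption \<open>irred\<close> says that this
  norm is anisotropic modulo \<open>p\<close>.\<close>

lemma quadratic_field:
  assumes p: "prime p"
    and irred: "\<And>a b :: int. int p dvd a * a + s * (a * b) - t * (b * b) \<Longrightarrow> int p dvd a \<and> int p dvd b"
  shows "field (quadratic_ring (int p) s t)"
proof -
  define N where "N = (\<lambda>(a, b). a * a + s * (a * b) - t * (b * b) :: int)"
  have p1: "int p > 1" using prime_gt_1_nat[OF p] by simp
  have N_mod: "[N (a mod int p, b mod int p) = N (a, b)] (mod int p)" for a b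
  proof -
    have c: "[k mod int p = k] (mod int p)" for k by (simp add: unique_euclidean_semiring_class.cong_def)
    show ?thesis unfolding N_def split_conv by (intro cong_add cong_diff cong_mult cong_refl c)
  qed
  show ?thesis
  proof (rule field_of_multiplicative_norm[where p = "int p" and N = N])
    show "cring (quadratic_ring (int p) s t)" using p1 by (rule quadratic_ring_cring)
    show "prime (int p)" using p by simp
    show "finite (carrier (quadratic_ring (int p) s t))" by (simp add: quadratic_ring_def)
    show "\<one>\<^bsub>quadratic_ring (int p) s t\<^esub> \<noteq> \<zero>\<^bsub>quadratic_ring (int p) s t\<^esub>" by (simp add: quadratic_ring_def)
    show "[N (x \<otimes>\<^bsub>quadratic_ring (int p) s t\<^esub> y) = N x * N y] (mod int p)" for x y
    proof -
      obtain a b c d where xy: "x = (a, b)" "y = (c, d)" by fastforce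
      have "N (a * c + t * (b * d), a * d + b * c + s * (b * d)) = N x * N y"
        unfolding N_def xy split_conv by (simp add: algebra_simps)
      then show ?thesis using N_mod[of "a * c + t * (b * d)" "a * d + b * c + s * (b * d)"]
        by (simp add: xy quadratic_ring_def quadratic_mult_def)
    qed
    show "int p dvd N x \<longleftrightarrow> x = \<zero>\<^bsub>quadratic_ring (int p) s t\<^esub>"
      if x: "x \<in> carrier (quadratic_ring (int p) s t)" for x
    proof
      assume "int p dvd N x"
      then have "int p dvd fst x" "int p dvd snd x"
        using irred[of "fst x" "snd x"] by (auto simp: N_def split_def)
      then show "x = \<zero>\<^bsub>quadratic_ring (int p) s t\<^esub>"
        using x zdvd_imp_le[of "int p" "fst x"] zdvd_imp_le[of "int p" "snd x"]
        by (cases x) (force simp: quadratic_ring_def)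
    qed (simp add: quadratic_ring_def N_def)
  qed
qed

lemma order_quadratic_ring: "Coset.order (quadratic_ring (int p) s t) = p ^ 2"
  by (simp add: Coset.order_def quadratic_ring_def card_cartesian_product power2_eq_square)

lemma fermat_theorem_int:
  assumes "prime p" "\<not> int p dvd x"
  shows "[x ^ (p - 1) = 1] (mod int p)"
proof -
  have "p > 0" using assms(1) by (rule prime_gt_0_nat)
  define n where "n = nat (x mod int p)"
  have n: "int n = x mod int p" using \<open>p > 0\<close> by (simp add: n_def)
  have "\<not> int p dvd int n" unfolding n using assms(2) by (simp add: dvd_mod_iff)
  then have "[n ^ (p - 1) = 1] (mod p)"
    using assms(1) by (intro fermat_theorem) auto
  then have "[int (n ^ (p - 1)) = int 1] (mod int p)" by (simp only: cong_int_iff)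
  then have "[(x mod int p) ^ (p - 1) = 1] (mod int p)" by (simp add: n)
  then show ?thesis unfolding unique_euclidean_semiring_class.cong_def power_mod .
qed

text \<open>The form divides \<open>a ^ 3 + b ^ 3\<close>. For \<open>p \<equiv> 2 (mod 3)\<close>
  cubing is injective modulo \<open>p\<close>, so a nontrivial zero would satisfy
  \<open>a \<equiv> - b\<close>, where the form takes the value
  \<open>3 * b\<^sup>2\<close>.\<close>

lemma eisenstein_irreducible:
  assumes p: "prime p" "p mod 6 = 5" and dvd: "int p dvd a * a + (-1) * (a * b) - (-1) * (b * b)"
  shows "int p dvd a \<and> int p dvd b"
proof (rule ccontr)
  assume "\<not> ?thesis"
  have pi: "prime (int p)" using p by simp
  have ab: "int p dvd a * a - a * b + b * b" using dvd by simp
  have sq: "int p dvd a \<longleftrightarrow> int p dvd b"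
  proof
    assume "int p dvd a"
    then have "int p dvd a * (a - b)" by simp
    then have "int p dvd (a * a - a * b + b * b) - a * (a - b)" by (rule dvd_diff[OF ab])
    then have "int p dvd b * b" by (simp add: algebra_simps)
    then show "int p dvd b" using pi by (simp add: prime_dvd_mult_iff)
  next
    assume "int p dvd b"
    then have "int p dvd b * (b - a)" by simp
    then have "int p dvd (a * a - a * b + b * b) - b * (b - a)" by (rule dvd_diff[OF ab])
    then have "int p dvd a * a" by (simp add: algebra_simps)
    then show "int p dvd a" using pi by (simp add: prime_dvd_mult_iff)
  qed
  with \<open>\<not> ?thesis\<close> have nd: "\<not> int p dvd a" "\<not> int p dvd - b" by auto
  have "int p dvd (a + b) * (a * a - a * b + b * b)" using ab by simp
  then have "int p dvd a ^ 3 - (- b) ^ 3"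
    by (simp add: algebra_simps power3_eq_cube)
  then have c3: "[a ^ 3 = (- b) ^ 3] (mod int p)" by (simp add: cong_iff_dvd_diff)
  \<comment> \<open>By Fermat, \<open>x ^ (3 * k)\<close> is the inverse of \<open>x\<close> modulo
    \<open>p\<close>. So the cube of \<open>x\<close> determines the inverse of \<open>x\<close>,
    and hence \<open>x\<close>.\<close>
  define k where "k = (p - 2) div 3"
  have k: "p - 1 = 3 * k + 1" using p(2) unfolding k_def by presburger
  have c: "[x ^ (3 * k) * x = 1] (mod int p)" if "\<not> int p dvd x" for x
    using fermat_theorem_int[OF p(1) that] unfolding k by (simp add: mult.commute)
  have "[(a ^ 3) ^ k = ((- b) ^ 3) ^ k] (mod int p)" by (rule cong_pow[OF c3])
  then have e: "[a ^ (3 * k) = (- b) ^ (3 * k)] (mod int p)" by (simp only: power_mult)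
  have "[a ^ (3 * k) * a = a ^ (3 * k) * (- b)] (mod int p)"
    using c[OF nd(1)] c[OF nd(2)] cong_mult[OF e cong_refl[of "- b" "int p"]]
    by (meson cong_sym cong_trans)
  then have "int p dvd a ^ (3 * k) * (a + b)" by (simp add: cong_iff_dvd_diff algebra_simps)
  moreover have "\<not> int p dvd a ^ (3 * k)" using nd(1) pi prime_dvd_power by blast
  ultimately have "int p dvd a + b" using pi by (simp add: prime_dvd_mult_iff)
  \<comment> \<open>Division with remainder: the form equals
    \<open>(a + b) * (a - 2 * b) + 3 * b\<^sup>2\<close>.\<close>
  then have "int p dvd (a + b) * (a - 2 * b)" by simp
  then have "int p dvd (a * a - a * b + b * b) - (a + b) * (a - 2 * b)" by (rule dvd_diff[OF ab])
  then have "int p dvd 3 * (b * b)" by (simp add: algebra_simps)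
  then have "int p dvd 3" using nd(2) pi by (auto simp: prime_dvd_mult_iff)
  then have "p dvd 3" by presburger
  then have "p \<le> 3" by (rule dvd_imp_le) simp
  moreover have "p \<ge> 5" using p(2) by presburger
  ultimately show False by simp
qed

lemma eisenstein_field:
  assumes "prime p" "p mod 6 = 5"
  shows "cubic_field (quadratic_ring (int p) (-1) (-1))"
proof -
  have "field (quadratic_ring (int p) (-1) (-1))"
    by (rule quadratic_field[OF assms(1)]) (rule eisenstein_irreducible[OF assms])
  moreover have "p ^ 2 mod 6 = 1"
    using power_mod[of p 6 2] assms(2) by simp
  moreover have "finite (carrier (quadratic_ring (int p) (-1) (-1)))" by (simp add: quadratic_ring_def)
  ultimately show ?thesis
    by (intro cubic_field.intro cubic_field_axioms.intro) (simp_all add: order_quadratic_ring)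
qed

definition quadratic_power_diff :: "int \<Rightarrow> int \<Rightarrow> int \<Rightarrow> int \<Rightarrow> int \<times> int \<Rightarrow> int \<times> int \<Rightarrow> int \<times> int" where
  "quadratic_power_diff p s t n x y = int_pow (quadratic_mult p s t) (quadratic_diff p x y) n"

definition quadratic_certificate :: "int \<Rightarrow> int \<Rightarrow> int \<Rightarrow> int \<times> int \<Rightarrow> int \<times> int \<Rightarrow> int \<times> int \<Rightarrow>
    int \<times> int \<Rightarrow> int \<times> int \<Rightarrow> int \<times> int \<Rightarrow> int \<times> int \<Rightarrow> bool" where
  "quadratic_certificate p s t = all_lines (rainbow_line (quadratic_power_diff p s t ((p * p - 1) div 3)))"

lemma rainbow_heptad_of_quadratic_certificate:
  assumes R: "cring (quadratic_ring (int p) s t)" and p: "p > 1"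
    and mem: "set [x0, x1, x2, x3, x4, x5, x6] \<subseteq> {0..<int p} \<times> {0..<int p}"
    and cert: "quadratic_certificate (int p) s t x0 x1 x2 x3 x4 x5 x6"
  shows "rainbow_heptad (quadratic_ring (int p) s t) (seven x0 x1 x2 x3 x4 x5 x6)"
proof -
  let ?R = "quadratic_ring (int p) s t"
  interpret cring ?R by fact
  have car: "carrier ?R = {0..<int p} \<times> {0..<int p}" by (simp add: quadratic_ring_def)
  have diff: "x \<ominus>\<^bsub>?R\<^esub> y = quadratic_diff (int p) x y" if "x \<in> carrier ?R" "y \<in> carrier ?R" for x y
  proof -
    let ?n = "((- fst y) mod int p, (- snd y) mod int p)"
    have "?n \<oplus>\<^bsub>?R\<^esub> y = \<zero>\<^bsub>?R\<^esub>" "?n \<in> carrier ?R"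
      using p by (cases y, auto simp: quadratic_ring_def mod_simps)+
    then have "\<ominus>\<^bsub>?R\<^esub> y = ?n" using that(2) minus_equality by blast
    then show ?thesis
      by (cases x, cases y) (simp add: a_minus_def quadratic_ring_def quadratic_diff_def mod_simps)
  qed
  have "p * p \<ge> 2 * 2" using p by (intro mult_mono) auto
  moreover have pp: "int p * int p - 1 = int (p * p - 1)"
  proof -
    have "1 \<le> p * p" using p by simp
    then show ?thesis by (simp only: of_nat_diff of_nat_mult of_nat_1)
  qed
  ultimately have e: "(int p * int p - 1) div 3 > 0" unfolding pp by linarith
  have n: "nat ((int p * int p - 1) div 3) = (Coset.order ?R - 1) div 3"
    unfolding pp order_quadratic_ring power2_eq_square by linarith
  have K: "quadratic_power_diff (int p) s t ((int p * int p - 1) div 3) x y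
      = (x \<ominus>\<^bsub>?R\<^esub> y) [^]\<^bsub>?R\<^esub> ((Coset.order ?R - 1) div 3)" if "x \<in> carrier ?R" "y \<in> carrier ?R" for x y
    using int_pow_eq[OF minus_closed[OF that] e] unfolding n diff[OF that] quadratic_power_diff_def
    by (simp add: quadratic_ring_def)
  show ?thesis
  proof (rule rainbow_heptad_sevenI)
    show sub: "{x0, x1, x2, x3, x4, x5, x6} \<subseteq> carrier ?R" unfolding car using mem by simp
    show "all_lines (\<lambda>x y z. rainbow3 ((x \<ominus>\<^bsub>?R\<^esub> y) [^]\<^bsub>?R\<^esub> ((Coset.order ?R - 1) div 3))
      ((y \<ominus>\<^bsub>?R\<^esub> z) [^]\<^bsub>?R\<^esub> ((Coset.order ?R - 1) div 3)) ((x \<ominus>\<^bsub>?R\<^esub> z) [^]\<^bsub>?R\<^esub> ((Coset.order ?R - 1) div 3)))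
      x0 x1 x2 x3 x4 x5 x6"
      using cert sub unfolding quadratic_certificate_def all_lines_def rainbow_line_def
      by (simp only: K insert_subset)
  qed
qed

text \<open>The first ten moduli are the primes \<open>p \<equiv> 5 (mod 6)\<close> with
  \<open>p\<^sup>2 < 6400\<close>, with \<open>x\<^sup>2 + x + 1 = 0\<close>. That polynomial splits
  modulo 13, so the last certificate uses \<open>x\<^sup>2 = 2\<close> instead.\<close>

lemma quadratic_heptads:
  "quadratic_certificate 5 (-1) (-1) (2, 2) (0, 1) (0, 0) (1, 2) (1, 0) (1, 1) (2, 4)"
  "quadratic_certificate 11 (-1) (-1) (2, 0) (0, 1) (0, 0) (1, 2) (1, 0) (1, 1) (4, 3)"
  "quadratic_certificate 17 (-1) (-1) (4, 12) (2, 3) (0, 0) (3, 2) (1, 0) (0, 1) (5, 5)"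
  "quadratic_certificate 23 (-1) (-1) (6, 3) (0, 1) (0, 0) (1, 2) (1, 0) (1, 1) (4, 3)"
  "quadratic_certificate 29 (-1) (-1) (2, 2) (0, 1) (0, 0) (1, 2) (1, 0) (1, 1) (0, 2)"
  "quadratic_certificate 41 (-1) (-1) (2, 2) (0, 1) (0, 0) (1, 2) (1, 0) (1, 1) (0, 2)"
  "quadratic_certificate 47 (-1) (-1) (0, 5) (0, 1) (0, 0) (1, 2) (1, 0) (1, 1) (3, 2)"
  "quadratic_certificate 53 (-1) (-1) (8, 10) (2, 3) (0, 0) (3, 2) (1, 0) (0, 1) (5, 5)"
  "quadratic_certificate 59 (-1) (-1) (0, 2) (0, 1) (0, 0) (1, 2) (1, 0) (1, 1) (3, 0)"
  "quadratic_certificate 71 (-1) (-1) (21, 33) (3, 5) (0, 0) (5, 3) (1, 0) (0, 1) (4, 4)"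
  "quadratic_certificate 13 0 2 (4, 1) (3, 1) (0, 0) (1, 2) (1, 0) (0, 1) (2, 5)"
  by code_simp+

section \<open>The field with 2197 elements\<close>

definition cubic_mult :: "int \<times> int \<times> int \<Rightarrow> int \<times> int \<times> int \<Rightarrow> int \<times> int \<times> int" where
  "cubic_mult = (\<lambda>(a, b, c) (d, e, f). ((a * d + 2 * (b * f) + 2 * (c * e)) mod 13,
     (a * e + b * d + 2 * (c * f)) mod 13, (a * f + b * e + c * d) mod 13))"

definition cubic_diff :: "int \<times> int \<times> int \<Rightarrow> int \<times> int \<times> int \<Rightarrow> int \<times> int \<times> int" where
  "cubic_diff = (\<lambda>(a, b, c) (d, e, f). ((a - d) mod 13, (b - e) mod 13, (c - f) mod 13))"

text \<open>The triple \<open>(a, b, c)\<close> stands for \<open>a + b x + c x\<^sup>2\<close> in \<open>\<int>[x] / (13, x\<^sup>3 - 2)\<close>.\<close>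

definition cubic_ring :: "(int \<times> int \<times> int) ring" where
  "cubic_ring = \<lparr>carrier = {0..<13} \<times> {0..<13} \<times> {0..<13}, monoid.mult = cubic_mult,
     monoid.one = (1, 0, 0), ring.zero = (0, 0, 0),
     ring.add = (\<lambda>(a, b, c) (d, e, f). ((a + d) mod 13, (b + e) mod 13, (c + f) mod 13))\<rparr>"

lemma cubic_ring_cring: "cring cubic_ring"
proof -
  define \<pi> where "\<pi> = (\<lambda>(a :: int, b :: int, c :: int). (a mod 13, b mod 13, c mod 13))"
  define add where "add = (\<lambda>(a :: int, b :: int, c :: int) (d, e, f). (a + d, b + e, c + f))"
  define mul where "mul = (\<lambda>(a :: int, b :: int, c :: int) (d, e, f).
    (a * d + 2 * (b * f) + 2 * (c * e), a * e + b * d + 2 * (c * f), a * f + b * e + c * d))"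
  have "cring \<lparr>carrier = range \<pi>, monoid.mult = \<lambda>x y. \<pi> (mul x y), monoid.one = \<pi> (1, 0, 0),
      ring.zero = \<pi> (0, 0, 0), ring.add = \<lambda>x y. \<pi> (add x y)\<rparr>"
  proof (rule cring_of_reduction[where neg = "\<lambda>(a, b, c). (- a, - b, - c)"])
    fix x y :: "int \<times> int \<times> int"
    obtain a b c d e f where xy: "x = (a, b, c)" "y = (d, e, f)" by (metis prod_cases3)
    show "\<pi> (add (\<pi> x) y) = \<pi> (add x y)"
      unfolding xy by (simp add: \<pi>_def add_def mod_simps)
    have m: "[k mod 13 = k] (mod (13 :: int))" for k by (simp add: unique_euclidean_semiring_class.cong_def)
    show "\<pi> (mul (\<pi> x) y) = \<pi> (mul x y)"
      unfolding xy \<pi>_def mul_def split_conv prod.inject unique_euclidean_semiring_class.cong_def[symmetric]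
      by (intro conjI cong_add cong_mult cong_refl m)
  qed (auto simp: add_def mul_def algebra_simps)
  moreover have "range \<pi> = {0..<13} \<times> {0..<13} \<times> {0..<13}"
  proof (intro equalityI subsetI)
    fix x :: "int \<times> int \<times> int" assume "x \<in> {0..<13} \<times> {0..<13} \<times> {0..<13}"
    then have "x = \<pi> x" by (auto simp: \<pi>_def)
    then show "x \<in> range \<pi>" by blast
  qed (auto simp: \<pi>_def)
  moreover have "(\<lambda>x y. \<pi> (mul x y)) = cubic_mult"
    "(\<lambda>x y. \<pi> (add x y)) = (\<lambda>(a, b, c) (d, e, f). ((a + d) mod 13, (b + e) mod 13, (c + f) mod 13))"
    by (auto simp: fun_eq_iff \<pi>_def mul_def add_def cubic_mult_def)
  moreover have "\<pi> (1, 0, 0) = (1, 0, 0)" "\<pi> (0, 0, 0) = (0, 0, 0)" by (auto simp: \<pi>_def)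
  ultimately show ?thesis unfolding cubic_ring_def by simp
qed

text \<open>This is the determinant of multiplication by \<open>a + b x + c x\<^sup>2\<close> where
  \<open>x\<^sup>3 = 2\<close>.\<close>

definition cubic_norm :: "int \<Rightarrow> int \<Rightarrow> int \<Rightarrow> int" where
  "cubic_norm a b c = a * a * a + 2 * (b * b * b) + 4 * (c * c * c) - 6 * (a * b * c)"

definition norm_anisotropic :: "int \<Rightarrow> int \<Rightarrow> int \<Rightarrow> bool" where
  "norm_anisotropic a b c \<longleftrightarrow> cubic_norm a b c mod 13 \<noteq> 0 \<or> a = 0 \<and> b = 0 \<and> c = 0"

definition norm_anisotropic2 :: "int \<Rightarrow> int \<Rightarrow> bool" where
  "norm_anisotropic2 a b \<longleftrightarrow> list_all (norm_anisotropic a b) [0, 1, 2, 3, 4, 5, 6, 7, 8, 9, 10, 11, 12]"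

definition norm_anisotropic1 :: "int \<Rightarrow> bool" where
  "norm_anisotropic1 a \<longleftrightarrow> list_all (norm_anisotropic2 a) [0, 1, 2, 3, 4, 5, 6, 7, 8, 9, 10, 11, 12]"

text \<open>The evaluation runs through all triples modulo 13. Its success reflects that 2 is not a
  cube modulo 13, where the nonzero cubes are 1, 5, 8 and 12.\<close>

lemma norm_anisotropic1: "list_all norm_anisotropic1 [0, 1, 2, 3, 4, 5, 6, 7, 8, 9, 10, 11, 12]"
  by code_simp

lemma cubic_norm_zero:
  assumes "a \<in> {0..<13}" "b \<in> {0..<13}" "c \<in> {0..<13}" "13 dvd cubic_norm a b c"
  shows "a = 0 \<and> b = 0 \<and> c = 0"
proof -
  have range: "k \<in> set [0, 1, 2, 3, 4, 5, 6, 7, 8, 9, 10, 11, 12]" if "k \<in> {0..<13}" for k :: int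
    using that by simp presburger
  have "norm_anisotropic a b c"
    using norm_anisotropic1 range[OF assms(1)] range[OF assms(2)] range[OF assms(3)]
    unfolding norm_anisotropic1_def norm_anisotropic2_def list_all_iff by blast
  then show ?thesis using assms(4) by (simp add: norm_anisotropic_def)
qed

lemma cubic_ring_field: "field cubic_ring"
proof -
  define N where "N = (\<lambda>(a, b, c). cubic_norm a b c)"
  have N_mod: "[N (a mod 13, b mod 13, c mod 13) = N (a, b, c)] (mod 13)" for a b c
  proof -
    have m: "[k mod 13 = k] (mod (13 :: int))" for k by (simp add: unique_euclidean_semiring_class.cong_def)
    show ?thesis unfolding N_def cubic_norm_def split_conv by (intro cong_add cong_diff cong_mult cong_refl m)
  qed
  show ?thesis
  proof (rule field_of_multiplicative_norm[where p = 13 and N = N])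
    show "cring cubic_ring" by (rule cubic_ring_cring)
    show "prime (13 :: int)" by simp
    show "finite (carrier cubic_ring)" by (simp add: cubic_ring_def)
    show "\<one>\<^bsub>cubic_ring\<^esub> \<noteq> \<zero>\<^bsub>cubic_ring\<^esub>" by (simp add: cubic_ring_def)
    show "[N (x \<otimes>\<^bsub>cubic_ring\<^esub> y) = N x * N y] (mod 13)" for x y
    proof -
      obtain a b c d e f where xy: "x = (a, b, c)" "y = (d, e, f)" by (metis prod_cases3)
      have "N (a * d + 2 * (b * f) + 2 * (c * e), a * e + b * d + 2 * (c * f), a * f + b * e + c * d) = N x * N y"
        unfolding N_def cubic_norm_def xy split_conv by (simp add: algebra_simps)
      then show ?thesis
        using N_mod[of "a * d + 2 * (b * f) + 2 * (c * e)" "a * e + b * d + 2 * (c * f)" "a * f + b * e + c * d"]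
        by (simp add: xy cubic_ring_def cubic_mult_def)
    qed
    show "13 dvd N x \<longleftrightarrow> x = \<zero>\<^bsub>cubic_ring\<^esub>" if x: "x \<in> carrier cubic_ring" for x
    proof
      assume d: "13 dvd N x"
      obtain a b c where abc: "x = (a, b, c)" by (metis prod_cases3)
      show "x = \<zero>\<^bsub>cubic_ring\<^esub>"
        using cubic_norm_zero[of a b c] d x by (simp add: abc N_def cubic_ring_def)
    qed (simp add: cubic_ring_def N_def cubic_norm_def)
  qed
qed

lemma order_cubic_ring: "Coset.order cubic_ring = 2197"
  by (simp add: Coset.order_def cubic_ring_def card_cartesian_product)

text \<open>The exponent is \<open>(13 ^ 3 - 1) / 3 = 732\<close>.\<close>

definition cubic_power_diff :: "int \<times> int \<times> int \<Rightarrow> int \<times> int \<times> int \<Rightarrow> int \<times> int \<times> int" where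
  "cubic_power_diff x y = int_pow cubic_mult (cubic_diff x y) 732"

lemma cubic_certificate:
  "all_lines (rainbow_line cubic_power_diff) (0, 2, 4) (0, 0, 1) (0, 0, 0) (1, 0, 1) (1, 0, 0) (0, 1, 0) (3, 1, 0)"
  by code_simp

lemma rainbow_heptad_cubic_ring:
  "rainbow_heptad cubic_ring (seven (0, 2, 4) (0, 0, 1) (0, 0, 0) (1, 0, 1) (1, 0, 0) (0, 1, 0) (3, 1, 0))"
proof -
  interpret cring cubic_ring by (rule cubic_ring_cring)
  have diff: "x \<ominus>\<^bsub>cubic_ring\<^esub> y = cubic_diff x y" if "x \<in> carrier cubic_ring" "y \<in> carrier cubic_ring" for x y
  proof -
    obtain a b c d e f where xy: "x = (a, b, c)" "y = (d, e, f)" by (metis prod_cases3)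
    let ?n = "((- d) mod 13, (- e) mod 13, (- f) mod 13)"
    have "?n \<oplus>\<^bsub>cubic_ring\<^esub> y = \<zero>\<^bsub>cubic_ring\<^esub>" "?n \<in> carrier cubic_ring"
      by (auto simp: xy cubic_ring_def mod_simps)
    then have "\<ominus>\<^bsub>cubic_ring\<^esub> y = ?n" using that(2) minus_equality by blast
    then show ?thesis
      by (simp add: xy a_minus_def cubic_ring_def cubic_diff_def mod_simps)
  qed
  have K: "cubic_power_diff x y = (x \<ominus>\<^bsub>cubic_ring\<^esub> y) [^]\<^bsub>cubic_ring\<^esub> ((Coset.order cubic_ring - 1) div 3)"
    if "x \<in> carrier cubic_ring" "y \<in> carrier cubic_ring" for x y
    using int_pow_eq[OF minus_closed[OF that], of 732] unfolding diff[OF that] cubic_power_diff_def order_cubic_ring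
    by (simp add: cubic_ring_def)
  show ?thesis
  proof (rule rainbow_heptad_sevenI)
    show sub: "{(0, 2, 4), (0, 0, 1), (0, 0, 0), (1, 0, 1), (1, 0, 0), (0, 1, 0), (3, 1, 0)} \<subseteq> carrier cubic_ring"
      by (simp add: cubic_ring_def)
    show "all_lines (\<lambda>x y z. rainbow3 ((x \<ominus>\<^bsub>cubic_ring\<^esub> y) [^]\<^bsub>cubic_ring\<^esub> ((Coset.order cubic_ring - 1) div 3))
      ((y \<ominus>\<^bsub>cubic_ring\<^esub> z) [^]\<^bsub>cubic_ring\<^esub> ((Coset.order cubic_ring - 1) div 3))
      ((x \<ominus>\<^bsub>cubic_ring\<^esub> z) [^]\<^bsub>cubic_ring\<^esub> ((Coset.order cubic_ring - 1) div 3)))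
      (0, 2, 4) (0, 0, 1) (0, 0, 0) (1, 0, 1) (1, 0, 0) (0, 1, 0) (3, 1, 0)"
      using cubic_certificate sub unfolding all_lines_def rainbow_line_def
      by (simp only: K insert_subset)
  qed
qed

section \<open>All orders\<close>

lemma has_difference_family_prime_power:
  assumes p: "prime p" "p mod 6 = 1" "p \<noteq> 13" and k: "k \<ge> 1"
  shows "has_fano_difference_family (p ^ k)"
proof -
  interpret F: cubic_field "residue_ring (int p)" by (rule prime_field(1)[OF p(1,2)])
  have "\<exists>b. rainbow_heptad (residue_ring (int p)) b"
  proof (cases "p < 6400")
    case True
    then show ?thesis using rainbow_heptad_of_small_prime p by blast
  next
    case False
    then show ?thesis using F.rainbow_heptad_of_large_order prime_field(2)[OF p(1,2)] by simp
  qed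
  then show ?thesis using F.has_difference_family_power k prime_field(2)[OF p(1,2)] by metis
qed

lemma has_difference_family_prime_square_power:
  assumes p: "prime p" "p mod 6 = 5" and k: "k \<ge> 1"
  shows "has_fano_difference_family ((p ^ 2) ^ k)"
proof -
  let ?R = "quadratic_ring (int p) (-1) (-1)"
  interpret F: cubic_field ?R by (rule eisenstein_field[OF p])
  have "\<exists>b. rainbow_heptad ?R b"
  proof (cases "p < 80")
    case True
    have mem: "p \<in> {5, 11, 17, 23, 29, 41, 47, 53, 59, 71}"
    proof -
      have "j \<in> {0, 1, 2, 3, 4, 5, 6, 7, 8, 9, 10, 11, 12}" if "j < 13" for j :: nat
        using that by simp presburger
      moreover have "p = 5 + 6 * (p div 6)" "p div 6 < 13" using p(2) True by presburger+
      ultimately have "p = 5 + 6 * (p div 6)" "p div 6 \<in> {0, 1, 2, 3, 4, 5, 6, 7, 8, 9, 10, 11, 12}"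
        by blast+
      moreover have "p \<noteq> 35" "p \<noteq> 65" "p \<noteq> 77" using p(1) by auto
      ultimately show ?thesis by (elim insertE) auto
    qed
    \<comment> \<open>The modulus is passed as an integer \<open>n\<close> because the evaluated
      certificates contain numerals in place of \<open>int p\<close>.\<close>
    have ex: ?thesis if "int p = n" "quadratic_certificate n (-1) (-1) x0 x1 x2 x3 x4 x5 x6"
      "set [x0, x1, x2, x3, x4, x5, x6] \<subseteq> {0..<n} \<times> {0..<n}" for n x0 x1 x2 x3 x4 x5 x6
      using rainbow_heptad_of_quadratic_certificate[OF F.is_cring prime_gt_1_nat[OF p(1)]] that by blast
    from mem show ?thesis
    proof (elim insertE emptyE)
      assume "p = 5"
      then show ?thesis by (intro ex[OF _ quadratic_heptads(1)]) simp_all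
    next
      assume "p = 11"
      then show ?thesis by (intro ex[OF _ quadratic_heptads(2)]) simp_all
    next
      assume "p = 17"
      then show ?thesis by (intro ex[OF _ quadratic_heptads(3)]) simp_all
    next
      assume "p = 23"
      then show ?thesis by (intro ex[OF _ quadratic_heptads(4)]) simp_all
    next
      assume "p = 29"
      then show ?thesis by (intro ex[OF _ quadratic_heptads(5)]) simp_all
    next
      assume "p = 41"
      then show ?thesis by (intro ex[OF _ quadratic_heptads(6)]) simp_all
    next
      assume "p = 47"
      then show ?thesis by (intro ex[OF _ quadratic_heptads(7)]) simp_all
    next
      assume "p = 53"
      then show ?thesis by (intro ex[OF _ quadratic_heptads(8)]) simp_all
    next
      assume "p = 59"
      then show ?thesis by (intro ex[OF _ quadratic_heptads(9)]) simp_all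
    next
      assume "p = 71"
      then show ?thesis by (intro ex[OF _ quadratic_heptads(10)]) simp_all
    qed
  next
    case False
    then have "80 ^ 2 \<le> p ^ 2" by (intro power_mono) auto
    then show ?thesis using F.rainbow_heptad_of_large_order order_quadratic_ring[of p] by simp
  qed
  then show ?thesis using F.has_difference_family_power k order_quadratic_ring by metis
qed

lemma sqrt2_irreducible_mod_13:
  assumes "int 13 dvd a * a + 0 * (a * b) - 2 * (b * b)"
  shows "int 13 dvd a \<and> int 13 dvd b"
proof -
  have range: "x mod 13 \<in> {0, 1, 2, 3, 4, 5, 6, 7, 8, 9, 10, 11, 12}" for x :: int
    by simp presburger
  have sq: "x * x mod 13 \<in> {1, 3, 4, 9, 10, 12} \<or> x mod 13 = 0" for x :: int
    using range[of x] mod_mult_eq[of x 13 x] by (elim insertE emptyE) auto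
  have sq0: "x * x mod 13 = 0" if "x mod 13 = 0" for x :: int
    using that by (simp add: dvd_eq_mod_eq_0[symmetric])
  have ab: "a * a mod 13 = 2 * (b * b mod 13) mod 13"
    using assms by (simp add: mod_eq_dvd_iff mod_mult_right_eq)
  have "b mod 13 = 0"
  proof (rule ccontr)
    assume "b mod 13 \<noteq> 0"
    then have "b * b mod 13 \<in> {1, 3, 4, 9, 10, 12}" using sq[of b] by simp
    \<comment> \<open>Doubling maps the nonzero squares modulo 13 to nonsquares, as 2 is itself a
      nonsquare.\<close>
    then have "a * a mod 13 \<in> {2, 6, 8, 5, 7, 11}" unfolding ab by (elim insertE emptyE) simp_all
    then show False using sq[of a] sq0[of a] by auto
  qed
  moreover from this have "a mod 13 = 0" using ab sq0[of b] sq[of a] by auto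
  ultimately show ?thesis by (simp add: dvd_eq_mod_eq_0)
qed

text \<open>Even exponents are powers of the field of order \<open>13\<^sup>2\<close>. An odd
  exponent is at least 3 and uses the field of order \<open>13 ^ 3\<close> once, followed by factors
  \<open>13\<^sup>2\<close>.\<close>

lemma has_difference_family_power_13:
  assumes k: "k \<ge> 2"
  shows "has_fano_difference_family (13 ^ k)"
proof -
  let ?R = "quadratic_ring (int 13) 0 2"
  have "field ?R"
  proof (rule quadratic_field)
    show "prime (13 :: nat)" by simp
  qed (rule sqrt2_irreducible_mod_13)
  moreover have "finite (carrier ?R)" by (simp add: quadratic_ring_def)
  ultimately interpret F: cubic_field ?R
    by (intro cubic_field.intro cubic_field_axioms.intro) (simp_all only: order_quadratic_ring, simp)
  have b: "rainbow_heptad ?R (seven (4, 1) (3, 1) (0, 0) (1, 2) (1, 0) (0, 1) (2, 5))"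
    using quadratic_heptads(11) by (intro rainbow_heptad_of_quadratic_certificate F.is_cring) auto
  interpret C: cubic_field cubic_ring
    by (intro cubic_field.intro cubic_field_axioms.intro cubic_ring_field)
      (simp_all add: order_cubic_ring, simp add: cubic_ring_def)
  have ord: "Coset.order ?R = 13 ^ 2" by (rule order_quadratic_ring)
  show ?thesis
  proof (cases "even k")
    case True
    then obtain j where "k = 2 * j" by blast
    then show ?thesis using F.has_difference_family_power[OF b, of j, unfolded ord] k by (simp add: power_mult)
  next
    case False
    then obtain j where "k = 2 * j + 1" by (elim oddE)
    with k obtain i where "k = 3 + 2 * i" by (cases j) auto
    moreover have "has_fano_difference_family 2197"
      using C.has_difference_family_of_rainbow_heptad(1)[OF rainbow_heptad_cubic_ring] by (simp add: order_cubic_ring)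
    ultimately show ?thesis
      using F.has_difference_family_mult_power[OF b, of 2197 i, unfolded ord] by (simp add: power_add power_mult)
  qed
qed

theorem theorem13:
  fixes q :: nat
  assumes "primepow q" and "[q = 1] (mod 6)" and "q \<noteq> 13"
  shows "\<exists>(V :: nat set) (F :: nat colored_plane set). regular_fano_kaleidoscope q V F"
proof (rule regular_kaleidoscope_of_has_difference_family)
  obtain p k where p: "prime p" "k > 0" "q = p ^ k"
    using assms(1) unfolding primepow_def by blast
  have q6: "p ^ k mod 6 = 1" using assms(2) p(3) by (simp add: unique_euclidean_semiring_class.cong_def)
  have pk: "(p mod 6) ^ k mod 6 = 1" using q6 by (simp add: power_mod)
  have "\<not> 2 dvd p" "\<not> 3 dvd p"
  proof -
    have "\<not> 2 dvd p ^ k" "\<not> 3 dvd p ^ k" using q6 by presburger+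
    then show "\<not> 2 dvd p" "\<not> 3 dvd p" using p(2) by (meson dvd_power dvd_trans)+
  qed
  then have "p mod 6 = 1 \<or> p mod 6 = 5" by presburger
  then consider "p mod 6 = 1" | "p mod 6 = 5" by blast
  then show "has_fano_difference_family q"
  proof cases
    case 1
    show ?thesis
    proof (cases "p = 13")
      case True
      then have "k \<noteq> 1" using assms(3) p(3) by auto
      then show ?thesis using has_difference_family_power_13[of k] p True by simp
    next
      case False
      then show ?thesis using has_difference_family_prime_power[OF p(1) 1] p by simp
    qed
  next
    case 2
    \<comment> \<open>Here \<open>p\<close> is -1 modulo 6, so an odd power of it would be -1 as
      well.\<close>
    have "even k"
    proof (rule ccontr)
      assume "odd k"
      then obtain j where "k = 2 * j + 1" by (elim oddE)
      moreover have "(5 :: nat) ^ (2 * j) mod 6 = 1"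
        using power_mod[of 25 "6 :: nat" j] by (simp add: power_mult)
      ultimately have "(5 :: nat) ^ k mod 6 = 5" by (simp add: mod_mult_right_eq[symmetric])
      then show False using pk 2 by simp
    qed
    then obtain j where "k = 2 * j" by blast
    then show ?thesis using has_difference_family_prime_square_power[OF p(1) 2, of j] p by (simp add: power_mult)
  qed
qed

end
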